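(* Let $E$ be locally complete and let $G\subset E'$ be a linear subspace which determines boundedness. Let $(T^{E}_{m},T^{\mathbb{K}}_{m})_{m\in\mathcal{M}}$ be a strong, consistent family for $(\mathcal{FV},E)$, let $\mathcal{FV}(\Omega)$ be a Fréchet–Schwartz space and $U$ a set of uniqueness for $\mathcal{FV}(\Omega)$. Then the restriction map \[ R_{U,G}\colon S(\mathcal{FV}(\Omega)\varepsilon E)\to \mathcal{FV}_{G}(U,E),\quad f\mapsto (T^{E}_{m}(f)(x))_{(m,x)\in U}, \] is surjective.
   Context: $\mathbb{K}\in\{\mathbb{R},\mathbb{C}\}$; $E$ is a non-trivial locally convex Hausdorff space (lcHs) over $\mathbb{K}$ with a directed fundamental system of seminorms $(p_\alpha)_{\alpha\in\mathfrak{A}}$ (for $E=\mathbb{K}$: $\{|\cdot|\}$); $E'$ its dual. $E$ is locally complete if for every closed bounded absolutely convex $D\subset E$ the space $\bigcup_n nD$ normed by the gauge of $D$ is a Banach space. A linear subspace $G\subset E'$ determines boundedness if every $\sigma(E,G)$-bounded subset of $E$ is bounded in $E$ (such $G$ is separating, i.e. $e'(x)=0$ for all $e'\in G$ implies $x=0$). Weighted function spaces: Let $\Omega,J,L$ be non-empty sets, $(M_l)_{l\in L}$ non-empty sets and $\mathcal{V}=((\nu_{j,l,m})_{m\in M_l})_{j\in J,l\in L}$ functions $\nu_{j,l,m}\colon\Omega\to[0,\infty)$ such that for all $x\in\Omega$, $l\in L$ there is $j\in J$ with $\nu_{j,l,m}(x)>0$ for all $m\in M_l$. Let $\mathcal{M}_{\mathrm{top}}:=\bigcup_lM_l$,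 and $\mathcal{M}_0,\mathcal{M}_r$ sets, the three pairwise disjoint, $\mathcal{M}$ their union; $(\omega_m)_{m\in\mathcal{M}}$ non-empty sets with $\Omega\subset\omega_m$ for $m\in\mathcal{M}_{\mathrm{top}}$. For $F\in\{E,\mathbb{K}\}$ let $T^F_m\colon\operatorname{dom}T^F_m\subset F^\Omega\to F^{\omega_m}$ be linear, $m\in\mathcal{M}$. $\mathcal{FV}(\Omega,F)$ is the set of $f\in\bigcap_{m\in\mathcal{M}}\operatorname{dom}T^F_m\cap\bigcap_{m\in\mathcal{M}_0}\ker T^F_m$ with $|f|_{j,l,\alpha}:=\sup_{x\in\Omega,m\in M_l}p_\alpha(T^F_m(f)(x))\nu_{j,l,m}(x)<\infty$ for all $j,l,\alpha$, topologised by these seminorms; $\mathcal{FV}(\Omega):=\mathcal{FV}(\Omega,\mathbb{K})$. $T^F_{m,x}(f):=T^F_m(f)(x)$. Such a space is a dom-space if its seminorm system is directed and, in the scalar case, all point evaluations $\delta_x\colon f\mapsto f(x)$ are continuous. $\mathcal{FV}(\Omega)\varepsilon E$ is the space of continuous linear maps $\mathcal{FV}(\Omega)'_\kappa\to E$ ($\kappa$: uniform convergence on absolutely convex compact sets) with topology of uniform convergence on equicontinuous sets; $S(u)(x):=u(\delta_x)$. With $\mathcal{FV}(\Omega)$, $\mathcal{FV}(\Omega,E)$ dom-spaces built from the same data with operators $T^{\mathbb{K}}_m$, $T^E_m$, the family $(T^E_m,T^{\mathbb{K}}_m)_{m\in\mathcal{M}}$ is consistent if for all $u\in\mathcal{FV}(\Omega)\varepsilon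 E$, $m\in\mathcal{M}$, $x\in\omega_m$: $S(u)\in\operatorname{dom}T^E_m$, $T^{\mathbb{K}}_{m,x}|_{\mathcal{FV}(\Omega)}\in\mathcal{FV}(\Omega)'$, and $T^E_m(S(u))(x)=u(T^{\mathbb{K}}_{m,x})$; it is strong if for all $e'\in E'$, $f\in\mathcal{FV}(\Omega,E)$, $m$: $e'\circ f\in\operatorname{dom}T^{\mathbb{K}}_m$ and $T^{\mathbb{K}}_m(e'\circ f)=e'\circ T^E_m(f)$ on $\omega_m$. $U\subset\bigcup_m\{m\}\times\omega_m$ is a set of uniqueness for $\mathcal{FV}(\Omega)$ if $T^{\mathbb{K}}_{m,x}\in\mathcal{FV}(\Omega)'$ for $(m,x)\in U$ and $f\in\mathcal{FV}(\Omega)$, $T^{\mathbb{K}}_m(f)(x)=0$ for all $(m,x)\in U$ imply $f=0$. $\mathcal{FV}_G(U,E)$ is the set of $f\colon U\to E$ such that for each $e'\in G$ there is $f_{e'}\in\mathcal{FV}(\Omega)$ with $T^{\mathbb{K}}_m(f_{e'})(x)=e'(f(m,x))$ for all $(m,x)\in U$. Under the hypotheses $R_{U,G}$ takes values in $\mathcal{FV}_G(U,E)$. *)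

theory Defs
  imports Complex_Main "HOL-Library.Function_Algebras"
begin

text \<open>A locally convex space is given by a carrier X (a linear subspace of a type 'v
  with an abelian group structure), a scalar multiplication s by scalars of type 'k,
  an index set I and seminorms q i, i in I. The topology is the one induced by the seminorms.\<close>

definition lc_open :: "'v::ab_group_add set \<Rightarrow> 'i set \<Rightarrow> ('i \<Rightarrow> 'v \<Rightarrow> real) \<Rightarrow> 'v set \<Rightarrow> bool" where
  "lc_open X I q U \<longleftrightarrow> U \<subseteq> X \<and>
     (\<forall>x\<in>U. \<exists>F. finite F \<and> F \<subseteq> I \<and> (\<exists>\<epsilon>>0. {y\<in>X. \<forall>i\<in>F. q i (y - x) < \<epsilon>} \<subseteq> U))"

definition lc_closed :: "'v::ab_group_add set \<Rightarrow> 'i set \<Rightarrow> ('i \<Rightarrow> 'v \<Rightarrow> real) \<Rightarrow> 'v set \<Rightarrow> bool" where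
  "lc_closed X I q C \<longleftrightarrow> C \<subseteq> X \<and> lc_open X I q (X - C)"

definition lc_compact :: "'v::ab_group_add set \<Rightarrow> 'i set \<Rightarrow> ('i \<Rightarrow> 'v \<Rightarrow> real) \<Rightarrow> 'v set \<Rightarrow> bool" where
  "lc_compact X I q K \<longleftrightarrow> K \<subseteq> X \<and>
     (\<forall>\<U>. (\<forall>U\<in>\<U>. lc_open X I q U) \<and> K \<subseteq> \<Union>\<U> \<longrightarrow> (\<exists>\<V>\<subseteq>\<U>. finite \<V> \<and> K \<subseteq> \<Union>\<V>))"

definition lc_bounded :: "'v set \<Rightarrow> 'i set \<Rightarrow> ('i \<Rightarrow> 'v \<Rightarrow> real) \<Rightarrow> 'v set \<Rightarrow> bool" where
  "lc_bounded X I q B \<longleftrightarrow> B \<subseteq> X \<and> (\<forall>i\<in>I. bdd_above (q i ` B))"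

definition absconvex :: "('k::real_normed_field \<Rightarrow> 'v::ab_group_add \<Rightarrow> 'v) \<Rightarrow> 'v set \<Rightarrow> bool" where
  "absconvex s K \<longleftrightarrow> (\<forall>x\<in>K. \<forall>y\<in>K. \<forall>a b. norm a + norm b \<le> 1 \<longrightarrow> s a x + s b y \<in> K)"

definition directed_seminorms :: "'v set \<Rightarrow> 'i set \<Rightarrow> ('i \<Rightarrow> 'v \<Rightarrow> real) \<Rightarrow> bool" where
  "directed_seminorms X I q \<longleftrightarrow> (\<forall>i1\<in>I. \<forall>i2\<in>I. \<exists>i3\<in>I. \<exists>C. \<forall>x\<in>X. q i1 x \<le> C * q i3 x \<and> q i2 x \<le> C * q i3 x)"

text \<open>The (topological) dual of (X, q): continuous linear functionals on X.
  To make functionals unique as HOL functions they are taken to vanish outside X.\<close>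
definition lc_dual :: "'v::ab_group_add set \<Rightarrow> ('k::real_normed_field \<Rightarrow> 'v \<Rightarrow> 'v) \<Rightarrow> 'i set \<Rightarrow> ('i \<Rightarrow> 'v \<Rightarrow> real)
    \<Rightarrow> ('v \<Rightarrow> 'k) set" where
  "lc_dual X s I q = {\<phi>. (\<forall>x\<in>X. \<forall>y\<in>X. \<phi> (x + y) = \<phi> x + \<phi> y) \<and> (\<forall>c. \<forall>x\<in>X. \<phi> (s c x) = c * \<phi> x)
      \<and> (\<forall>y. y \<notin> X \<longrightarrow> \<phi> y = 0)
      \<and> (\<exists>F C. finite F \<and> F \<subseteq> I \<and> (\<forall>x\<in>X. norm (\<phi> x) \<le> C * (\<Sum>i\<in>F. q i x)))}"

definition restr :: "'v set \<Rightarrow> ('v \<Rightarrow> 'k::zero) \<Rightarrow> 'v \<Rightarrow> 'k" where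
  "restr X \<phi> = (\<lambda>f. if f \<in> X then \<phi> f else 0)"

definition lcHs :: "('k::real_normed_field \<Rightarrow> 'e::ab_group_add \<Rightarrow> 'e) \<Rightarrow> 'a set \<Rightarrow> ('a \<Rightarrow> 'e \<Rightarrow> real) \<Rightarrow> bool" where
  "lcHs s A p \<longleftrightarrow> Vector_Spaces.vector_space s \<and> A \<noteq> {}
     \<and> (\<forall>\<alpha>\<in>A. \<forall>x y. p \<alpha> (x + y) \<le> p \<alpha> x + p \<alpha> y)
     \<and> (\<forall>\<alpha>\<in>A. \<forall>c x. p \<alpha> (s c x) = norm c * p \<alpha> x)
     \<and> (\<forall>x. (\<forall>\<alpha>\<in>A. p \<alpha> x = 0) \<longrightarrow> x = 0)"

text \<open>Local completeness: for every closed bounded absolutely convex D the space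
  E_D = union of n D, normed by the gauge (Minkowski functional) of D, is a Banach space.\<close>
definition span_abs :: "('k::real_normed_field \<Rightarrow> 'e \<Rightarrow> 'e) \<Rightarrow> 'e set \<Rightarrow> 'e set" where
  "span_abs s D = {s (of_nat n) d | n d. d \<in> D}"

definition gauge_of :: "('k::real_normed_field \<Rightarrow> 'e \<Rightarrow> 'e) \<Rightarrow> 'e set \<Rightarrow> 'e \<Rightarrow> real" where
  "gauge_of s D x = Inf {t::real. t > 0 \<and> (\<exists>d\<in>D. x = s (of_real t) d)}"

definition locally_complete :: "('k::real_normed_field \<Rightarrow> 'e::ab_group_add \<Rightarrow> 'e) \<Rightarrow> 'a set \<Rightarrow> ('a \<Rightarrow> 'e \<Rightarrow> real) \<Rightarrow> bool" where
  "locally_complete s A p \<longleftrightarrow> (\<forall>D. lc_closed UNIV A p D \<and> lc_bounded UNIV A p D \<and> absconvex s D \<longrightarrow>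
      (\<forall>xs. (\<forall>n. xs n \<in> span_abs s D)
          \<and> (\<forall>\<epsilon>>0. \<exists>N. \<forall>m\<ge>N. \<forall>n\<ge>N. gauge_of s D (xs m - xs n) < \<epsilon>)
        \<longrightarrow> (\<exists>x\<in>span_abs s D. (\<lambda>n. gauge_of s D (xs n - x)) \<longlonglongrightarrow> 0)))"

definition determines_boundedness :: "'a set \<Rightarrow> ('a \<Rightarrow> 'e \<Rightarrow> real) \<Rightarrow> ('e \<Rightarrow> 'k::real_normed_field) set \<Rightarrow> bool" where
  "determines_boundedness A p G \<longleftrightarrow>
     (\<forall>B. (\<forall>g\<in>G. bdd_above ((\<lambda>x. norm (g x)) ` B)) \<longrightarrow> lc_bounded UNIV A p B)"

definition linear_subspace_fun :: "('e \<Rightarrow> 'k::real_normed_field) set \<Rightarrow> bool" where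
  "linear_subspace_fun G \<longleftrightarrow> (\<lambda>x. 0) \<in> G \<and> (\<forall>g\<in>G. \<forall>h\<in>G. (\<lambda>x. g x + h x) \<in> G)
     \<and> (\<forall>c. \<forall>g\<in>G. (\<lambda>x. c * g x) \<in> G)"

definition lc_metrizable :: "'v set \<Rightarrow> 'i set \<Rightarrow> ('i \<Rightarrow> 'v \<Rightarrow> real) \<Rightarrow> bool" where
  "lc_metrizable X I q \<longleftrightarrow> (\<exists>idx::nat \<Rightarrow> 'i. range idx \<subseteq> I \<and>
      (\<forall>i\<in>I. \<exists>n C. \<forall>x\<in>X. q i x \<le> C * q (idx n) x))"

definition lc_complete :: "'v::ab_group_add set \<Rightarrow> 'i set \<Rightarrow> ('i \<Rightarrow> 'v \<Rightarrow> real) \<Rightarrow> bool" where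
  "lc_complete X I q \<longleftrightarrow> (\<forall>F. F \<noteq> bot \<and> eventually (\<lambda>x. x \<in> X) F
      \<and> (\<forall>i\<in>I. \<forall>\<epsilon>>0. eventually (\<lambda>(x, y). q i (x - y) < \<epsilon>) (F \<times>\<^sub>F F))
     \<longrightarrow> (\<exists>x\<in>X. \<forall>i\<in>I. \<forall>\<epsilon>>0. eventually (\<lambda>y. q i (y - x) < \<epsilon>) F))"

definition lc_schwartz :: "'v::ab_group_add set \<Rightarrow> 'i set \<Rightarrow> ('i \<Rightarrow> 'v \<Rightarrow> real) \<Rightarrow> bool" where
  "lc_schwartz X I q \<longleftrightarrow> (\<forall>i\<in>I. \<exists>k\<in>I. \<forall>\<epsilon>>0. \<exists>F. finite F \<and> F \<subseteq> X \<and>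
      (\<forall>x\<in>X. q k x \<le> 1 \<longrightarrow> (\<exists>y\<in>F. q i (x - y) < \<epsilon>)))"

definition frechet_schwartz :: "'v::ab_group_add set \<Rightarrow> 'i set \<Rightarrow> ('i \<Rightarrow> 'v \<Rightarrow> real) \<Rightarrow> bool" where
  "frechet_schwartz X I q \<longleftrightarrow> lc_metrizable X I q \<and> lc_complete X I q \<and> lc_schwartz X I q"

text \<open>All sets Omega and omega_m are subsets of one ambient type 'x. Functions on Omega
  (elements of F^Omega) are represented as functions 'x => F vanishing outside Omega.\<close>

definition weight_data :: "'x set \<Rightarrow> 'j set \<Rightarrow> 'l set \<Rightarrow> ('l \<Rightarrow> 'm set) \<Rightarrow> ('j \<Rightarrow> 'l \<Rightarrow> 'm \<Rightarrow> 'x \<Rightarrow> real)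
    \<Rightarrow> 'm set \<Rightarrow> 'm set \<Rightarrow> ('m \<Rightarrow> 'x set) \<Rightarrow> bool" where
  "weight_data \<Omega> J L M \<nu> M0 Mr \<omega> \<longleftrightarrow>
     \<Omega> \<noteq> {} \<and> J \<noteq> {} \<and> L \<noteq> {} \<and> (\<forall>l\<in>L. M l \<noteq> {})
     \<and> (\<forall>j l m x. \<nu> j l m x \<ge> 0)
     \<and> (\<forall>x\<in>\<Omega>. \<forall>l\<in>L. \<exists>j\<in>J. \<forall>m\<in>M l. \<nu> j l m x > 0)
     \<and> (\<Union>l\<in>L. M l) \<inter> M0 = {} \<and> (\<Union>l\<in>L. M l) \<inter> Mr = {} \<and> M0 \<inter> Mr = {}
     \<and> (\<forall>m\<in>(\<Union>l\<in>L. M l) \<union> M0 \<union> Mr. \<omega> m \<noteq> {})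
     \<and> (\<forall>m\<in>(\<Union>l\<in>L. M l). \<Omega> \<subseteq> \<omega> m)"

abbreviation Mall :: "'l set \<Rightarrow> ('l \<Rightarrow> 'm set) \<Rightarrow> 'm set \<Rightarrow> 'm set \<Rightarrow> 'm set" where
  "Mall L M M0 Mr \<equiv> (\<Union>l\<in>L. M l) \<union> M0 \<union> Mr"

definition linear_ops :: "'x set \<Rightarrow> 'm set \<Rightarrow> ('k::real_normed_field \<Rightarrow> 'f::ab_group_add \<Rightarrow> 'f)
    \<Rightarrow> ('m \<Rightarrow> 'x set) \<Rightarrow> ('m \<Rightarrow> ('x \<Rightarrow> 'f) set) \<Rightarrow> ('m \<Rightarrow> ('x \<Rightarrow> 'f) \<Rightarrow> 'x \<Rightarrow> 'f) \<Rightarrow> bool" where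
  "linear_ops \<Omega> MM s \<omega> Dm T \<longleftrightarrow> (\<forall>m\<in>MM.
      Dm m \<subseteq> {f. \<forall>x. x \<notin> \<Omega> \<longrightarrow> f x = 0} \<and> (\<lambda>x. 0) \<in> Dm m
      \<and> (\<forall>f\<in>Dm m. \<forall>g\<in>Dm m. (\<lambda>x. f x + g x) \<in> Dm m \<and>
           (\<forall>x\<in>\<omega> m. T m (\<lambda>x. f x + g x) x = T m f x + T m g x))
      \<and> (\<forall>c. \<forall>f\<in>Dm m. (\<lambda>x. s c (f x)) \<in> Dm m \<and> (\<forall>x\<in>\<omega> m. T m (\<lambda>x. s c (f x)) x = s c (T m f x))))"

definition FVsp :: "'x set \<Rightarrow> 'j set \<Rightarrow> 'l set \<Rightarrow> ('l \<Rightarrow> 'm set) \<Rightarrow> ('j \<Rightarrow> 'l \<Rightarrow> 'm \<Rightarrow> 'x \<Rightarrow> real)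
    \<Rightarrow> 'm set \<Rightarrow> 'm set \<Rightarrow> ('m \<Rightarrow> 'x set) \<Rightarrow> 'a set \<Rightarrow> ('a \<Rightarrow> 'f::zero \<Rightarrow> real)
    \<Rightarrow> ('m \<Rightarrow> ('x \<Rightarrow> 'f) set) \<Rightarrow> ('m \<Rightarrow> ('x \<Rightarrow> 'f) \<Rightarrow> 'x \<Rightarrow> 'f) \<Rightarrow> ('x \<Rightarrow> 'f) set" where
  "FVsp \<Omega> J L M \<nu> M0 Mr \<omega> A p Dm T = {f.
      (\<forall>m\<in>Mall L M M0 Mr. f \<in> Dm m) \<and> (\<forall>m\<in>M0. \<forall>x\<in>\<omega> m. T m f x = 0)
      \<and> (\<forall>j\<in>J. \<forall>l\<in>L. \<forall>\<alpha>\<in>A. bdd_above {p \<alpha> (T m f x) * \<nu> j l m x | x m. x \<in> \<Omega> \<and> m \<in> M l})}"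

definition FVsemi :: "'x set \<Rightarrow> ('l \<Rightarrow> 'm set) \<Rightarrow> ('j \<Rightarrow> 'l \<Rightarrow> 'm \<Rightarrow> 'x \<Rightarrow> real)
    \<Rightarrow> ('a \<Rightarrow> 'f \<Rightarrow> real) \<Rightarrow> ('m \<Rightarrow> ('x \<Rightarrow> 'f) \<Rightarrow> 'x \<Rightarrow> 'f) \<Rightarrow> 'j \<times> 'l \<times> 'a \<Rightarrow> ('x \<Rightarrow> 'f) \<Rightarrow> real" where
  "FVsemi \<Omega> M \<nu> p T = (\<lambda>(j, l, \<alpha>) f. (SUP (x, m) \<in> \<Omega> \<times> M l. p \<alpha> (T m f x) * \<nu> j l m x))"

definition fscale :: "('k \<Rightarrow> 'f \<Rightarrow> 'f) \<Rightarrow> 'k \<Rightarrow> ('x \<Rightarrow> 'f) \<Rightarrow> 'x \<Rightarrow> 'f" where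
  "fscale s c f = (\<lambda>x. s c (f x))"

text \<open>X eps E for a function space X \<subseteq> 'x => 'k with seminorms (I, q): continuous linear maps
  from the dual of X with the topology kappa of uniform convergence on absolutely convex
  compact sets into E.\<close>
definition eps_prod :: "('x \<Rightarrow> 'k::real_normed_field) set \<Rightarrow> 'i set \<Rightarrow> ('i \<Rightarrow> ('x \<Rightarrow> 'k) \<Rightarrow> real)
    \<Rightarrow> ('k \<Rightarrow> 'e::ab_group_add \<Rightarrow> 'e) \<Rightarrow> 'a set \<Rightarrow> ('a \<Rightarrow> 'e \<Rightarrow> real) \<Rightarrow> ((('x \<Rightarrow> 'k) \<Rightarrow> 'k) \<Rightarrow> 'e) set" where
  "eps_prod X I q s A p = {u.
      (\<forall>\<phi>\<in>lc_dual X (fscale (*)) I q. \<forall>\<psi>\<in>lc_dual X (fscale (*)) I q. u (\<lambda>f. \<phi> f + \<psi> f) = u \<phi> + u \<psi>)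
    \<and> (\<forall>c. \<forall>\<phi>\<in>lc_dual X (fscale (*)) I q. u (\<lambda>f. c * \<phi> f) = s c (u \<phi>))
    \<and> (\<forall>\<alpha>\<in>A. \<exists>K C. K \<noteq> {} \<and> lc_compact X I q K \<and> absconvex (fscale (*)) K \<and>
         (\<forall>\<phi>\<in>lc_dual X (fscale (*)) I q. p \<alpha> (u \<phi>) \<le> C * (SUP f\<in>K. norm (\<phi> f))))}"

definition Smap :: "('x \<Rightarrow> 'k::zero) set \<Rightarrow> 'x set \<Rightarrow> ((('x \<Rightarrow> 'k) \<Rightarrow> 'k) \<Rightarrow> 'e::zero) \<Rightarrow> 'x \<Rightarrow> 'e" where
  "Smap X \<Omega> u = (\<lambda>x. if x \<in> \<Omega> then u (restr X (\<lambda>f. f x)) else 0)"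

end

theory Submission
  imports Defs "HOL-Analysis.Analysis"
begin

text \<open>For \<phi> in the dual of the scalar space, at most one vector e satisfies g e = \<phi> (f g) for all
  g in G, where f g is the element of the scalar space that interpolates g \<circ> F. The functionals for
  which such an e exists form a subspace H that contains the functionals indexed by U, hence separates
  points. The vectors e that belong to an equicontinuous set of functionals are bounded for G, hence
  lie in a bounded Banach disc, and local completeness makes H closed for limits that are uniform on a
  neighbourhood of zero. The construction of Banach and Dieudonne yields a null sequence through which
  a functional outside H is uniformly separated from H; the Hahn--Banach theorem in the space of null
  sequences turns this into an absolutely convergent series, whose sum is a non-zero element
  annihilated by H. So H is the whole dual. The map sending \<phi> to e is bounded on equicontinuous sets,
  and the same construction shows that its seminorms are dominated by suprema over the absolutely
  convex compact hull of a null sequence.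

  Ostrowski's argument shows that the scalar field is the real or the complex field; this gives
  compactness of its balls and reduces the Hahn--Banach theorem to the real case.\<close>

section \<open>Normed fields over the reals\<close>

text \<open>The obstacle is that local completeness produces vectors only as limits inside one disc,
  in the norm of its gauge, while equality of H with the dual calls for closedness under pointwise
  limits. The Schwartz property bridges the two: on the polar of one neighbourhood of zero,
  pointwise limits are uniform on the next, smaller neighbourhood. Each polar needs its own finite
  set of test points, and choosing these points ever smaller turns their union into a null sequence.
  Separation along a null sequence takes place in c_0, whose dual is l^1, and l^1 coefficients sum a
  null sequence in a Frechet space; this is how a separating functional becomes a point of the space
  instead of a point of its bidual. A second obstacle is the topology kappa: boundedness on
  equicontinuous sets names no compact set. Applied to the set of functionals at which the
  pulled-back seminorm is at least 1, the same null sequence construction provides one.\<close>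

definition conj_quadratic :: "complex \<Rightarrow> 'k::real_normed_field \<Rightarrow> 'k" where
  "conj_quadratic z x = (x - of_real (Re z))\<^sup>2 + (of_real (Im z))\<^sup>2"

text \<open>\<open>conj_quadratic z\<close> is the real polynomial with the roots z and its
  conjugate, evaluated in a field where z need not exist. With X = x - Re z, t = Im z and Y = X^2 +
  t^2, the factor Y - w of the outer polynomial is X^2 - g^2 = (X - g) (X + g). The conjugate factor
  splits likewise, and conjugate pairs regroup to real quadratics.\<close>

lemma conj_quadratic_factor:
  fixes x :: "'k::real_normed_field"
  assumes "g\<^sup>2 = w - of_real ((Im z)\<^sup>2)"
  shows "conj_quadratic w (conj_quadratic z x) =
    conj_quadratic (of_real (Re z) + g) x * conj_quadratic (of_real (Re z) - g) x"
proof -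
  define X :: 'k where "X = x - of_real (Re z)"
  define a b t :: 'k where "a = of_real (Re g)" and "b = of_real (Im g)" and "t = of_real (Im z)"
  have "Re w = (Re g)\<^sup>2 - (Im g)\<^sup>2 + (Im z)\<^sup>2" "Im w = 2 * Re g * Im g"
    using arg_cong[OF assms, of Re] arg_cong[OF assms, of Im]
    by (simp_all add: power2_eq_square mult.commute)
  then have w: "of_real (Re w) = a\<^sup>2 - b\<^sup>2 + t\<^sup>2" "of_real (Im w) = 2 * a * b"
    by (simp_all add: a_def b_def t_def)
  have "conj_quadratic w (conj_quadratic z x) = (X\<^sup>2 + t\<^sup>2 - (a\<^sup>2 - b\<^sup>2 + t\<^sup>2))\<^sup>2 + (2 * a * b)\<^sup>2"
    unfolding conj_quadratic_def w X_def t_def by simp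
  also have "\<dots> = ((X - a)\<^sup>2 + b\<^sup>2) * ((X + a)\<^sup>2 + b\<^sup>2)"
    by (simp add: power2_eq_square algebra_simps)
  finally show ?thesis
    by (simp add: conj_quadratic_def X_def a_def b_def algebra_simps)
qed

text \<open>Outside the disc of radius 3 |x| the term |z|^2 dominates the others, and the norm is at
  least |x|^2, which is its value at z = 0. So the minimum over the compact disc is global.\<close>

lemma conj_quadratic_minimum:
  fixes x :: "'k::real_normed_field"
  obtains z where "\<And>w. norm (conj_quadratic z x) \<le> norm (conj_quadratic w x)"
proof -
  let ?f = "\<lambda>z. norm (conj_quadratic z x)"
  have cont: "continuous_on (cball 0 (3 * norm x)) ?f"
    unfolding conj_quadratic_def by (intro continuous_intros)
  have "compact (cball (0::complex) (3 * norm x))" "cball (0::complex) (3 * norm x) \<noteq> {}"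
    by auto
  from continuous_attains_inf[OF this cont] obtain z where
    z: "z \<in> cball 0 (3 * norm x)" "\<And>w. w \<in> cball 0 (3 * norm x) \<Longrightarrow> ?f z \<le> ?f w"
    by blast
  have "?f z \<le> ?f w" for w
  proof (cases "w \<in> cball 0 (3 * norm x)")
    case False
    then have w: "3 * norm x < norm w" by simp
    have eq: "conj_quadratic w x = of_real ((norm w)\<^sup>2) - (of_real (2 * Re w) * x - x\<^sup>2)"
      unfolding conj_quadratic_def cmod_power2 by (simp add: power2_eq_square algebra_simps)
    have "norm (of_real (2 * Re w) * x - x\<^sup>2) \<le> norm (of_real (2 * Re w) * x) + norm (x\<^sup>2)"
      by (rule norm_triangle_ineq4)
    also have "\<dots> \<le> 2 * norm w * norm x + (norm x)\<^sup>2"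
      using abs_Re_le_cmod[of w] by (simp add: norm_mult norm_power mult_right_mono)
    finally have "(norm w)\<^sup>2 - (2 * norm w * norm x + (norm x)\<^sup>2) \<le> ?f w"
      using norm_triangle_ineq2[of "of_real ((norm w)\<^sup>2)" "of_real (2 * Re w) * x - x\<^sup>2"]
      unfolding eq by (simp add: norm_power)
    moreover have "2 * (norm x)\<^sup>2 \<le> (norm w)\<^sup>2 - (2 * norm w * norm x + (norm x)\<^sup>2)"
    proof -
      have "(3 * norm x) * norm x \<le> norm w * (norm w - 2 * norm x)"
        by (rule mult_mono) (use w norm_ge_zero[of x] in linarith)+
      then show ?thesis by (simp add: power2_eq_square algebra_simps)
    qed
    ultimately have "(norm x)\<^sup>2 \<le> ?f w"
      using zero_le_power2[of "norm x"] by linarith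
    moreover have "?f z \<le> ?f 0" by (rule z) simp
    ultimately show ?thesis by (simp add: conj_quadratic_def norm_power)
  qed (use z in blast)
  then show thesis using that by blast
qed

text \<open>Ostrowski: with y the minimal value and e = m / 2, the difference of the N-th powers of y and -e
  is y + e times factors of norm at least m, while its norm is at most m ^ N + e ^ N.\<close>

lemma conj_quadratic_minimum_shift:
  fixes x :: "'k::real_normed_field"
  assumes min: "\<And>w. m \<le> norm (conj_quadratic w x)" and eq: "norm (conj_quadratic z x) = m" and "0 < m"
  shows "norm (conj_quadratic z x + of_real (m / 2)) = m"
proof -
  define y where "y = conj_quadratic z x"
  define e where "e = m / 2"
  \<comment> \<open>The factorisation splits a quadratic in \<open>y\<close> into two in
    \<open>x\<close>, and a quadratic in a square into two in its root. Each of the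
    \<open>2 * 2 ^ j\<close> factors in \<open>x\<close> obtained so has norm at least
    \<open>m\<close>.\<close>
  have lower: "m ^ (2 * 2 ^ j) \<le> norm (conj_quadratic w (y ^ (2 ^ j)))" for j w
  proof (induction j arbitrary: w)
    case 0
    obtain g where "g\<^sup>2 = w - of_real ((Im z)\<^sup>2)" by (metis power2_csqrt)
    from conj_quadratic_factor[OF this, of x] show ?case
      unfolding y_def using mult_mono[OF min[of "of_real (Re z) + g"] min[of "of_real (Re z) - g"]] \<open>0 < m\<close>
      by (simp add: norm_mult power2_eq_square)
  next
    case (Suc j)
    obtain g where "g\<^sup>2 = w" by (metis power2_csqrt)
    then have "g\<^sup>2 = w - of_real ((Im 0)\<^sup>2)" by simp
    from conj_quadratic_factor[OF this, of "y ^ (2 ^ j)"]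
    have "conj_quadratic w (y ^ (2 ^ Suc j)) =
        conj_quadratic g (y ^ (2 ^ j)) * conj_quadratic (- g) (y ^ (2 ^ j))"
      by (simp add: conj_quadratic_def[of 0] flip: power_mult)
         (simp add: mult.commute)
    moreover have "m ^ (2 * 2 ^ Suc j) = m ^ (2 * 2 ^ j) * m ^ (2 * 2 ^ j)"
      by (simp flip: power_add)
    ultimately show ?case
      using mult_mono[OF Suc.IH Suc.IH] \<open>0 < m\<close> by (simp add: norm_mult)
  qed
  \<comment> \<open>Passing to \<open>Suc j\<close> multiplies by Y + c, where Y =
    \<open>y ^ (2 ^ j)\<close> and c = \<open>(- e) ^ (2 ^ j)\<close>. For the real parameter - c
    the quadratic is the square (Y + c)^2, so \<open>lower\<close> bounds this factor from below.
    The extra \<open>m\<close> on the right makes j = 0 an equality.\<close>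
  have prod: "norm (y + of_real e) * m ^ (2 ^ j) \<le> m * norm (y ^ (2 ^ j) - of_real (- e) ^ (2 ^ j))" for j
  proof (induction j)
    case 0
    then show ?case by simp
  next
    case (Suc j)
    let ?c = "(- e) ^ (2 ^ j)" and ?Y = "y ^ (2 ^ j)"
    have "(m ^ (2 ^ j))\<^sup>2 \<le> (norm (?Y + of_real ?c))\<^sup>2"
      using lower[of j "of_real (- ?c)"]
      by (simp add: conj_quadratic_def norm_power mult.commute flip: power_mult)
    then have "m ^ (2 ^ j) \<le> norm (?Y + of_real ?c)"
      by (rule power2_le_imp_le) simp
    from mult_mono[OF Suc.IH this] \<open>0 < m\<close>
    have "norm (y + of_real e) * (m ^ (2 ^ j))\<^sup>2 \<le> m * norm ((?Y - of_real ?c) * (?Y + of_real ?c))"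
      by (simp add: norm_mult power2_eq_square mult.assoc)
    also have "(?Y - of_real ?c) * (?Y + of_real ?c) = ?Y\<^sup>2 - (of_real ?c)\<^sup>2"
      by (simp add: power2_eq_square algebra_simps)
    also have "\<dots> = y ^ (2 ^ Suc j) - of_real (- e) ^ (2 ^ Suc j)"
      by (simp add: mult.commute flip: power_mult of_real_power)
    finally show ?case by (simp add: mult.commute flip: power_mult)
  qed
  have bound: "norm (y + of_real e) \<le> m * (1 + (1 / 2) ^ (2 ^ j))" for j
  proof -
    have "norm (y ^ (2 ^ j) - of_real (- e) ^ (2 ^ j)) \<le> norm (y ^ (2 ^ j)) + norm (of_real (- e) ^ (2 ^ j) :: 'k)"
      by (rule norm_triangle_ineq4)
    also have "\<dots> = m ^ (2 ^ j) * (1 + (1 / 2) ^ (2 ^ j))"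
      using eq \<open>0 < m\<close> by (simp add: y_def e_def norm_power power_divide algebra_simps)
    finally have "norm (y + of_real e) * m ^ (2 ^ j) \<le> m * (m ^ (2 ^ j) * (1 + (1 / 2) ^ (2 ^ j)))"
      using prod[of j] \<open>0 < m\<close> by (meson mult_left_mono order_trans less_imp_le)
    then have "norm (y + of_real e) * m ^ (2 ^ j) \<le> (m * (1 + (1 / 2) ^ (2 ^ j))) * m ^ (2 ^ j)"
      by (simp only: ac_simps)
    then show ?thesis using \<open>0 < m\<close> by (simp only: mult_le_cancel_right_pos zero_less_power)
  qed
  have "norm (y + of_real e) \<le> m"
  proof (rule LIMSEQ_le_const)
    have "(\<lambda>n. (1 / 2) ^ n :: real) \<longlonglongrightarrow> 0" by (simp add: LIMSEQ_power_zero)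
    from LIMSEQ_subseq_LIMSEQ[OF this, of "\<lambda>j. 2 ^ j"]
    have "(\<lambda>j. (1 / 2) ^ (2 ^ j) :: real) \<longlonglongrightarrow> 0"
      by (simp add: strict_mono_def o_def)
    then show "(\<lambda>j. m * (1 + (1 / 2) ^ (2 ^ j))) \<longlonglongrightarrow> m"
      by (auto intro!: tendsto_eq_intros)
  qed (use bound in blast)
  \<comment> \<open>Adding a positive real only enlarges the squared imaginary part, so the shifted
    element is again a value of the quadratic at \<open>x\<close>.\<close>
  moreover have "m \<le> norm (y + of_real e)"
  proof -
    have "(Im z)\<^sup>2 + e \<ge> 0" using \<open>0 < m\<close> by (simp add: e_def)
    then have "(of_real (sqrt ((Im z)\<^sup>2 + e)))\<^sup>2 = (of_real ((Im z)\<^sup>2 + e) :: 'k)"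
      by (simp flip: of_real_power)
    then have "y + of_real e = conj_quadratic (Complex (Re z) (sqrt ((Im z)\<^sup>2 + e))) x"
      by (simp add: y_def conj_quadratic_def add.assoc)
    then show ?thesis using min by simp
  qed
  ultimately show ?thesis by (simp add: y_def e_def)
qed

text \<open>A positive minimum m, attained at y, would be attained again after each shift by m / 2,
  so y + k m / 2 would have norm m for all k. The triangle inequality bounds k m / 2 by 2 m, which
  fails for large k.\<close>

lemma conj_quadratic_root:
  fixes x :: "'k::real_normed_field"
  obtains z where "conj_quadratic z x = 0"
proof -
  obtain z0 where z0: "\<And>w. norm (conj_quadratic z0 x) \<le> norm (conj_quadratic w x)"
    using conj_quadratic_minimum[of x] by blast
  define m where "m = norm (conj_quadratic z0 x)"
  have "m = 0"
  proof (rule ccontr)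
    assume "m \<noteq> 0"
    then have "0 < m" by (simp add: m_def)
    let ?y = "conj_quadratic z0 x"
    have shift: "\<exists>z. conj_quadratic z x = ?y + of_real (real k * (m / 2)) \<and> norm (conj_quadratic z x) = m" for k
    proof (induction k)
      case 0
      then show ?case by (auto simp: m_def intro!: exI[of _ z0])
    next
      case (Suc k)
      then obtain z where z: "conj_quadratic z x = ?y + of_real (real k * (m / 2))"
        "norm (conj_quadratic z x) = m" by blast
      have "(Im z)\<^sup>2 + m / 2 \<ge> 0" using \<open>0 < m\<close> by simp
      then have "(of_real (sqrt ((Im z)\<^sup>2 + m / 2)))\<^sup>2 = (of_real ((Im z)\<^sup>2 + m / 2) :: 'k)"
        by (simp flip: of_real_power)
      then have "conj_quadratic (Complex (Re z) (sqrt ((Im z)\<^sup>2 + m / 2))) x = conj_quadratic z x + of_real (m / 2)"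
        by (simp add: conj_quadratic_def add.assoc)
      moreover have "\<dots> = ?y + of_real (real (Suc k) * (m / 2))"
        unfolding z by (simp add: algebra_simps add_divide_distrib)
      ultimately show ?case
        using conj_quadratic_minimum_shift[OF z0[folded m_def] z(2) \<open>0 < m\<close>]
        by metis
    qed
    obtain k :: nat where k: "real k * (m / 2) > 2 * m"
      using reals_Archimedean3[of "m / 2"] \<open>0 < m\<close> by fastforce
    obtain z where z: "conj_quadratic z x = ?y + of_real (real k * (m / 2))" "norm (conj_quadratic z x) = m"
      using shift by blast
    have "norm (of_real (real k * (m / 2)) :: 'k) \<le> m + m"
      using norm_triangle_ineq4[of "conj_quadratic z x" ?y] z by (simp add: m_def)
    then show False using k \<open>0 < m\<close> by (simp del: of_real_mult)
  qed
  then show thesis using that by (simp add: m_def)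
qed

text \<open>If y is not real, its vanishing quadratic has a parameter with non-zero imaginary part,
  and normalising gives a square root i of -1. For any x with parameter w, the elements x - Re w and
  (Im w) i have equal squares, so they agree up to sign.\<close>

lemma real_normed_field_cases:
  obtains (real) "\<And>x::'k::real_normed_field. \<exists>a. x = of_real a"
  | (complex) i :: "'k::real_normed_field" where "i\<^sup>2 = -1" "\<And>x. \<exists>a b. x = of_real a + of_real b * i"
proof (cases "\<forall>x::'k. \<exists>a. x = of_real a")
  case False
  then obtain y :: 'k where y: "\<And>a. y \<noteq> of_real a" by blast
  obtain z where z: "conj_quadratic z y = 0" by (rule conj_quadratic_root)
  have "Im z \<noteq> 0" using z y[of "Re z"] by (auto simp: conj_quadratic_def)
  define i where "i = (y - of_real (Re z)) / of_real (Im z)"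
  have "(y - of_real (Re z))\<^sup>2 = - (of_real (Im z))\<^sup>2"
    using z by (simp add: conj_quadratic_def eq_neg_iff_add_eq_0)
  then have i: "i\<^sup>2 = -1"
    using \<open>Im z \<noteq> 0\<close> by (simp add: i_def power_divide)
  have "\<exists>a b. x = of_real a + of_real b * i" for x
  proof -
    obtain w where "conj_quadratic w x = 0" by (rule conj_quadratic_root)
    then have "(x - of_real (Re w))\<^sup>2 = (of_real (Im w) * i)\<^sup>2"
      using i by (simp add: conj_quadratic_def power_mult_distrib add_eq_0_iff2)
    then have "x - of_real (Re w) = of_real (Im w) * i \<or> x - of_real (Re w) = - (of_real (Im w) * i)"
      by (simp add: power2_eq_iff)
    then show ?thesis
    proof
      assume "x - of_real (Re w) = of_real (Im w) * i"
      then show ?thesis by (intro exI[of _ "Re w"] exI[of _ "Im w"]) (simp add: algebra_simps)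
    next
      assume "x - of_real (Re w) = - (of_real (Im w) * i)"
      then show ?thesis by (intro exI[of _ "Re w"] exI[of _ "- Im w"]) (simp add: algebra_simps)
    qed
  qed
  with i show ?thesis by (rule complex)
qed (use real in blast)

text \<open>The norm is known to be multiplicative, but not yet to be the modulus. For x = a + b i,
  multiplying by the conjugate gives a^2 + b^2 <= |x| (|a| + |b|), and (|a| + |b|)^2 <= 2 (a^2 +
  b^2) then allows division by |a| + |b|.\<close>

lemma coordinates_le_norm:
  fixes i :: "'k::real_normed_field"
  assumes "i\<^sup>2 = -1"
  shows "\<bar>a\<bar> + \<bar>b\<bar> \<le> 2 * norm (of_real a + of_real b * i)"
proof -
  define x where "x = of_real a + of_real b * i"
  have "(norm i)\<^sup>2 = 1" using assms by (metis norm_minus_cancel norm_one norm_power)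
  then have i: "norm i = 1" using power2_eq_1_iff[of "norm i"] norm_ge_zero[of i] by linarith
  have "x * (of_real a - of_real b * i) = of_real a ^ 2 - of_real b ^ 2 * i\<^sup>2"
    by (simp add: x_def power2_eq_square algebra_simps)
  then have "x * (of_real a - of_real b * i) = of_real (a\<^sup>2 + b\<^sup>2)"
    unfolding assms by simp
  then have "norm x * norm (of_real a - of_real b * i) = a\<^sup>2 + b\<^sup>2"
    by (metis abs_of_nonneg norm_mult norm_of_real sum_power2_ge_zero)
  moreover have "norm (of_real a - of_real b * i) \<le> \<bar>a\<bar> + \<bar>b\<bar>"
    using norm_triangle_ineq4[of "of_real a" "of_real b * i"] i by (simp add: norm_mult)
  ultimately have *: "\<bar>a\<bar>\<^sup>2 + \<bar>b\<bar>\<^sup>2 \<le> norm x * (\<bar>a\<bar> + \<bar>b\<bar>)"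
    by (metis mult_left_mono norm_ge_zero power2_abs)
  have "(\<bar>a\<bar> + \<bar>b\<bar>)\<^sup>2 \<le> 2 * (\<bar>a\<bar>\<^sup>2 + \<bar>b\<bar>\<^sup>2)"
    using zero_le_power2[of "\<bar>a\<bar> - \<bar>b\<bar>"] by (simp only: power2_eq_square algebra_simps)
  also have "\<dots> \<le> 2 * (norm x * (\<bar>a\<bar> + \<bar>b\<bar>))"
    using * by simp
  finally have "(\<bar>a\<bar> + \<bar>b\<bar>) * (\<bar>a\<bar> + \<bar>b\<bar>) \<le> (2 * norm x) * (\<bar>a\<bar> + \<bar>b\<bar>)"
    by (simp only: power2_eq_square mult.assoc)
  then have "\<bar>a\<bar> + \<bar>b\<bar> \<le> 2 * norm x"
    unfolding mult_le_cancel_right using norm_ge_zero[of x] by linarith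
  then show ?thesis by (simp add: x_def)
qed

lemma compact_cball_normed_field: "compact (cball (0::'k::real_normed_field) r)"
proof -
  have sub: "compact (cball (0::'k) r)"
    if c: "compact K" and sub: "cball 0 r \<subseteq> K" for K :: "'k set"
    using compact_Int_closed[OF c, of "cball 0 r"] sub by (simp add: Int_absorb1)
  show ?thesis
  proof (cases rule: real_normed_field_cases[where 'k = 'k])
    case real
    have "compact ((of_real :: real \<Rightarrow> 'k) ` {-r..r})"
      by (intro compact_continuous_image continuous_intros) auto
    moreover have "cball 0 r \<subseteq> (of_real :: real \<Rightarrow> 'k) ` {-r..r}"
    proof
      fix x :: 'k assume "x \<in> cball 0 r"
      moreover obtain a where "x = of_real a" using real by blast
      ultimately show "x \<in> of_real ` {-r..r}" by (auto simp: abs_le_iff)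
    qed
    ultimately show ?thesis by (rule sub)
  next
    case (complex i)
    have "compact ((\<lambda>(a, b). of_real a + of_real b * i) ` ({-2 * r..2 * r} \<times> {-2 * r..2 * r}))"
      unfolding split_def
      by (intro compact_continuous_image continuous_intros compact_Times) auto
    moreover have "cball 0 r \<subseteq> (\<lambda>(a, b). of_real a + of_real b * i) ` ({-2 * r..2 * r} \<times> {-2 * r..2 * r})"
    proof
      fix x :: 'k assume "x \<in> cball 0 r"
      obtain a b where ab: "x = of_real a + of_real b * i" using complex(2) by blast
      have "\<bar>a\<bar> + \<bar>b\<bar> \<le> 2 * r"
        using coordinates_le_norm[OF complex(1), of a b] \<open>x \<in> cball 0 r\<close> ab by simp
      then have "(a, b) \<in> {-2 * r..2 * r} \<times> {-2 * r..2 * r}" by auto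
      then show "x \<in> (\<lambda>(a, b). of_real a + of_real b * i) ` ({-2 * r..2 * r} \<times> {-2 * r..2 * r})"
        using ab by force
    qed
    ultimately show ?thesis by (rule sub)
  qed
qed

text \<open>The field is isomorphic to its real dual; \<rho> plays the role of the real part.\<close>

lemma real_functionals_normed_field:
  obtains \<rho> :: "'k::real_normed_field \<Rightarrow> real" where "bounded_linear \<rho>" "\<rho> 1 = 1"
    "\<And>l :: 'k \<Rightarrow> real. linear l \<Longrightarrow> \<exists>\<mu>. \<forall>c. l c = \<rho> (\<mu> * c)"
proof (cases rule: real_normed_field_cases[where 'k = 'k])
  case real
  define \<rho> :: "'k \<Rightarrow> real" where "\<rho> x = (THE a. x = of_real a)" for x
  have \<rho>: "\<rho> (of_real a) = a" for a by (simp add: \<rho>_def)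
  have of_real_\<rho>: "of_real (\<rho> x) = x" for x using real[of x] \<rho> by auto
  show thesis
  proof
    show "bounded_linear \<rho>"
    proof (rule bounded_linear_intro)
      show "\<rho> (x + y) = \<rho> x + \<rho> y" for x y
        using \<rho>[of "\<rho> x + \<rho> y"] by (simp add: of_real_\<rho>)
      show "\<rho> (r *\<^sub>R x) = r *\<^sub>R \<rho> x" for r x
        using \<rho>[of "r * \<rho> x"] by (simp add: of_real_\<rho> scaleR_conv_of_real)
      show "norm (\<rho> x) \<le> norm x * 1" for x
        using of_real_\<rho>[of x] by (metis mult.right_neutral norm_of_real order_refl real_norm_def)
    qed
    show "\<rho> 1 = 1" using \<rho>[of 1] by simp
    fix l :: "'k \<Rightarrow> real" assume "linear l"
    then have "l x = \<rho> (of_real (l 1) * x)" for x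
      using linear_scale[of l "\<rho> x" 1] \<rho>[of "l 1 * \<rho> x"]
      by (simp add: of_real_\<rho> scaleR_conv_of_real)
    then show "\<exists>\<mu>. \<forall>c. l c = \<rho> (\<mu> * c)" by blast
  qed
next
  case (complex i)
  have unique: "a = a' \<and> b = b'" if "of_real a + of_real b * i = of_real a' + of_real b' * i" for a b a' b'
  proof -
    have "of_real (a - a') + of_real (b - b') * i = 0"
      using that by (simp add: algebra_simps)
    then show ?thesis using coordinates_le_norm[OF complex(1), of "a - a'" "b - b'"]
      by (simp only: norm_zero) linarith
  qed
  define \<rho> :: "'k \<Rightarrow> real" where "\<rho> x = (THE a. \<exists>b. x = of_real a + of_real b * i)" for x
  have \<rho>: "\<rho> (of_real a + of_real b * i) = a" for a b
    unfolding \<rho>_def by (rule the_equality) (use unique in blast)+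
  show thesis
  proof
    show "bounded_linear \<rho>"
    proof (rule bounded_linear_intro)
      fix x y r
      obtain a b where x: "x = of_real a + of_real b * i" using complex(2) by blast
      obtain c d where y: "y = of_real c + of_real d * i" using complex(2) by blast
      have "x + y = of_real (a + c) + of_real (b + d) * i" by (simp add: x y algebra_simps)
      then show "\<rho> (x + y) = \<rho> x + \<rho> y" by (simp only: x y \<rho>)
      have "r *\<^sub>R x = of_real (r * a) + of_real (r * b) * i"
        by (simp add: x scaleR_conv_of_real algebra_simps)
      then show "\<rho> (r *\<^sub>R x) = r *\<^sub>R \<rho> x" by (simp only: x \<rho> real_scaleR_def)
      show "norm (\<rho> x) \<le> norm x * 2"
        using coordinates_le_norm[OF complex(1), of a b] by (simp add: x \<rho>)
    qed
    show "\<rho> 1 = 1" using \<rho>[of 1 0] by simp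
    fix l :: "'k \<Rightarrow> real" assume "linear l"
    \<comment> \<open>The multiplier l 1 - (l i) i is the one whose product with a + b i has real
      part a l 1 + b l i.\<close>
    have "l x = \<rho> ((of_real (l 1) - of_real (l i) * i) * x)" for x
    proof -
      obtain a b where x: "x = of_real a + of_real b * i" using complex(2) by blast
      have "x = a *\<^sub>R 1 + b *\<^sub>R i" by (simp add: x scaleR_conv_of_real)
      then have "l x = a * l 1 + b * l i"
        using \<open>linear l\<close> by (simp only: linear_add linear_scale real_scaleR_def)
      have "(of_real (l 1) - of_real (l i) * i) * x =
          of_real (l 1 * a) - of_real (l i * b) * i\<^sup>2 + of_real (l 1 * b - l i * a) * i"
        by (simp add: x power2_eq_square algebra_simps)
      also have "\<dots> = of_real (l 1 * a + l i * b) + of_real (l 1 * b - l i * a) * i"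
        by (simp add: complex(1))
      finally have eq: "(of_real (l 1) - of_real (l i) * i) * x =
          of_real (l 1 * a + l i * b) + of_real (l 1 * b - l i * a) * i" .
      show ?thesis unfolding eq \<rho> using \<open>l x = a * l 1 + b * l i\<close> by (simp add: mult.commute)
    qed
    then show "\<exists>\<mu>. \<forall>c. l c = \<rho> (\<mu> * c)" by blast
  qed
qed

section \<open>Hahn--Banach and separation in sequence space\<close>

definition sublinear :: "('a::real_vector \<Rightarrow> real) \<Rightarrow> bool" where
  "sublinear q \<longleftrightarrow> (\<forall>x y. q (x + y) \<le> q x + q y) \<and> (\<forall>c x. 0 \<le> c \<longrightarrow> q (c *\<^sub>R x) = c * q x)"

lemma sublinearI:
  assumes "\<And>x y. q (x + y) \<le> q x + q y" "q 0 = 0" "\<And>c x. 0 < c \<Longrightarrow> q (c *\<^sub>R x) \<le> c * q x"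
  shows "sublinear q"
  unfolding sublinear_def
proof (intro conjI allI impI)
  fix c :: real and x assume "0 \<le> c"
  show "q (c *\<^sub>R x) = c * q x"
  proof (cases "c = 0")
    case False
    with \<open>0 \<le> c\<close> have "0 < c" by simp
    have "q ((1 / c) *\<^sub>R (c *\<^sub>R x)) \<le> 1 / c * q (c *\<^sub>R x)"
      by (rule assms) (use \<open>0 < c\<close> in simp)
    with \<open>0 < c\<close> assms(3)[OF \<open>0 < c\<close>, of x] show ?thesis
      by (simp add: field_simps)
  qed (simp add: assms)
qed (rule assms)

lemma
  assumes "sublinear q"
  shows sublinear_add: "q (x + y) \<le> q x + q y"
    and sublinear_scale: "0 \<le> c \<Longrightarrow> q (c *\<^sub>R x) = c * q x"
    and sublinear_0: "q 0 = 0"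
    and sublinear_minus: "- q (- x) \<le> q x"
proof -
  show add: "q (x + y) \<le> q x + q y" for x y using assms by (simp add: sublinear_def)
  show "0 \<le> c \<Longrightarrow> q (c *\<^sub>R x) = c * q x" for c using assms by (simp add: sublinear_def)
  from this[of 0] show 0: "q 0 = 0" by simp
  show "- q (- x) \<le> q x" using add[of x "- x"] 0 by simp
qed

text \<open>The largest sublinear minorant of q whose value at -x is at most -q x.\<close>

definition sublinear_tilt :: "('a::real_vector \<Rightarrow> real) \<Rightarrow> 'a \<Rightarrow> 'a \<Rightarrow> real" where
  "sublinear_tilt q x y = (INF t\<in>{0..}. q (y + t *\<^sub>R x) - t * q x)"

text \<open>The infimum is finite since q (t x) <= q (- y) + q (y + t x) bounds every term below by
  - q (- y). Subadditivity combines the parameters s and t to s + t; homogeneity replaces t by c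
  t.\<close>

lemma
  assumes q: "sublinear q"
  shows sublinear_tilt_le: "0 \<le> t \<Longrightarrow> sublinear_tilt q x y \<le> q (y + t *\<^sub>R x) - t * q x"
    and sublinear_sublinear_tilt: "sublinear (sublinear_tilt q x)"
proof -
  have bdd: "bdd_below ((\<lambda>t. q (y + t *\<^sub>R x) - t * q x) ` {0..})" for y
  proof (rule bdd_belowI2)
    fix t :: real assume "t \<in> {0..}"
    then show "- q (- y) \<le> q (y + t *\<^sub>R x) - t * q x"
      using sublinear_add[OF q, of "- y" "y + t *\<^sub>R x"] sublinear_scale[OF q, of t x] by simp
  qed
  show le: "sublinear_tilt q x y \<le> q (y + t *\<^sub>R x) - t * q x" if "0 \<le> t" for t y
    unfolding sublinear_tilt_def by (rule cINF_lower[OF bdd]) (use that in simp)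
  have ge: "c \<le> sublinear_tilt q x y" if "\<And>t. 0 \<le> t \<Longrightarrow> c \<le> q (y + t *\<^sub>R x) - t * q x" for c y
    unfolding sublinear_tilt_def by (rule cINF_greatest) (use that in auto)
  show "sublinear (sublinear_tilt q x)"
  proof (rule sublinearI)
    fix y z
    have "sublinear_tilt q x (y + z) \<le> (q (y + s *\<^sub>R x) - s * q x) + (q (z + t *\<^sub>R x) - t * q x)"
      if "0 \<le> s" "0 \<le> t" for s t
      using le[of "s + t" "y + z"] that sublinear_add[OF q, of "y + s *\<^sub>R x" "z + t *\<^sub>R x"]
      by (simp add: algebra_simps)
    then have "sublinear_tilt q x (y + z) - (q (z + t *\<^sub>R x) - t * q x) \<le> sublinear_tilt q x y"
      if "0 \<le> t" for t
      using that by (intro ge) (simp add: diff_le_eq)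
    then have "sublinear_tilt q x (y + z) - sublinear_tilt q x y \<le> sublinear_tilt q x z"
      by (intro ge) (simp add: diff_le_eq add.commute)
    then show "sublinear_tilt q x (y + z) \<le> sublinear_tilt q x y + sublinear_tilt q x z" by simp
  next
    show "sublinear_tilt q x 0 = 0"
      using le[of 0 0] sublinear_0[OF q] by (intro antisym ge) (simp_all add: sublinear_scale[OF q])
  next
    fix c :: real and y assume "0 < c"
    have "sublinear_tilt q x (c *\<^sub>R y) / c \<le> sublinear_tilt q x y"
    proof (rule ge)
      fix t :: real assume "0 \<le> t"
      have "c *\<^sub>R y + (c * t) *\<^sub>R x = c *\<^sub>R (y + t *\<^sub>R x)" by (simp add: algebra_simps)
      then have "q (c *\<^sub>R y + (c * t) *\<^sub>R x) = c * q (y + t *\<^sub>R x)"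
        using sublinear_scale[OF q] \<open>0 < c\<close> by simp
      then show "sublinear_tilt q x (c *\<^sub>R y) / c \<le> q (y + t *\<^sub>R x) - t * q x"
        using le[of "c * t" "c *\<^sub>R y"] \<open>0 < c\<close> \<open>0 \<le> t\<close> by (simp add: field_simps)
    qed
    then show "sublinear_tilt q x (c *\<^sub>R y) \<le> c * sublinear_tilt q x y"
      using \<open>0 < c\<close> by (simp add: field_simps)
  qed
qed

text \<open>Zorn's lemma for the reversed pointwise order. The pointwise infimum of a chain is
  finite because every sublinear q below p satisfies - p (- x) <= - q (- x) <= q x.\<close>

lemma minimal_sublinear_exists:
  assumes p: "sublinear p"
  obtains q where "sublinear q" "q \<le> p" "\<And>r. sublinear r \<Longrightarrow> r \<le> q \<Longrightarrow> r = q"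
proof -
  define A where "A = {q. sublinear q \<and> q \<le> p}"
  have "\<exists>m\<in>A. \<forall>a\<in>A. m \<ge> a \<longrightarrow> a = m"
  proof (rule predicate_Zorn)
    show "partial_order_on A (relation_of (\<ge>) A)"
      by (rule partial_order_on_relation_ofI) auto
    fix C assume C: "C \<in> Chains (relation_of (\<ge>) A)"
    then have "C \<subseteq> A" by (rule Chains_relation_of)
    then have sl: "sublinear q" "q \<le> p" if "q \<in> C" for q using that by (auto simp: A_def)
    show "\<exists>u\<in>A. \<forall>a\<in>C. a \<ge> u"
    proof (cases "C = {}")
      case False
      define u where "u x = (INF q\<in>C. q x)" for x
      have bdd: "bdd_below ((\<lambda>q. q x) ` C)" for x
      proof (rule bdd_belowI2)
        fix q assume "q \<in> C"
        then show "- p (- x) \<le> q x"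
          using sl[of q] sublinear_minus[of q x] le_funD[of q p "- x"] by linarith
      qed
      have le: "u x \<le> q x" if "q \<in> C" for q x
        unfolding u_def using bdd that by (rule cINF_lower)
      have ge: "c \<le> u x" if "\<And>q. q \<in> C \<Longrightarrow> c \<le> q x" for c x
        unfolding u_def by (rule cINF_greatest) (use False that in auto)
      have "sublinear u"
      proof (rule sublinearI)
        fix x y
        \<comment> \<open>Here the chain property enters: the smaller of \<open>q\<close> and
          \<open>r\<close> is a single sublinear function below both.\<close>
        have "u (x + y) \<le> q x + r y" if qr: "q \<in> C" "r \<in> C" for q r
        proof -
          have "q \<le> r \<or> r \<le> q" using C that by (auto simp: Chains_def relation_of_def)
          then obtain s where "s \<in> C" "s \<le> q" "s \<le> r" using qr by blast
          then show ?thesis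
            using le[of s "x + y"] sublinear_add[OF sl(1), of s x y] le_funD[of s q x] le_funD[of s r y]
            by linarith
        qed
        then have "u (x + y) - r y \<le> u x" if "r \<in> C" for r
          using that by (intro ge) (simp add: diff_le_eq)
        then have "u (x + y) - u x \<le> u y"
          by (intro ge) (simp add: diff_le_eq add.commute)
        then show "u (x + y) \<le> u x + u y" by simp
      next
        obtain q where "q \<in> C" using False by blast
        show "u 0 = 0"
        proof (rule antisym)
          show "u 0 \<le> 0" using le[OF \<open>q \<in> C\<close>, of 0] sublinear_0[OF sl(1)[OF \<open>q \<in> C\<close>]] by simp
          show "0 \<le> u 0"
          proof (rule ge)
            fix r assume "r \<in> C"
            then show "0 \<le> r 0" using sublinear_0[OF sl(1)[OF \<open>r \<in> C\<close>]] by simp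
          qed
        qed
      next
        fix c :: real and x assume "0 < c"
        have "u (c *\<^sub>R x) / c \<le> u x"
          using le[of _ "c *\<^sub>R x"] sublinear_scale[OF sl(1), of _ c x] \<open>0 < c\<close>
          by (intro ge) (simp add: field_simps)
        then show "u (c *\<^sub>R x) \<le> c * u x" using \<open>0 < c\<close> by (simp add: field_simps)
      qed
      moreover have "u \<le> p"
        using False le sl(2) by (metis all_not_in_conv le_fun_def order_trans)
      ultimately show ?thesis using le by (intro bexI[of _ u]) (auto simp: A_def le_fun_def)
    qed (use p in \<open>auto simp: A_def\<close>)
  qed
  then obtain q where q: "q \<in> A" "\<forall>a\<in>A. q \<ge> a \<longrightarrow> a = q" by blast
  show thesis
  proof
    show "sublinear q" "q \<le> p" using q(1) by (auto simp: A_def)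
    fix r assume "sublinear r" "r \<le> q"
    with q show "r = q" using order_trans[of r q p] by (auto simp: A_def)
  qed
qed

text \<open>A minimal sublinear function equals its tilt in every direction, hence is odd, and an
  odd sublinear function is linear. Minimising below the tilt of p at a instead of below p forces f
  (- a) <= - p a, hence equality at a.\<close>

lemma hahn_banach_sublinear:
  assumes p: "sublinear p"
  obtains f where "linear f" "\<And>x. f x \<le> p x" "f a = p a"
proof -
  obtain q where q: "sublinear q" "q \<le> sublinear_tilt p a" and min: "\<And>r. sublinear r \<Longrightarrow> r \<le> q \<Longrightarrow> r = q"
    using minimal_sublinear_exists[OF sublinear_sublinear_tilt[OF p]] by blast
  have "sublinear_tilt q x = q" for x
    using sublinear_tilt_le[OF q(1), of 0]
    by (intro min sublinear_sublinear_tilt q le_funI) simp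
  then have neg: "q (- x) = - q x" for x
    using sublinear_tilt_le[OF q(1), of 1 x "- x"] sublinear_0[OF q(1)] sublinear_minus[OF q(1), of x]
    by simp
  have "linear q"
  proof (rule linearI)
    fix x y
    show "q (x + y) = q x + q y"
      using sublinear_add[OF q(1), of x y] sublinear_add[OF q(1), of "- x" "- y"] neg[of "x + y"]
      by (simp add: neg)
  next
    fix c :: real and x
    show "q (c *\<^sub>R x) = c *\<^sub>R q x"
      using sublinear_scale[OF q(1), of c x] sublinear_scale[OF q(1), of "- c" x] neg[of "c *\<^sub>R x"]
      by (cases "0 \<le> c") auto
  qed
  moreover have "q x \<le> p x" for x
    using le_funD[OF q(2), of x] sublinear_tilt_le[OF p, of 0 a x] by simp
  moreover have "q a = p a"
    using calculation(2)[of a] le_funD[OF q(2), of "- a"] sublinear_tilt_le[OF p, of 1 a "- a"]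
      sublinear_0[OF p] neg[of a] by simp
  ultimately show thesis by (rule that)
qed

text \<open>The duality of c_0 and l^1, by hand. The functional comes from the distance to Y, which
  vanishes on Y and is at least 1 at a. It is only real-linear; its restriction to each coordinate
  axis is multiplication by a scalar \<open>\<mu> k\<close> followed by the real part.\<close>

lemma c0_separation:
  fixes Y :: "(nat \<Rightarrow> 'k::{real_normed_field,banach}) set"
  assumes Y0: "(\<lambda>k. 0) \<in> Y" and Y_add: "\<And>y z. y \<in> Y \<Longrightarrow> z \<in> Y \<Longrightarrow> (\<lambda>k. y k + z k) \<in> Y"
    and Y_scale: "\<And>c y. y \<in> Y \<Longrightarrow> (\<lambda>k. c * y k) \<in> Y"
    and Y_null: "\<And>y. y \<in> Y \<Longrightarrow> y \<longlonglongrightarrow> 0" and a_null: "a \<longlonglongrightarrow> 0"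
    and far: "\<And>y. y \<in> Y \<Longrightarrow> \<exists>k. 1 \<le> norm (a k - y k)"
  obtains \<mu> where "\<And>N. (\<Sum>k<N. norm (\<mu> k)) \<le> 1"
    "\<And>y. y \<in> Y \<Longrightarrow> (\<lambda>k. \<mu> k * y k) sums 0" "(\<Sum>k. \<mu> k * a k) \<noteq> 0"
proof -
  \<comment> \<open>Bounded sequences become bounded continuous functions on the naturals, a type
    that carries the supremum norm. \<open>Bcontfun\<close> is meaningful only on bounded sequences,
    hence the \<open>Bseq\<close> premises below.\<close>
  define emb :: "(nat \<Rightarrow> 'k) \<Rightarrow> nat \<Rightarrow>\<^sub>C 'k" where "emb = Bcontfun"
  have emb: "apply_bcontfun (emb b) = b" if "Bseq b" for b
  proof -
    from that obtain K where "\<And>k. norm (b k) \<le> K" by (auto simp: Bseq_def)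
    then have "b \<in> bcontfun" by (intro bcontfun_normI[of _ K]) auto
    then show ?thesis by (simp add: emb_def Bcontfun_inverse)
  qed
  have emb_eqI: "emb b = B" if "\<And>k. b k = apply_bcontfun B k" for b B
  proof -
    from that have "b = apply_bcontfun B" by auto
    then show ?thesis by (simp add: emb_def apply_bcontfun_inverse)
  qed
  have null_Bseq: "Bseq b" if "b \<longlonglongrightarrow> 0" for b :: "nat \<Rightarrow> 'k"
    using that by (rule convergent_imp_Bseq[OF convergentI])
  have Y_Bseq: "Bseq y" if "y \<in> Y" for y using null_Bseq[OF Y_null[OF that]] .
  have emb_add: "emb (\<lambda>k. b k + c k) = emb b + emb c" if "Bseq b" "Bseq c" for b c
    by (rule emb_eqI) (simp add: emb that plus_bcontfun.rep_eq)
  have emb_scale: "emb (\<lambda>k. of_real r * b k) = r *\<^sub>R emb b" if "Bseq b" for b r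
    by (rule emb_eqI) (simp add: emb that scaleR_bcontfun.rep_eq scaleR_conv_of_real)
  define p where "p x = (INF y\<in>Y. norm (x - emb y))" for x
  have le: "p x \<le> norm (x - emb y)" if "y \<in> Y" for x y
    unfolding p_def by (rule cINF_lower) (use that in \<open>auto intro!: bdd_belowI[of _ 0]\<close>)
  have ge: "c \<le> p x" if "\<And>y. y \<in> Y \<Longrightarrow> c \<le> norm (x - emb y)" for c x
    unfolding p_def by (rule cINF_greatest) (use Y0 that in auto)
  have emb_0: "emb (\<lambda>k. 0) = 0" by (rule emb_eqI) simp
  have p_norm: "p x \<le> norm x" for x using le[OF Y0, of x] by (simp add: emb_0)
  have "sublinear p"
  proof (rule sublinearI)
    fix x x'
    have "p (x + x') \<le> norm (x - emb y) + norm (x' - emb y')" if "y \<in> Y" "y' \<in> Y" for y y'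
      using le[OF Y_add[OF that], of "x + x'"] norm_triangle_ineq[of "x - emb y" "x' - emb y'"]
      by (simp add: emb_add Y_Bseq that algebra_simps)
    then have "p (x + x') - norm (x' - emb y') \<le> p x" if "y' \<in> Y" for y'
      using that by (intro ge) (simp add: diff_le_eq)
    then have "p (x + x') - p x \<le> p x'"
      by (intro ge) (simp add: diff_le_eq add.commute)
    then show "p (x + x') \<le> p x + p x'" by simp
  next
    show "p 0 = 0" using p_norm[of 0] ge[of 0 0] by simp
  next
    fix c :: real and x assume "0 < c"
    have "p (c *\<^sub>R x) / c \<le> p x"
    proof (rule ge)
      fix y assume "y \<in> Y"
      have "p (c *\<^sub>R x) \<le> norm (c *\<^sub>R x - c *\<^sub>R emb y)"
        using le[OF Y_scale[OF \<open>y \<in> Y\<close>, of "of_real c"]] by (simp add: emb_scale Y_Bseq \<open>y \<in> Y\<close>)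
      also have "\<dots> = c * norm (x - emb y)"
        using \<open>0 < c\<close> by (simp flip: scaleR_diff_right)
      finally show "p (c *\<^sub>R x) / c \<le> norm (x - emb y)" using \<open>0 < c\<close> by (simp add: field_simps)
    qed
    then show "p (c *\<^sub>R x) \<le> c * p x" using \<open>0 < c\<close> by (simp add: field_simps)
  qed
  then obtain \<psi> where \<psi>: "linear \<psi>" "\<And>x. \<psi> x \<le> p x" "\<psi> (emb a) = p (emb a)"
    by (rule hahn_banach_sublinear[of p "emb a"]) blast
  have \<psi>_norm: "\<bar>\<psi> x\<bar> \<le> norm x" for x
    using \<psi>(2)[of x] \<psi>(2)[of "- x"] p_norm[of x] p_norm[of "- x"] linear_neg[OF \<psi>(1), of x] by simp
  have \<psi>_Y: "\<psi> (emb y) = 0" if "y \<in> Y" for y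
  proof -
    have "\<psi> (emb z) \<le> 0" if "z \<in> Y" for z using \<psi>(2)[of "emb z"] le[OF that, of "emb z"] by simp
    moreover have "emb (\<lambda>k. - 1 * y k) = - emb y"
      by (rule emb_eqI) (simp add: emb Y_Bseq that uminus_bcontfun.rep_eq)
    ultimately show ?thesis
      using that Y_scale[OF that, of "-1"] linear_neg[OF \<psi>(1), of "emb y"] by (metis neg_le_0_iff_le order_antisym)
  qed
  have \<psi>_a: "1 \<le> \<psi> (emb a)"
    unfolding \<psi>(3)
  proof (rule ge)
    fix y assume "y \<in> Y"
    then obtain k where "1 \<le> norm (a k - y k)" using far by blast
    also have "\<dots> = norm (apply_bcontfun (emb a - emb y) k)"
      by (simp add: emb null_Bseq a_null Y_Bseq \<open>y \<in> Y\<close> minus_bcontfun.rep_eq)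
    also have "\<dots> \<le> norm (emb a - emb y)" by (rule norm_bounded)
    finally show "1 \<le> norm (emb a - emb y)" .
  qed
  obtain \<rho> :: "'k \<Rightarrow> real" where \<rho>: "bounded_linear \<rho>" "\<rho> 1 = 1"
    "\<And>l. linear l \<Longrightarrow> \<exists>\<mu>. \<forall>c. l c = \<rho> (\<mu> * c)"
    by (rule real_functionals_normed_field) blast
  interpret \<rho>: bounded_linear \<rho> by (rule \<rho>)
  define unit where "unit k c = emb (\<lambda>j. if j = k then c else 0)" for k c
  have Bseq_trunc: "Bseq (\<lambda>j. if j < N then b j else 0)" for N and b :: "nat \<Rightarrow> 'k"
    by (rule null_Bseq, rule tendsto_eventually, rule eventually_sequentiallyI[of N]) auto
  have Bseq_unit: "Bseq (\<lambda>j. if j = k then c else 0)" for k and c :: 'k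
    by (rule null_Bseq, rule tendsto_eventually, rule eventually_sequentiallyI[of "Suc k"]) auto
  have "linear (\<lambda>c. \<psi> (unit k c))" for k
  proof (rule linearI)
    fix b c
    have "unit k (b + c) = unit k b + unit k c"
      unfolding unit_def emb_add[OF Bseq_unit Bseq_unit, symmetric] by (rule arg_cong[of _ _ emb]) auto
    then show "\<psi> (unit k (b + c)) = \<psi> (unit k b) + \<psi> (unit k c)" by (simp add: linear_add[OF \<psi>(1)])
  next
    fix r :: real and c
    have "unit k (r *\<^sub>R c) = r *\<^sub>R unit k c"
      unfolding unit_def emb_scale[OF Bseq_unit, symmetric]
      by (rule arg_cong[of _ _ emb]) (auto simp: scaleR_conv_of_real)
    then show "\<psi> (unit k (r *\<^sub>R c)) = r *\<^sub>R \<psi> (unit k c)" by (simp add: linear_scale[OF \<psi>(1)])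
  qed
  then have "\<forall>k. \<exists>\<mu>. \<forall>c. \<psi> (unit k c) = \<rho> (\<mu> * c)" by (intro allI \<rho>)
  then obtain \<mu> where \<mu>: "\<And>k c. \<psi> (unit k c) = \<rho> (\<mu> k * c)" by metis
  have trunc: "\<psi> (emb (\<lambda>j. if j < N then b j else 0)) = (\<Sum>k<N. \<rho> (\<mu> k * b k))" for N b
  proof (induction N)
    case 0
    then show ?case by (simp add: emb_0 linear_0[OF \<psi>(1)])
  next
    case (Suc N)
    have "emb (\<lambda>j. if j < Suc N then b j else 0) = emb (\<lambda>j. if j < N then b j else 0) + unit N (b N)"
      unfolding unit_def emb_add[OF Bseq_trunc Bseq_unit, symmetric] by (rule arg_cong[of _ _ emb]) auto
    then show ?case by (simp add: Suc \<mu> linear_add[OF \<psi>(1)])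
  qed
  have sum_\<mu>: "(\<Sum>k<N. norm (\<mu> k)) \<le> 1" for N
  proof -
    \<comment> \<open>Phases that turn \<open>\<mu> k\<close> into its norm. Truncations of
      \<open>b\<close> have supremum norm at most 1, and \<open>\<psi>\<close> maps them to the
      partial sums in question.\<close>
    define b where "b k = (if \<mu> k = 0 then 0 else of_real (norm (\<mu> k)) / \<mu> k)" for k
    have "\<rho> (\<mu> k * b k) = norm (\<mu> k)" for k
      using \<rho>.scaleR[of "norm (\<mu> k)" 1] \<rho>(2) by (simp add: b_def scaleR_conv_of_real \<rho>.zero)
    then have "(\<Sum>k<N. norm (\<mu> k)) = \<psi> (emb (\<lambda>j. if j < N then b j else 0))" by (simp add: trunc)
    also have "\<dots> \<le> norm (emb (\<lambda>j. if j < N then b j else 0))" using \<psi>_norm abs_le_D1 by blast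
    also have "\<dots> \<le> 1" by (rule norm_bound) (simp add: emb Bseq_trunc b_def norm_divide)
    finally show ?thesis .
  qed
  have summable: "summable (\<lambda>k. norm (\<mu> k))"
    by (rule summableI_nonneg_bounded[of _ 1]) (use sum_\<mu> in auto)
  have summable_null: "summable (\<lambda>k. \<mu> k * b k)" if b: "b \<longlonglongrightarrow> 0" for b
  proof -
    obtain K where K: "\<And>k. norm (b k) \<le> K" using null_Bseq[OF b] by (auto simp: Bseq_def)
    show ?thesis
      by (rule summable_comparison_test'[OF summable_mult2[OF summable, of K]])
        (auto simp: norm_mult intro!: mult_left_mono K)
  qed
  have \<psi>_series: "\<psi> (emb b) = \<rho> (\<Sum>k. \<mu> k * b k)" if b: "b \<longlonglongrightarrow> 0" for b
  proof -
    \<comment> \<open>The truncations converge to \<open>b\<close> in the supremum norm precisely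
      because \<open>b\<close> is a null sequence.\<close>
    have "(\<lambda>N. \<Sum>k<N. \<rho> (\<mu> k * b k)) \<longlonglongrightarrow> \<psi> (emb b)"
    proof (rule LIMSEQ_I)
      fix r :: real assume "0 < r"
      then obtain N0 where N0: "\<And>k. k \<ge> N0 \<Longrightarrow> norm (b k) < r / 2"
        using LIMSEQ_D[OF b, of "r / 2"] by auto
      have "norm ((\<Sum>k<N. \<rho> (\<mu> k * b k)) - \<psi> (emb b)) < r" if "N \<ge> N0" for N
      proof -
        have "norm ((\<Sum>k<N. \<rho> (\<mu> k * b k)) - \<psi> (emb b)) = \<bar>\<psi> (emb (\<lambda>j. if j < N then b j else 0) - emb b)\<bar>"
          by (simp add: trunc linear_diff[OF \<psi>(1)])
        also have "\<dots> \<le> norm (emb (\<lambda>j. if j < N then b j else 0) - emb b)" by (rule \<psi>_norm)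
        also have "\<dots> \<le> r / 2"
          by (rule norm_bound)
            (use N0 that \<open>0 < r\<close> in \<open>auto simp: minus_bcontfun.rep_eq emb Bseq_trunc null_Bseq b less_imp_le\<close>)
        finally show ?thesis using \<open>0 < r\<close> by simp
      qed
      then show "\<exists>N0. \<forall>N\<ge>N0. norm ((\<Sum>k<N. \<rho> (\<mu> k * b k)) - \<psi> (emb b)) < r" by blast
    qed
    moreover have "(\<lambda>N. \<Sum>k<N. \<rho> (\<mu> k * b k)) \<longlonglongrightarrow> \<rho> (\<Sum>k. \<mu> k * b k)"
      using \<rho>.sums[OF summable_sums[OF summable_null[OF b]]] by (simp add: sums_def)
    ultimately show ?thesis by (rule LIMSEQ_unique)
  qed
  show thesis
  proof
    show "(\<Sum>k<N. norm (\<mu> k)) \<le> 1" for N by (rule sum_\<mu>)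
    show "(\<Sum>k. \<mu> k * a k) \<noteq> 0" using \<psi>_series[OF a_null] \<psi>_a \<rho>.zero by auto
    fix y assume "y \<in> Y"
    let ?s = "\<Sum>k. \<mu> k * y k"
    \<comment> \<open>The functional only controls the real part of the series. As \<open>Y\<close>
      is stable under all scalars, the real part of every multiple vanishes, and the multiple by
      \<open>inverse ?s\<close> would have real part 1.\<close>
    have "\<rho> (c * ?s) = 0" for c
    proof -
      have "c * ?s = (\<Sum>k. \<mu> k * (c * y k))"
        using suminf_mult[OF summable_null[OF Y_null[OF \<open>y \<in> Y\<close>]], of c] by (simp add: ac_simps)
      then show ?thesis
        using \<psi>_series[OF Y_null[OF Y_scale[OF \<open>y \<in> Y\<close>, of c]]] \<psi>_Y[OF Y_scale[OF \<open>y \<in> Y\<close>, of c]] by simp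
    qed
    from this[of "inverse ?s"] have "?s = 0" using \<rho>(2) by (cases "?s = 0") auto
    with summable_sums[OF summable_null[OF Y_null[OF \<open>y \<in> Y\<close>]]]
    show "(\<lambda>k. \<mu> k * y k) sums 0" by simp
  qed
qed

section \<open>Graded Schwartz spaces\<close>

lemma closed_Collect_norm_coordinate_le:
  "closed {f :: 'a \<Rightarrow> 'b::real_normed_vector. norm (f x) \<le> r}"
  by (intro closed_Collect_le continuous_intros continuous_on_product_coordinates)

text \<open>Tychonoff: the set is a product of closed balls of the scalar field.\<close>

lemma compact_Collect_norm_le:
  "compact {f :: 'a \<Rightarrow> 'k::real_normed_field. \<forall>x. norm (f x) \<le> r x}"
proof -
  have "compactin (product_topology (\<lambda>_. euclidean) UNIV) (PiE UNIV (\<lambda>x. cball (0::'k) (r x)))"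
    unfolding compactin_PiE by (simp add: compact_cball_normed_field)
  moreover have "PiE UNIV (\<lambda>x. cball (0::'k) (r x)) = {f. \<forall>x. norm (f x) \<le> r x}"
    by (auto simp: PiE_def)
  ultimately show ?thesis by (simp add: euclidean_product_topology)
qed

text \<open>A Frechet--Schwartz space presented by an increasing sequence of seminorms. Requiring
  Q 0 = 0 starts the inductive construction of Banach and Dieudonne at polar 0 = {0}; the factor 2
  makes every sequence with Q n (x n) \<le> 1 a null sequence.\<close>

locale graded_schwartz = vector_space s
  for s :: "'k::real_normed_field \<Rightarrow> 'v::ab_group_add \<Rightarrow> 'v" +
  fixes X :: "'v set" and Q :: "nat \<Rightarrow> 'v \<Rightarrow> real"
  assumes subspace_X: "subspace X"
    and Q_add: "\<And>n x y. x \<in> X \<Longrightarrow> y \<in> X \<Longrightarrow> Q n (x + y) \<le> Q n x + Q n y"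
    and Q_scale: "\<And>n c x. x \<in> X \<Longrightarrow> Q n (s c x) = norm c * Q n x"
    and Q_0: "\<And>x. x \<in> X \<Longrightarrow> Q 0 x = 0"
    and Q_Suc: "\<And>n x. x \<in> X \<Longrightarrow> 2 * Q n x \<le> Q (Suc n) x"
    and precompact: "\<And>n \<epsilon>. 0 < \<epsilon> \<Longrightarrow>
      \<exists>F. finite F \<and> F \<subseteq> X \<and> (\<forall>x\<in>X. Q (Suc n) x \<le> 1 \<longrightarrow> (\<exists>y\<in>F. Q n (x - y) < \<epsilon>))"
    and complete: "\<And>xs. (\<And>k. xs k \<in> X) \<Longrightarrow>
      (\<And>n \<epsilon>. 0 < \<epsilon> \<Longrightarrow> \<exists>N. \<forall>k\<ge>N. \<forall>l\<ge>N. Q n (xs k - xs l) < \<epsilon>) \<Longrightarrow>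
      \<exists>x\<in>X. \<forall>n. (\<lambda>k. Q n (xs k - x)) \<longlonglongrightarrow> 0"
begin

lemma X_0 [simp]: "0 \<in> X" and X_add: "x \<in> X \<Longrightarrow> y \<in> X \<Longrightarrow> x + y \<in> X"
  and X_scale: "x \<in> X \<Longrightarrow> s c x \<in> X" and X_diff: "x \<in> X \<Longrightarrow> y \<in> X \<Longrightarrow> x - y \<in> X"
  and X_sum: "(\<And>i. i \<in> A \<Longrightarrow> f i \<in> X) \<Longrightarrow> (\<Sum>i\<in>A. f i) \<in> X"
  using subspace_X by (auto intro: subspace_0 subspace_add subspace_scale subspace_diff subspace_sum)

lemma Q_zero [simp]: "Q n 0 = 0"
  using Q_scale[OF X_0, of n 0] by simp

lemma Q_minus: "x \<in> X \<Longrightarrow> Q n (- x) = Q n x"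
  using Q_scale[of x n "-1"] by simp

lemma Q_nonneg: "x \<in> X \<Longrightarrow> 0 \<le> Q n x"
  using Q_add[of x "- x" n] Q_minus[of x n] X_scale[of x "-1"] by simp

lemma Q_diff_commute: "x \<in> X \<Longrightarrow> y \<in> X \<Longrightarrow> Q n (x - y) = Q n (y - x)"
  using Q_minus[OF X_diff, of x y n] by simp

lemma Q_sum: "(\<And>i. i \<in> A \<Longrightarrow> f i \<in> X) \<Longrightarrow> Q n (\<Sum>i\<in>A. f i) \<le> (\<Sum>i\<in>A. Q n (f i))"
proof (induction A rule: infinite_finite_induct)
  case (insert a A)
  then have "Q n (f a + sum f A) \<le> Q n (f a) + Q n (sum f A)"
    by (intro Q_add X_sum) auto
  with insert show ?case by force
qed simp_all

lemma Q_grow: "x \<in> X \<Longrightarrow> 2 ^ k * Q n x \<le> Q (n + k) x"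
proof (induction k)
  case (Suc k)
  then show ?case using Q_Suc[of x "n + k"] by simp
qed simp

lemma Q_mono: "x \<in> X \<Longrightarrow> m \<le> n \<Longrightarrow> Q m x \<le> Q n x"
proof -
  assume x: "x \<in> X" and "m \<le> n"
  have "1 * Q m x \<le> 2 ^ (n - m) * Q m x" by (rule mult_right_mono) (simp_all add: Q_nonneg x)
  then show ?thesis using Q_grow[OF x, of "n - m" m] \<open>m \<le> n\<close> by simp
qed

text \<open>Rescale by 1 / r for every r above \<open>Q n x\<close> and let r decrease; division by
  \<open>Q n x\<close> itself fails where the seminorm vanishes.\<close>

lemma homogeneous_bound:
  assumes f: "\<And>c x. x \<in> X \<Longrightarrow> f (s c x) = c * f x" and "0 < e"
    and bound: "\<And>x. x \<in> X \<Longrightarrow> Q n x \<le> 1 \<Longrightarrow> norm (f x) \<le> e" and x: "x \<in> X"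
  shows "norm (f x :: 'k) \<le> e * Q n x"
proof -
  have "norm (f x) / e \<le> r" if "Q n x < r" for r
  proof -
    have "0 < r" using that Q_nonneg[OF x, of n] by simp
    have "norm (f (s (of_real (1 / r)) x)) \<le> e"
      using that \<open>0 < r\<close> x by (intro bound) (simp_all add: X_scale Q_scale norm_divide)
    moreover have "norm (f (s (of_real (1 / r)) x)) = norm (f x) / r"
      unfolding f[OF x] using \<open>0 < r\<close> by (simp add: norm_mult norm_divide)
    ultimately show ?thesis using \<open>0 < r\<close> \<open>0 < e\<close> by (simp add: pos_divide_le_eq mult.commute)
  qed
  then have "norm (f x) / e \<le> Q n x" by (rule dense_ge)
  then show ?thesis using \<open>0 < e\<close> by (simp add: field_simps)
qed

text \<open>The polar of the unit ball of \<open>Q n\<close>, expressed through the homogeneous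
  inequality. Its members vanish off X, which is the convention of \<open>lc_dual\<close> and makes
  functionals unique as functions on the whole type.\<close>

definition polar :: "nat \<Rightarrow> ('v \<Rightarrow> 'k) set" where
  "polar n = {\<phi>. (\<forall>x\<in>X. \<forall>y\<in>X. \<phi> (x + y) = \<phi> x + \<phi> y) \<and> (\<forall>c. \<forall>x\<in>X. \<phi> (s c x) = c * \<phi> x)
     \<and> (\<forall>x. x \<notin> X \<longrightarrow> \<phi> x = 0) \<and> (\<forall>x\<in>X. norm (\<phi> x) \<le> Q n x)}"

definition dual :: "('v \<Rightarrow> 'k) set" where
  "dual = (\<Union>n. polar n)"

lemma dual_add: "\<phi> \<in> dual \<Longrightarrow> x \<in> X \<Longrightarrow> y \<in> X \<Longrightarrow> \<phi> (x + y) = \<phi> x + \<phi> y"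
  and dual_scale: "\<phi> \<in> dual \<Longrightarrow> x \<in> X \<Longrightarrow> \<phi> (s c x) = c * \<phi> x"
  and dual_outside: "\<phi> \<in> dual \<Longrightarrow> x \<notin> X \<Longrightarrow> \<phi> x = 0"
  and polar_bound: "\<phi> \<in> polar n \<Longrightarrow> x \<in> X \<Longrightarrow> norm (\<phi> x) \<le> Q n x"
  and polar_subset_dual: "\<phi> \<in> polar n \<Longrightarrow> \<phi> \<in> dual"
  by (auto simp: dual_def polar_def)

lemma dual_polarE:
  assumes "\<phi> \<in> dual" obtains n where "\<phi> \<in> polar n"
  using assms by (auto simp: dual_def)

lemma polarI: "\<phi> \<in> dual \<Longrightarrow> (\<And>x. x \<in> X \<Longrightarrow> norm (\<phi> x) \<le> Q n x) \<Longrightarrow> \<phi> \<in> polar n"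
  by (auto simp: dual_def polar_def)

lemma dual_zero: "\<phi> \<in> dual \<Longrightarrow> \<phi> 0 = 0"
  using dual_scale[OF _ X_0, of \<phi> 0] by simp

lemma dual_diff: "\<phi> \<in> dual \<Longrightarrow> x \<in> X \<Longrightarrow> y \<in> X \<Longrightarrow> \<phi> (x - y) = \<phi> x - \<phi> y"
  using dual_add[of \<phi> x "s (-1) y"] dual_scale[of \<phi> y "-1"] X_scale[of y "-1"] by simp

lemma dual_sum: "\<phi> \<in> dual \<Longrightarrow> (\<And>i. i \<in> A \<Longrightarrow> f i \<in> X) \<Longrightarrow> \<phi> (\<Sum>i\<in>A. f i) = (\<Sum>i\<in>A. \<phi> (f i))"
  by (induction A rule: infinite_finite_induct) (auto simp: dual_zero dual_add X_sum)

text \<open>Each step of the grading at least doubles the seminorms, so a constant below 2^k is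
  absorbed by raising the index by k. This is why the polars exhaust the dual without scalar
  multiples.\<close>

lemma dualI:
  assumes "\<And>x y. x \<in> X \<Longrightarrow> y \<in> X \<Longrightarrow> \<phi> (x + y) = \<phi> x + \<phi> y"
    and "\<And>c x. x \<in> X \<Longrightarrow> \<phi> (s c x) = c * \<phi> x" and "\<And>x. x \<notin> X \<Longrightarrow> \<phi> x = 0"
    and bound: "\<And>x. x \<in> X \<Longrightarrow> norm (\<phi> x) \<le> C * Q n x"
  shows "\<phi> \<in> dual"
proof -
  obtain k where k: "C < 2 ^ k" using real_arch_pow[of 2 C] by auto
  have "norm (\<phi> x) \<le> Q (n + k) x" if "x \<in> X" for x
  proof -
    have "norm (\<phi> x) \<le> C * Q n x" by (rule bound[OF that])
    also have "\<dots> \<le> 2 ^ k * Q n x" using k by (intro mult_right_mono Q_nonneg that) simp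
    also have "\<dots> \<le> Q (n + k) x" by (rule Q_grow[OF that])
    finally show ?thesis .
  qed
  then have "\<phi> \<in> polar (n + k)" using assms(1-3) by (simp add: polar_def)
  then show ?thesis by (rule polar_subset_dual)
qed

lemma dual_zero_fun: "(\<lambda>x. 0) \<in> dual"
  by (rule dualI[of _ 0 0]) auto

lemma dual_scale_fun: "\<phi> \<in> dual \<Longrightarrow> (\<lambda>x. c * \<phi> x) \<in> dual"
proof -
  assume \<phi>: "\<phi> \<in> dual"
  obtain n where n: "\<phi> \<in> polar n" using \<phi> by (rule dual_polarE)
  show ?thesis
    by (rule dualI[of _ "norm c" n])
      (simp_all add: dual_add dual_scale dual_outside \<phi> algebra_simps norm_mult polar_bound[OF n] mult_left_mono)
qed

lemma dual_add_fun: "\<phi> \<in> dual \<Longrightarrow> \<psi> \<in> dual \<Longrightarrow> (\<lambda>x. \<phi> x + \<psi> x) \<in> dual"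
proof -
  assume \<phi>: "\<phi> \<in> dual" and \<psi>: "\<psi> \<in> dual"
  obtain m where m: "\<phi> \<in> polar m" using \<phi> by (rule dual_polarE)
  obtain n where n: "\<psi> \<in> polar n" using \<psi> by (rule dual_polarE)
  show ?thesis
  proof (rule dualI[of _ 2 "max m n"])
    fix x assume x: "x \<in> X"
    show "norm (\<phi> x + \<psi> x) \<le> 2 * Q (max m n) x"
      using norm_triangle_ineq[of "\<phi> x" "\<psi> x"] polar_bound[OF m x] polar_bound[OF n x]
        Q_mono[OF x, of m "max m n"] Q_mono[OF x, of n "max m n"] by simp
  qed (simp_all add: dual_add dual_scale dual_outside \<phi> \<psi> algebra_simps)
qed

lemma dual_diff_fun: "\<phi> \<in> dual \<Longrightarrow> \<psi> \<in> dual \<Longrightarrow> (\<lambda>x. \<phi> x - \<psi> x) \<in> dual"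
  using dual_add_fun[OF _ dual_scale_fun[of \<psi> "-1"]] by simp

text \<open>Alaoglu--Bourbaki: the conditions are closed for pointwise convergence, and the set lies
  in a product of balls whose radius is 0 off X.\<close>

lemma closed_polar: "closed (polar n)" and compact_polar: "compact (polar n)"
proof -
  define r where "r x = (if x \<in> X then Q n x else 0)" for x
  define P where "P = (\<Inter>x\<in>X. \<Inter>y\<in>X. {\<phi> :: 'v \<Rightarrow> 'k. \<phi> (x + y) = \<phi> x + \<phi> y})
    \<inter> (\<Inter>c. \<Inter>x\<in>X. {\<phi>. \<phi> (s c x) = c * \<phi> x})"
  have P: "closed P"
    unfolding P_def
    by (intro closed_Int closed_INT ballI closed_Collect_eq continuous_intros continuous_on_product_coordinates)
  have polar: "polar n = {\<phi>. \<forall>x. norm (\<phi> x) \<le> r x} \<inter> P"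
    by (auto simp: polar_def P_def r_def split: if_splits)
  show "compact (polar n)" unfolding polar using P by (simp add: compact_Int_closed compact_Collect_norm_le)
  have "{\<phi> :: 'v \<Rightarrow> 'k. \<forall>x. norm (\<phi> x) \<le> r x} = (\<Inter>x. {\<phi>. norm (\<phi> x) \<le> r x})" by auto
  then show "closed (polar n)"
    unfolding polar using P by (simp add: closed_Int closed_INT closed_Collect_norm_coordinate_le)
qed

text \<open>Closedness slice by slice, for limits in the norm dual to \<open>Q (Suc n)\<close> of
  members of C in \<open>polar n\<close>. The shift of the index makes these limits comparable with
  pointwise ones, since the unit ball of \<open>Q (Suc n)\<close> is precompact for
  \<open>Q n\<close>.\<close>

definition dual_norm_closed :: "('v \<Rightarrow> 'k) set \<Rightarrow> bool" where
  "dual_norm_closed C \<longleftrightarrow> (\<forall>n. \<forall>\<phi>\<in>dual.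
     (\<forall>\<epsilon>>0. \<exists>\<psi>\<in>C \<inter> polar n. \<forall>x\<in>X. norm (\<psi> x - \<phi> x) \<le> \<epsilon> * Q (Suc n) x) \<longrightarrow> \<phi> \<in> C)"

text \<open>On an equicontinuous set pointwise convergence is uniform on precompact sets.\<close>

lemma closed_Int_polar:
  assumes C: "dual_norm_closed C"
  shows "closed (C \<inter> polar n)"
proof -
  have "\<phi> \<in> C \<inter> polar n" if "\<phi> \<in> closure (C \<inter> polar n)" for \<phi>
  proof -
    have "closure (C \<inter> polar n) \<subseteq> polar n"
      by (rule closure_minimal) (simp_all add: closed_polar)
    with that have \<phi>: "\<phi> \<in> polar n" by blast
    have "\<exists>\<psi>\<in>C \<inter> polar n. \<forall>x\<in>X. norm (\<psi> x - \<phi> x) \<le> \<epsilon> * Q (Suc n) x" if "0 < \<epsilon>" for \<epsilon>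
    proof -
      \<comment> \<open>One third of \<open>\<epsilon>\<close> is spent on the values on the net,
        and one on each of the two functionals at x - y, where \<open>polar n\<close> bounds them by
        \<open>Q n (x - y)\<close>.\<close>
      obtain F where F: "finite F" "F \<subseteq> X" "\<And>x. x \<in> X \<Longrightarrow> Q (Suc n) x \<le> 1 \<Longrightarrow> \<exists>y\<in>F. Q n (x - y) < \<epsilon> / 3"
        using precompact[of "\<epsilon> / 3" n] \<open>0 < \<epsilon>\<close> by auto
      define T where "T = (\<Inter>y\<in>F. {\<psi>. norm (\<psi> y - \<phi> y) < \<epsilon> / 3})"
      have "open T"
        unfolding T_def using F(1)
        by (intro open_INT ballI open_Collect_less continuous_intros continuous_on_product_coordinates)
      moreover have "\<phi> \<in> T" using \<open>0 < \<epsilon>\<close> by (simp add: T_def)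
      ultimately have "T \<inter> (C \<inter> polar n) \<noteq> {}"
        using open_Int_closure_eq_empty[of T "C \<inter> polar n"] \<open>\<phi> \<in> closure (C \<inter> polar n)\<close> by blast
      then obtain \<psi> where \<psi>: "\<psi> \<in> C" "\<psi> \<in> polar n" and near: "\<And>y. y \<in> F \<Longrightarrow> norm (\<psi> y - \<phi> y) < \<epsilon> / 3"
        by (auto simp: T_def)
      have dual: "\<psi> \<in> dual" "\<phi> \<in> dual" using \<psi>(2) \<phi> polar_subset_dual by blast+
      have "norm (\<psi> x - \<phi> x) \<le> \<epsilon>" if x: "x \<in> X" "Q (Suc n) x \<le> 1" for x
      proof -
        obtain y where y: "y \<in> F" "Q n (x - y) < \<epsilon> / 3" using F(3)[OF x] by blast
        then have "y \<in> X" using F(2) by blast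
        have "\<psi> x - \<phi> x = (\<psi> y - \<phi> y) + (\<psi> (x - y) - \<phi> (x - y))"
          by (simp add: dual_diff dual x \<open>y \<in> X\<close>)
        also have "norm \<dots> \<le> norm (\<psi> y - \<phi> y) + (norm (\<psi> (x - y)) + norm (\<phi> (x - y)))"
          using norm_triangle_ineq norm_triangle_ineq4 add_left_mono order_trans by meson
        finally show ?thesis
          using near[OF y(1)] y(2) polar_bound[OF \<psi>(2) X_diff[OF x(1) \<open>y \<in> X\<close>]]
            polar_bound[OF \<phi> X_diff[OF x(1) \<open>y \<in> X\<close>]] by linarith
      qed
      then have "norm (\<psi> x - \<phi> x) \<le> \<epsilon> * Q (Suc n) x" if "x \<in> X" for x
        using that \<open>0 < \<epsilon>\<close>
        by (intro homogeneous_bound[where f = "\<lambda>x. \<psi> x - \<phi> x"])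
          (auto simp: dual_scale dual algebra_simps)
      then show ?thesis using \<psi> by blast
    qed
    then show ?thesis using C \<phi> polar_subset_dual[OF \<phi>] by (auto simp: dual_norm_closed_def)
  qed
  then show ?thesis using closure_subset[of "C \<inter> polar n"] closure_closed
    by (metis closed_closure subsetI subset_antisym)
qed

text \<open>A functional bounded by 1 on the whole unit ball of \<open>Q n\<close> lies in
  \<open>polar n\<close>, where the constraints from P already exclude C. The slice of C in
  \<open>polar (Suc n)\<close> is compact, so finitely many points of that ball suffice for the
  exclusion.\<close>

lemma banach_dieudonne_step:
  assumes C: "dual_norm_closed C"
    and disj: "C \<inter> polar n \<inter> {\<phi>. \<forall>x\<in>P. norm (\<phi> x) \<le> 1} = {}"
  obtains F where "finite F" "F \<subseteq> {x\<in>X. Q n x \<le> 1}"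
    "C \<inter> polar (Suc n) \<inter> {\<phi>. \<forall>x\<in>P \<union> F. norm (\<phi> x) \<le> 1} = {}"
proof -
  let ?K = "(C \<inter> polar (Suc n)) \<inter> (\<Inter>x\<in>P. {\<phi>. norm (\<phi> x) \<le> 1})"
  let ?I = "{x\<in>X. Q n x \<le> 1}"
  have "compact (polar (Suc n) \<inter> (C \<inter> polar (Suc n)))"
    by (intro compact_Int_closed compact_polar closed_Int_polar C)
  then have "compact (C \<inter> polar (Suc n))" by (simp add: Int_absorb1 Int_commute)
  moreover have "closed (\<Inter>x\<in>P. {\<phi> :: 'v \<Rightarrow> 'k. norm (\<phi> x) \<le> 1})"
    by (intro closed_INT ballI closed_Collect_norm_coordinate_le)
  ultimately have K: "compact ?K" by (rule compact_Int_closed)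
  have empty: "?K \<inter> (\<Inter>x\<in>?I. {\<phi>. norm (\<phi> x) \<le> 1}) = {}"
  proof (rule ccontr)
    assume "\<not> ?thesis"
    then obtain \<phi> where "\<phi> \<in> ?K \<inter> (\<Inter>x\<in>?I. {\<phi>. norm (\<phi> x) \<le> 1})" by blast
    then have \<phi>: "\<phi> \<in> C" "\<phi> \<in> polar (Suc n)" "\<forall>x\<in>P. norm (\<phi> x) \<le> 1"
      and small: "\<And>x. x \<in> X \<Longrightarrow> Q n x \<le> 1 \<Longrightarrow> norm (\<phi> x) \<le> 1"
      by simp_all
    have "norm (\<phi> x) \<le> 1 * Q n x" if "x \<in> X" for x
      using that small dual_scale[OF polar_subset_dual[OF \<phi>(2)]] by (intro homogeneous_bound) simp_all
    then have "\<phi> \<in> polar n"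
      by (intro polarI polar_subset_dual[OF \<phi>(2)]) simp
    with \<phi> disj show False by blast
  qed
  have "\<exists>F. finite F \<and> F \<subseteq> ?I \<and> ?K \<inter> (\<Inter>x\<in>F. {\<phi>. norm (\<phi> x) \<le> 1}) = {}"
  proof (rule ccontr)
    assume none: "\<not> ?thesis"
    have "?K \<inter> (\<Inter>x\<in>?I. {\<phi>. norm (\<phi> x) \<le> 1}) \<noteq> {}"
    proof (rule compact_imp_fip_image[OF K closed_Collect_norm_coordinate_le])
      fix F assume "finite F" "F \<subseteq> ?I"
      with none show "?K \<inter> (\<Inter>x\<in>F. {\<phi>. norm (\<phi> x) \<le> 1}) \<noteq> {}" by meson
    qed
    with empty show False by contradiction
  qed
  then obtain F where F: "finite F" "F \<subseteq> ?I" "?K \<inter> (\<Inter>x\<in>F. {\<phi>. norm (\<phi> x) \<le> 1}) = {}"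
    by meson
  have "C \<inter> polar (Suc n) \<inter> {\<phi>. \<forall>x\<in>P \<union> F. norm (\<phi> x) \<le> 1} = {}"
    using F(3) by auto
  with F(1,2) show thesis by (rule that)
qed

lemma enumerate_null_family:
  assumes "countable S" "S \<subseteq> X" and fin: "\<And>n \<epsilon>. 0 < \<epsilon> \<Longrightarrow> finite {x\<in>S. \<epsilon> \<le> Q n x}"
  obtains xs where "\<And>k. xs k \<in> X" "\<And>n. (\<lambda>k. Q n (xs k)) \<longlonglongrightarrow> 0" "S \<subseteq> range xs"
proof -
  let ?i = "to_nat_on S"
  \<comment> \<open>Indices left over by the enumeration, which exist when \<open>S\<close> is
    finite, get the value 0.\<close>
  define xs where "xs k = (if k \<in> ?i ` S then from_nat_into S k else 0)" for k
  have xs: "xs (?i x) = x" if "x \<in> S" for x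
    using that assms(1) by (simp add: xs_def)
  have cases: "xs k \<in> S \<and> k = ?i (xs k) \<or> xs k = 0" for k
    using xs by (auto simp: xs_def assms(1))
  show thesis
  proof
    show "xs k \<in> X" for k using cases[of k] assms(2) by auto
    show "S \<subseteq> range xs" using xs by (metis rangeI subsetI)
    fix n
    show "(\<lambda>k. Q n (xs k)) \<longlonglongrightarrow> 0"
    proof (rule LIMSEQ_I)
      fix r :: real assume "0 < r"
      have "finite (?i ` {x\<in>S. r \<le> Q n x})" using fin[OF \<open>0 < r\<close>] by simp
      then obtain N where N: "\<forall>k\<in>?i ` {x\<in>S. r \<le> Q n x}. k < N"
        unfolding finite_nat_set_iff_bounded ..
      have "norm (Q n (xs k) - 0) < r" if "k \<ge> N" for k
      proof (rule ccontr)
        assume "\<not> ?thesis"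
        then have "r \<le> Q n (xs k)" using Q_nonneg \<open>xs k \<in> X\<close> by simp
        then have "k \<in> ?i ` {x\<in>S. r \<le> Q n x}" using cases[of k] \<open>0 < r\<close> by force
        with N that show False by (meson not_le)
      qed
      then show "\<exists>N. \<forall>k\<ge>N. norm (Q n (xs k) - 0) < r" by blast
    qed
  qed
qed

text \<open>The finite sets of all stages together exclude C, as the polars exhaust the dual. A
  point added after stage n has \<open>Q n\<close> at most 1, and the doubling of the seminorms then
  makes the union a null sequence.\<close>

lemma banach_dieudonne:
  assumes C: "dual_norm_closed C" and "(\<lambda>x. 0) \<notin> C"
  obtains xs where "\<And>k. xs k \<in> X" "\<And>n. (\<lambda>k. Q n (xs k)) \<longlonglongrightarrow> 0"
    "\<And>\<phi>. \<phi> \<in> C \<Longrightarrow> \<phi> \<in> dual \<Longrightarrow> \<exists>k. 1 < norm (\<phi> (xs k))"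
proof -
  define good where "good n P \<longleftrightarrow> finite P \<and> P \<subseteq> X \<and> C \<inter> polar n \<inter> {\<phi>. \<forall>x\<in>P. norm (\<phi> x) \<le> 1} = {}" for n P
  have "polar 0 \<subseteq> {\<lambda>x. 0}"
  proof
    fix \<phi> assume "\<phi> \<in> polar 0"
    then have "\<phi> x = 0" for x
      by (cases "x \<in> X") (use Q_0[of x] in \<open>auto simp: polar_def\<close>)
    then show "\<phi> \<in> {\<lambda>x. 0}" by auto
  qed
  with assms(2) have base: "good 0 {}" by (auto simp: good_def)
  have step: "\<exists>P'. good (Suc n) P' \<and> (P \<subseteq> P' \<and> (\<forall>x\<in>P' - P. Q n x \<le> 1))" if P: "good n P" for n P
  proof -
    obtain F where "finite F" "F \<subseteq> {x\<in>X. Q n x \<le> 1}"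
      "C \<inter> polar (Suc n) \<inter> {\<phi>. \<forall>x\<in>P \<union> F. norm (\<phi> x) \<le> 1} = {}"
      using banach_dieudonne_step[OF C, of n P] P by (auto simp: good_def)
    then show ?thesis using P by (intro exI[of _ "P \<union> F"]) (auto simp: good_def)
  qed
  have "\<exists>P. \<forall>n. good n (P n) \<and> (P n \<subseteq> P (Suc n) \<and> (\<forall>x\<in>P (Suc n) - P n. Q n x \<le> 1))"
    using base step by (intro dependent_nat_choice) blast+
  then obtain P where "\<forall>n. good n (P n) \<and> (P n \<subseteq> P (Suc n) \<and> (\<forall>x\<in>P (Suc n) - P n. Q n x \<le> 1))" ..
  then have P: "good n (P n)" "P n \<subseteq> P (Suc n)" "x \<in> P (Suc n) \<Longrightarrow> x \<notin> P n \<Longrightarrow> Q n x \<le> 1" for n x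
    by blast+
  let ?S = "\<Union>n. P n"
  have "finite {x\<in>?S. \<epsilon> \<le> Q n x}" if "0 < \<epsilon>" for n \<epsilon>
  proof -
    obtain k where k: "1 / \<epsilon> < 2 ^ k" using real_arch_pow[of 2 "1 / \<epsilon>"] by auto
    \<comment> \<open>A point outside \<open>P (n + k)\<close> enters so late that
      \<open>Q (n + k)\<close> is at most 1 there, and \<open>Q n\<close> is smaller by the factor
      2^k.\<close>
    have small: "Q n x < \<epsilon>" if "x \<in> P m" "x \<notin> P (n + k)" for x m
      using that(1)
    proof (induction m)
      case 0
      then show ?case using that(2) P(2) lift_Suc_mono_le[of P 0 "n + k"] by blast
    next
      case (Suc m)
      show ?case
      proof (cases "x \<in> P m")
        case False
        then have Qm: "Q m x \<le> 1" using P(3) Suc.prems by blast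
        have "\<not> Suc m \<le> n + k" using that(2) Suc.prems P(2) lift_Suc_mono_le[of P "Suc m" "n + k"] by blast
        have x: "x \<in> X" using P(1)[of "Suc m"] Suc.prems by (auto simp: good_def)
        have "2 ^ k * Q n x \<le> Q (n + k) x" by (rule Q_grow[OF x])
        also have "\<dots> \<le> Q m x" using \<open>\<not> Suc m \<le> n + k\<close> by (intro Q_mono x) simp
        finally have "2 ^ k * Q n x \<le> 1" using Qm by simp
        then have "Q n x \<le> 1 / 2 ^ k" by (simp add: field_simps)
        also have "\<dots> < \<epsilon>" using k \<open>0 < \<epsilon>\<close> by (simp add: field_simps)
        finally show ?thesis .
      qed (rule Suc.IH)
    qed
    have "{x\<in>?S. \<epsilon> \<le> Q n x} \<subseteq> P (n + k)" using small by fastforce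
    then show ?thesis using P(1)[of "n + k"] finite_subset by (auto simp: good_def)
  qed
  moreover have "countable ?S" "?S \<subseteq> X"
    using P(1) by (auto simp: good_def intro: countable_finite)
  ultimately obtain xs where xs: "\<And>k. xs k \<in> X" "\<And>n. (\<lambda>k. Q n (xs k)) \<longlonglongrightarrow> 0" "?S \<subseteq> range xs"
    using enumerate_null_family[of ?S] by blast
  show thesis
  proof (rule that[OF xs(1,2)])
    fix \<phi> assume "\<phi> \<in> C" "\<phi> \<in> dual"
    then obtain n where "\<phi> \<in> polar n" by (blast elim: dual_polarE)
    then obtain x where "x \<in> P n" "\<not> norm (\<phi> x) \<le> 1"
      using \<open>\<phi> \<in> C\<close> P(1)[of n] by (auto simp: good_def)
    moreover from this obtain k where "x = xs k" using xs(3) by blast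
    ultimately show "\<exists>k. 1 < norm (\<phi> (xs k))" by (auto simp: not_le)
  qed
qed

end

section \<open>Absolutely summable combinations of a null sequence\<close>

context graded_schwartz
begin

text \<open>A relation, because the seminorms of this locale may have a common null vector, so that
  a convergent series can have several limits.\<close>

definition series_limit :: "(nat \<Rightarrow> 'v) \<Rightarrow> (nat \<Rightarrow> 'k) \<Rightarrow> 'v \<Rightarrow> bool" where
  "series_limit xs c x \<longleftrightarrow> x \<in> X \<and> (\<forall>n. (\<lambda>N. Q n ((\<Sum>k<N. s (c k) (xs k)) - x)) \<longlonglongrightarrow> 0)"

lemma partial_sum_in_X: "(\<And>k. xs k \<in> X) \<Longrightarrow> (\<Sum>k<N. s (c k) (xs k)) \<in> X"
  by (intro X_sum X_scale)

lemma null_sequence_bounded: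
  fixes n :: nat
  assumes "(\<lambda>k. Q n (xs k)) \<longlonglongrightarrow> 0"
  obtains R where "0 < R" "\<And>k. Q n (xs k) \<le> R"
proof -
  obtain R where "0 < R" "\<And>k. norm (Q n (xs k)) \<le> R"
    using convergent_imp_Bseq[OF convergentI[OF assms]] by (auto simp: Bseq_def)
  then show thesis using that by (metis abs_le_D1 real_norm_def)
qed

lemma series_limit_exists:
  assumes xs: "\<And>k. xs k \<in> X" and null: "\<And>n. (\<lambda>k. Q n (xs k)) \<longlonglongrightarrow> 0"
    and c: "\<And>N. (\<Sum>k<N. norm (c k)) \<le> B"
  obtains x where "series_limit xs c x"
proof -
  have summable: "summable (\<lambda>k. norm (c k))"
    by (rule summableI_nonneg_bounded[of _ B]) (use c in auto)
  let ?p = "\<lambda>N. \<Sum>k<N. s (c k) (xs k)"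
  have cauchy: "\<exists>N. \<forall>k\<ge>N. \<forall>l\<ge>N. Q n (?p k - ?p l) < \<epsilon>" if "0 < \<epsilon>" for n \<epsilon>
  proof -
    obtain R where R: "0 < R" "\<And>k. Q n (xs k) \<le> R" using null_sequence_bounded[OF null] by blast
    obtain N where N: "\<And>k l. N \<le> k \<Longrightarrow> norm (sum (\<lambda>k. norm (c k)) {k..<l}) < \<epsilon> / R"
      using summable[unfolded summable_Cauchy] \<open>0 < \<epsilon>\<close> R(1) by (meson divide_pos_pos)
    have le: "Q n (?p l - ?p k) < \<epsilon>" if "N \<le> k" "k \<le> l" for k l
    proof -
      have "?p l = ?p k + (\<Sum>i\<in>{k..<l}. s (c i) (xs i))"
        using sum.atLeastLessThan_concat[of 0 k l "\<lambda>k. s (c k) (xs k)"] \<open>k \<le> l\<close>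
        by (simp add: atLeast0LessThan)
      then have "Q n (?p l - ?p k) = Q n (\<Sum>i\<in>{k..<l}. s (c i) (xs i))" by simp
      also have "\<dots> \<le> (\<Sum>i\<in>{k..<l}. norm (c i) * Q n (xs i))"
        using Q_sum[of "{k..<l}" "\<lambda>i. s (c i) (xs i)" n] by (simp add: X_scale Q_scale xs)
      also have "\<dots> \<le> (\<Sum>i\<in>{k..<l}. norm (c i) * R)" by (intro sum_mono mult_left_mono R) simp
      also have "\<dots> = norm (sum (\<lambda>k. norm (c k)) {k..<l}) * R" by (simp add: sum_distrib_right sum_nonneg)
      also have "\<dots> < \<epsilon>" using N[OF \<open>N \<le> k\<close>] R(1) by (simp add: pos_less_divide_eq)
      finally show ?thesis .
    qed
    have "Q n (?p k - ?p l) < \<epsilon>" if "N \<le> k" "N \<le> l" for k l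
    proof -
      have "Q n (?p k - ?p l) = Q n (?p l - ?p k)" by (intro Q_diff_commute partial_sum_in_X xs)
      then show ?thesis using le[of k l] le[of l k] that by (cases "k \<le> l") auto
    qed
    then show ?thesis by blast
  qed
  have "\<exists>x\<in>X. \<forall>n. (\<lambda>N. Q n (?p N - x)) \<longlonglongrightarrow> 0"
    by (rule complete[OF partial_sum_in_X[OF xs] cauchy])
  then obtain x where "x \<in> X" "\<forall>n. (\<lambda>N. Q n (?p N - x)) \<longlonglongrightarrow> 0" ..
  then show thesis by (intro that) (simp add: series_limit_def)
qed

lemma dual_null:
  assumes "\<phi> \<in> dual" "\<And>k. xs k \<in> X" "\<And>n. (\<lambda>k. Q n (xs k)) \<longlonglongrightarrow> 0"
  shows "(\<lambda>k. \<phi> (xs k)) \<longlonglongrightarrow> 0"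
proof -
  obtain n where "\<phi> \<in> polar n" using assms(1) by (rule dual_polarE)
  then show ?thesis
    by (intro tendsto_0_le[OF assms(3)[of n], of _ 1] always_eventually)
      (simp add: Q_nonneg assms(2) polar_bound)
qed

lemma series_limit_dual:
  assumes "\<phi> \<in> dual" "\<And>k. xs k \<in> X" "series_limit xs c x"
  shows "(\<lambda>k. c k * \<phi> (xs k)) sums \<phi> x"
proof -
  have x: "x \<in> X" using assms(3) by (simp add: series_limit_def)
  have "(\<lambda>N. \<phi> ((\<Sum>k<N. s (c k) (xs k)) - x)) \<longlonglongrightarrow> 0"
    using assms by (intro dual_null X_diff partial_sum_in_X) (auto simp: series_limit_def)
  moreover have "\<phi> ((\<Sum>k<N. s (c k) (xs k)) - x) = (\<Sum>k<N. c k * \<phi> (xs k)) - \<phi> x" for N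
    using assms by (simp add: dual_diff partial_sum_in_X x dual_sum X_scale dual_scale)
  ultimately show ?thesis unfolding sums_def by (simp add: LIM_zero_iff)
qed

end

section \<open>Separating subspaces of the dual\<close>

locale graded_schwartz_banach = graded_schwartz s X Q
  for s :: "'k::{real_normed_field,banach} \<Rightarrow> 'v::ab_group_add \<Rightarrow> 'v" and X Q
begin

text \<open>Krein--Smulian, in the form that suffices for Schwartz spaces.\<close>

theorem separating_norm_closed_subspace_eq_dual:
  assumes H: "H \<subseteq> dual" and zero: "(\<lambda>x. 0) \<in> H"
    and add: "\<And>g h. g \<in> H \<Longrightarrow> h \<in> H \<Longrightarrow> (\<lambda>x. g x + h x) \<in> H"
    and scale: "\<And>c h. h \<in> H \<Longrightarrow> (\<lambda>x. c * h x) \<in> H"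
    and closed: "\<And>\<phi> n. \<phi> \<in> dual \<Longrightarrow>
      (\<And>\<epsilon>. 0 < \<epsilon> \<Longrightarrow> \<exists>h\<in>H. \<forall>x\<in>X. norm (h x - \<phi> x) \<le> \<epsilon> * Q n x) \<Longrightarrow> \<phi> \<in> H"
    and separating: "\<And>x. x \<in> X \<Longrightarrow> (\<And>h. h \<in> H \<Longrightarrow> h x = 0) \<Longrightarrow> x = 0"
  shows "H = dual"
proof (rule ccontr)
  assume "H \<noteq> dual"
  then obtain \<phi>0 where \<phi>0: "\<phi>0 \<in> dual" "\<phi>0 \<notin> H" using H by blast
  \<comment> \<open>The translate of \<open>H\<close> by - \<open>\<phi>0\<close> misses 0 and
    inherits closedness. The null sequence obtained for it keeps the values of
    \<open>\<phi>0\<close> at supremum distance at least 1 from the values of each member of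
    \<open>H\<close>.\<close>
  define C where "C = (\<lambda>h x. h x - \<phi>0 x) ` H"
  have "dual_norm_closed C"
    unfolding dual_norm_closed_def
  proof (intro allI ballI impI)
    fix n \<phi>
    assume \<phi>: "\<phi> \<in> dual"
      and lim: "\<forall>\<epsilon>>0. \<exists>\<psi>\<in>C \<inter> polar n. \<forall>x\<in>X. norm (\<psi> x - \<phi> x) \<le> \<epsilon> * Q (Suc n) x"
    have "(\<lambda>x. \<phi> x + \<phi>0 x) \<in> H"
    proof (rule closed[OF dual_add_fun[OF \<phi> \<phi>0(1)]])
      fix \<epsilon> :: real assume "0 < \<epsilon>"
      with lim obtain \<psi> where "\<psi> \<in> C" and \<psi>: "\<forall>x\<in>X. norm (\<psi> x - \<phi> x) \<le> \<epsilon> * Q (Suc n) x" by blast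
      then obtain h where "h \<in> H" "\<psi> = (\<lambda>x. h x - \<phi>0 x)" by (auto simp: C_def)
      then show "\<exists>h\<in>H. \<forall>x\<in>X. norm (h x - (\<phi> x + \<phi>0 x)) \<le> \<epsilon> * Q (Suc n) x"
        using \<psi> by (intro bexI[of _ h]) (simp_all add: algebra_simps)
    qed
    then show "\<phi> \<in> C" unfolding C_def by (rule rev_image_eqI) simp
  qed
  moreover have "(\<lambda>x. 0) \<notin> C"
  proof
    assume "(\<lambda>x. 0) \<in> C"
    then obtain h where "h \<in> H" "(\<lambda>x. 0) = (\<lambda>x. h x - \<phi>0 x)" by (auto simp: C_def)
    then have "h = \<phi>0" by (metis eq_iff_diff_eq_0 ext)
    with \<open>h \<in> H\<close> \<phi>0 show False by simp
  qed
  ultimately obtain xs where xs: "\<And>k. xs k \<in> X" "\<And>n. (\<lambda>k. Q n (xs k)) \<longlonglongrightarrow> 0"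
    and far: "\<And>\<phi>. \<phi> \<in> C \<Longrightarrow> \<phi> \<in> dual \<Longrightarrow> \<exists>k. 1 < norm (\<phi> (xs k))"
    by (rule banach_dieudonne) blast
  define Y where "Y = (\<lambda>h k. h (xs k)) ` H"
  obtain \<mu> where \<mu>: "\<And>N. (\<Sum>k<N. norm (\<mu> k)) \<le> 1"
    "\<And>y. y \<in> Y \<Longrightarrow> (\<lambda>k. \<mu> k * y k) sums 0" "(\<Sum>k. \<mu> k * \<phi>0 (xs k)) \<noteq> 0"
  proof (rule c0_separation[of Y "\<lambda>k. \<phi>0 (xs k)"])
    show "(\<lambda>k. 0) \<in> Y" unfolding Y_def by (rule rev_image_eqI[OF zero]) simp
    show "(\<lambda>k. y k + z k) \<in> Y" if yz: "y \<in> Y" "z \<in> Y" for y z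
    proof -
      obtain g h where "g \<in> H" "h \<in> H" "y = (\<lambda>k. g (xs k))" "z = (\<lambda>k. h (xs k))"
        using yz by (auto simp: Y_def)
      then show ?thesis unfolding Y_def by (intro rev_image_eqI[OF add[of g h]]) auto
    qed
    show "(\<lambda>k. c * y k) \<in> Y" if y: "y \<in> Y" for c y
    proof -
      obtain h where "h \<in> H" "y = (\<lambda>k. h (xs k))" using y by (auto simp: Y_def)
      then show ?thesis unfolding Y_def by (intro rev_image_eqI[OF scale[of h c]]) auto
    qed
    show "y \<longlonglongrightarrow> 0" if "y \<in> Y" for y
      using that H by (auto simp: Y_def intro!: dual_null xs)
    show "(\<lambda>k. \<phi>0 (xs k)) \<longlonglongrightarrow> 0" by (intro dual_null xs \<phi>0)
    show "\<exists>k. 1 \<le> norm (\<phi>0 (xs k) - y k)" if y: "y \<in> Y" for y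
    proof -
      obtain h where h: "h \<in> H" "y = (\<lambda>k. h (xs k))" using y by (auto simp: Y_def)
      have "(\<lambda>x. h x - \<phi>0 x) \<in> dual" using h(1) H by (intro dual_diff_fun \<phi>0) auto
      then obtain k where "1 < norm (h (xs k) - \<phi>0 (xs k))"
        using far[of "\<lambda>x. h x - \<phi>0 x"] h(1) by (auto simp: C_def)
      then show ?thesis by (auto simp: h(2) norm_minus_commute intro: less_imp_le)
    qed
  qed blast
  \<comment> \<open>The l^1 functional becomes a point of the space: evaluating a functional at this
    sum gives the series with coefficients \<open>\<mu> k\<close>.\<close>
  obtain x where x: "series_limit xs \<mu> x" using series_limit_exists[OF xs \<mu>(1)] by blast
  have "h x = 0" if h: "h \<in> H" for h
  proof -
    have "(\<lambda>k. \<mu> k * h (xs k)) sums h x" using h H by (intro series_limit_dual xs x) auto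
    moreover have "(\<lambda>k. \<mu> k * h (xs k)) sums 0" using h by (intro \<mu>(2)) (auto simp: Y_def)
    ultimately show ?thesis by (rule sums_unique2)
  qed
  then have "x = 0" using x by (intro separating) (auto simp: series_limit_def)
  moreover have "\<phi>0 x \<noteq> 0"
    using series_limit_dual[OF \<phi>0(1) xs(1) x] \<mu>(3) by (simp add: sums_iff)
  ultimately show False using dual_zero[OF \<phi>0(1)] by simp
qed

end

section \<open>Compact hulls of null sequences\<close>

context graded_schwartz
begin

text \<open>For a null sequence this is the closed absolutely convex hull, parametrised by the unit
  ball of l^1. Bounding partial sums makes each condition depend on finitely many coordinates, hence
  closed for coordinatewise convergence.\<close>

definition null_hull :: "(nat \<Rightarrow> 'v) \<Rightarrow> 'v set" where
  "null_hull xs = {x. \<exists>c. (\<forall>N. (\<Sum>k<N. norm (c k)) \<le> 1) \<and> series_limit xs c x}"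

lemma mem_null_hull:
  assumes "\<And>k. xs k \<in> X"
  shows "xs k \<in> null_hull xs"
proof -
  define c :: "nat \<Rightarrow> 'k" where "c j = (if j = k then 1 else 0)" for j
  have "(\<Sum>j<N. norm (c j)) \<le> 1" for N
    by (simp add: c_def if_distrib[of norm] sum.delta cong: if_cong)
  moreover have "(\<Sum>j<N. s (c j) (xs j)) = xs k" if "k < N" for N
    using that by (simp add: c_def if_distrib[of "\<lambda>c. s c _"] sum.delta cong: if_cong)
  then have "Q n ((\<Sum>j<N. s (c j) (xs j)) - xs k) = 0" if "k < N" for n N
    using that by simp
  then have "(\<lambda>N. Q n ((\<Sum>j<N. s (c j) (xs j)) - xs k)) \<longlonglongrightarrow> 0" for n
    by (intro tendsto_eventually eventually_sequentiallyI[of "Suc k"]) simp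
  ultimately show ?thesis using assms by (auto simp: null_hull_def series_limit_def intro!: exI[of _ c])
qed

lemma absconvex_null_hull:
  assumes xs: "\<And>k. xs k \<in> X"
  shows "absconvex s (null_hull xs)"
  unfolding absconvex_def
proof (intro ballI allI impI)
  fix x y and a b :: 'k
  assume "x \<in> null_hull xs" "y \<in> null_hull xs" and ab: "norm a + norm b \<le> 1"
  then obtain c d where c: "\<And>N. (\<Sum>k<N. norm (c k)) \<le> 1" "series_limit xs c x"
    and d: "\<And>N. (\<Sum>k<N. norm (d k)) \<le> 1" "series_limit xs d y"
    by (auto simp: null_hull_def)
  have x: "x \<in> X" and y: "y \<in> X" using c d by (auto simp: series_limit_def)
  let ?e = "\<lambda>k. a * c k + b * d k"
  have "(\<Sum>k<N. norm (?e k)) \<le> 1" for N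
  proof -
    have "(\<Sum>k<N. norm (?e k)) \<le> (\<Sum>k<N. norm a * norm (c k) + norm b * norm (d k))"
      by (intro sum_mono order_trans[OF norm_triangle_ineq]) (simp add: norm_mult)
    also have "\<dots> = norm a * (\<Sum>k<N. norm (c k)) + norm b * (\<Sum>k<N. norm (d k))"
      by (simp add: sum.distrib sum_distrib_left)
    also have "\<dots> \<le> norm a * 1 + norm b * 1" by (intro add_mono mult_left_mono c d) auto
    finally show ?thesis using ab by simp
  qed
  moreover have "series_limit xs ?e (s a x + s b y)"
    unfolding series_limit_def
  proof (intro conjI allI)
    show "s a x + s b y \<in> X" by (intro X_add X_scale x y)
    fix n
    let ?p = "\<lambda>c N. \<Sum>k<N. s (c k) (xs k)"
    have lim: "(\<lambda>N. norm a * Q n (?p c N - x) + norm b * Q n (?p d N - y)) \<longlonglongrightarrow> 0"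
      using c(2) d(2) by (auto simp: series_limit_def intro!: tendsto_eq_intros)
    have "norm (Q n (?p ?e N - (s a x + s b y)))
        \<le> norm a * Q n (?p c N - x) + norm b * Q n (?p d N - y)" for N
    proof -
      have p: "?p c N - x \<in> X" "?p d N - y \<in> X" by (intro X_diff partial_sum_in_X xs x y)+
      have "?p ?e N - (s a x + s b y) = s a (?p c N - x) + s b (?p d N - y)"
        by (simp add: scale_right_diff_distrib scale_sum_right scale_left_distrib sum.distrib)
      then show ?thesis
        using Q_add[OF X_scale[OF p(1), of a] X_scale[OF p(2), of b], of n]
          Q_nonneg[OF X_add[OF X_scale[OF p(1), of a] X_scale[OF p(2), of b]], of n]
        by (simp add: Q_scale p)
    qed
    then show "(\<lambda>N. Q n (?p ?e N - (s a x + s b y))) \<longlonglongrightarrow> 0"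
      by (intro Lim_null_comparison[OF always_eventually lim] allI)
  qed
  ultimately show "s a x + s b y \<in> null_hull xs" by (auto simp: null_hull_def intro!: exI[of _ ?e])
qed

text \<open>Continuity of the sum in its coefficients, for coordinatewise convergence. From N on the
  vectors have seminorm at most \<delta>, and both coefficient sequences have l^1 norm at most 1, so
  the tail costs at most 2 \<delta>.\<close>

lemma series_limit_close:
  assumes xs: "\<And>k. xs k \<in> X" and small: "\<And>k. N \<le> k \<Longrightarrow> Q n (xs k) \<le> \<delta>"
    and c: "\<And>N. (\<Sum>k<N. norm (c k)) \<le> 1" "series_limit xs c x"
    and d: "\<And>N. (\<Sum>k<N. norm (d k)) \<le> 1" "series_limit xs d y"
  shows "Q n (y - x) \<le> (\<Sum>k<N. norm (d k - c k) * Q n (xs k)) + 2 * \<delta>"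
proof -
  have x: "x \<in> X" and y: "y \<in> X" using c d by (auto simp: series_limit_def)
  have "0 \<le> \<delta>" using small[of N] Q_nonneg[OF xs, of n N] by linarith
  let ?p = "\<lambda>c N. \<Sum>k<N. s (c k) (xs k)"
  let ?R = "(\<Sum>k<N. norm (d k - c k) * Q n (xs k)) + 2 * \<delta>"
  have p: "?p c m \<in> X" for c m by (intro partial_sum_in_X xs)
  have diff: "Q n (?p d m - ?p c m) \<le> ?R" if "N \<le> m" for m
  proof -
    have "?p d m - ?p c m = (\<Sum>k<m. s (d k - c k) (xs k))"
      by (simp add: scale_left_diff_distrib sum_subtractf)
    then have "Q n (?p d m - ?p c m) \<le> (\<Sum>k<m. norm (d k - c k) * Q n (xs k))"
      using Q_sum[of "{..<m}" "\<lambda>k. s (d k - c k) (xs k)" n] by (simp add: X_scale Q_scale xs)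
    also have "\<dots> = (\<Sum>k<N. norm (d k - c k) * Q n (xs k)) + (\<Sum>k\<in>{N..<m}. norm (d k - c k) * Q n (xs k))"
      using sum.atLeastLessThan_concat[of 0 N m "\<lambda>k. norm (d k - c k) * Q n (xs k)"] that
      by (simp add: atLeast0LessThan)
    also have "(\<Sum>k\<in>{N..<m}. norm (d k - c k) * Q n (xs k)) \<le> (\<Sum>k\<in>{N..<m}. (norm (d k) + norm (c k)) * \<delta>)"
      using \<open>0 \<le> \<delta>\<close> by (intro sum_mono mult_mono norm_triangle_ineq4 small Q_nonneg xs) auto
    also have "\<dots> \<le> (\<Sum>k<m. (norm (d k) + norm (c k)) * \<delta>)"
      using \<open>0 \<le> \<delta>\<close> by (intro sum_mono2) auto
    also have "\<dots> = ((\<Sum>k<m. norm (d k)) + (\<Sum>k<m. norm (c k))) * \<delta>"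
      by (simp add: sum_distrib_right sum.distrib distrib_right)
    also have "\<dots> \<le> (1 + 1) * \<delta>" using \<open>0 \<le> \<delta>\<close> by (intro mult_right_mono add_mono c d)
    finally show ?thesis by simp
  qed
  have "Q n (y - x) \<le> Q n (?p d m - y) + ?R + Q n (?p c m - x)" if "N \<le> m" for m
  proof -
    have eq: "y - x = (y - ?p d m) + ((?p d m - ?p c m) + (?p c m - x))" by simp
    have "Q n (y - x) \<le> Q n (y - ?p d m) + (Q n (?p d m - ?p c m) + Q n (?p c m - x))"
      unfolding eq
      by (rule order_trans[OF Q_add add_left_mono[OF Q_add]]) (intro X_add X_diff p x y)+
    then show ?thesis using diff[OF that] Q_diff_commute[OF y p, of n d m] by simp
  qed
  moreover have "(\<lambda>m. Q n (?p d m - y) + ?R + Q n (?p c m - x)) \<longlonglongrightarrow> ?R"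
    using c(2) d(2) by (auto simp: series_limit_def intro!: tendsto_eq_intros)
  ultimately show ?thesis by (intro LIMSEQ_le_const) auto
qed

text \<open>The hull is the image of the unit ball of the summable sequences, which is compact for
  coordinatewise convergence.\<close>

lemma null_hull_finite_subcover:
  assumes xs: "\<And>k. xs k \<in> X" and null: "\<And>n. (\<lambda>k. Q n (xs k)) \<longlonglongrightarrow> 0"
    and opn: "\<And>U x. U \<in> \<U> \<Longrightarrow> x \<in> U \<Longrightarrow> \<exists>n. \<exists>\<epsilon>>0. {y\<in>X. Q n (y - x) < \<epsilon>} \<subseteq> U"
    and cover: "null_hull xs \<subseteq> \<Union>\<U>"
  shows "\<exists>\<V>\<subseteq>\<U>. finite \<V> \<and> null_hull xs \<subseteq> \<Union>\<V>"
proof -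
  define B where "B = {c :: nat \<Rightarrow> 'k. \<forall>N. (\<Sum>k<N. norm (c k)) \<le> 1}"
  have "compact B"
  proof -
    have "closed (\<Inter>N. {c :: nat \<Rightarrow> 'k. (\<Sum>k<N. norm (c k)) \<le> 1})"
      by (intro closed_INT ballI closed_Collect_le[OF continuous_on_sum[OF continuous_on_norm] continuous_on_const]
        continuous_on_product_coordinates)
    moreover have "norm (c k) \<le> 1" if "c \<in> B" for c k
    proof -
      have "norm (c k) \<le> (\<Sum>j<Suc k. norm (c j))" by (rule member_le_sum) auto
      also have "\<dots> \<le> 1" using that unfolding B_def by blast
      finally show ?thesis .
    qed
    then have "B = {c. \<forall>k. norm (c k) \<le> 1} \<inter> (\<Inter>N. {c. (\<Sum>k<N. norm (c k)) \<le> 1})"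
      by (auto simp: B_def)
    ultimately show ?thesis by (simp add: compact_Int_closed compact_Collect_norm_le)
  qed
  \<comment> \<open>As limits need not be unique, the neighbourhood of \<open>c\<close> has to place
    every limit of every nearby series in the same \<open>U\<close>.\<close>
  have "\<exists>U\<in>\<U>. \<exists>V. open V \<and> c \<in> V \<and> (\<forall>d\<in>B \<inter> V. \<forall>y. series_limit xs d y \<longrightarrow> y \<in> U)" if c: "c \<in> B" for c
  proof -
    obtain x where x: "series_limit xs c x"
      using series_limit_exists[OF xs null, of c 1] c by (auto simp: B_def)
    then obtain U where U: "U \<in> \<U>" "x \<in> U" using cover c by (auto simp: null_hull_def B_def)
    obtain n \<epsilon> where \<epsilon>: "0 < \<epsilon>" "{y\<in>X. Q n (y - x) < \<epsilon>} \<subseteq> U" using opn[OF U] by blast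
    \<comment> \<open>The tail may cost twice \<open>\<epsilon> / 4\<close>, which leaves
      \<open>\<epsilon> / 2\<close> for the finitely many coordinates that define
      \<open>V\<close>.\<close>
    obtain N where N: "\<And>k. N \<le> k \<Longrightarrow> norm (Q n (xs k) - 0) < \<epsilon> / 4"
      using LIMSEQ_D[OF null, of "\<epsilon> / 4"] \<epsilon>(1) by auto
    define V where "V = {d. (\<Sum>k<N. norm (d k - c k) * Q n (xs k)) < \<epsilon> / 2}"
    have "open V"
      unfolding V_def by (intro open_Collect_less continuous_intros continuous_on_product_coordinates)
    moreover have "c \<in> V" using \<epsilon>(1) by (simp add: V_def)
    moreover have "y \<in> U" if d: "d \<in> B \<inter> V" "series_limit xs d y" for d y
    proof -
      have "Q n (y - x) \<le> (\<Sum>k<N. norm (d k - c k) * Q n (xs k)) + 2 * (\<epsilon> / 4)"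
      proof (rule series_limit_close[OF xs _ _ x _ d(2)])
        show "Q n (xs k) \<le> \<epsilon> / 4" if "N \<le> k" for k using N[OF that] by simp
      qed (use c d in \<open>auto simp: B_def\<close>)
      also have "\<dots> < \<epsilon>" using d(1) by (simp add: V_def)
      finally show ?thesis using \<epsilon>(2) d(2) by (auto simp: series_limit_def)
    qed
    ultimately show ?thesis using U(1) by blast
  qed
  then obtain U V where UV: "\<And>c. c \<in> B \<Longrightarrow> U c \<in> \<U>" "\<And>c. c \<in> B \<Longrightarrow> open (V c)" "\<And>c. c \<in> B \<Longrightarrow> c \<in> V c"
    "\<And>c d y. c \<in> B \<Longrightarrow> d \<in> B \<Longrightarrow> d \<in> V c \<Longrightarrow> series_limit xs d y \<Longrightarrow> y \<in> U c"
    by (metis IntI)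
  obtain D where D: "D \<subseteq> B" "finite D" "B \<subseteq> (\<Union>c\<in>D. V c)"
    using compactE_image[OF \<open>compact B\<close>, of B V] UV(2,3) by blast
  have "null_hull xs \<subseteq> (\<Union>c\<in>D. U c)"
  proof
    fix y assume "y \<in> null_hull xs"
    then obtain d where d: "d \<in> B" "series_limit xs d y" by (auto simp: null_hull_def B_def)
    then obtain c where "c \<in> D" "d \<in> V c" using D by blast
    then show "y \<in> (\<Union>c\<in>D. U c)" using UV(4)[of c d y] d D(1) by blast
  qed
  then show ?thesis using UV(1) D(1,2) by (intro exI[of _ "U ` D"]) auto
qed

text \<open>This makes the supremum over the hull a genuine upper bound; on unbounded sets the real
  supremum carries no information.\<close>

lemma dual_bounded_null_hull:
  assumes "\<phi> \<in> dual" and xs: "\<And>k. xs k \<in> X" and null: "\<And>n. (\<lambda>k. Q n (xs k)) \<longlonglongrightarrow> 0"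
  shows "bdd_above ((\<lambda>x. norm (\<phi> x)) ` null_hull xs)"
proof -
  obtain n where n: "\<phi> \<in> polar n" using assms(1) by (rule dual_polarE)
  obtain R where R: "0 < R" "\<And>k. Q n (xs k) \<le> R" using null_sequence_bounded[OF null] by blast
  have "norm (\<phi> x) \<le> R" if x: "x \<in> null_hull xs" for x
  proof -
    obtain c where c: "\<And>N. (\<Sum>k<N. norm (c k)) \<le> 1" "series_limit xs c x"
      using x by (auto simp: null_hull_def)
    have "norm (\<Sum>k<N. c k * \<phi> (xs k)) \<le> R" for N
    proof -
      have "norm (\<Sum>k<N. c k * \<phi> (xs k)) \<le> (\<Sum>k<N. norm (c k) * R)"
        by (intro sum_norm_le)
          (simp add: norm_mult mult_left_mono order_trans[OF polar_bound[OF n xs] R(2)])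
      also have "\<dots> \<le> R" using c(1)[of N] R(1) by (simp add: mult_left_le_one_le sum_nonneg flip: sum_distrib_right)
      finally show ?thesis .
    qed
    moreover have "(\<lambda>N. norm (\<Sum>k<N. c k * \<phi> (xs k))) \<longlonglongrightarrow> norm (\<phi> x)"
      using series_limit_dual[OF assms(1) xs c(2)] by (intro tendsto_norm) (simp add: sums_def)
    ultimately show ?thesis by (intro LIMSEQ_le_const2) auto
  qed
  then show ?thesis by (rule bdd_aboveI2)
qed

text \<open>The set where N is at least 1 is closed slice by slice, since boundedness on polars
  makes N continuous for their norms. A functional bounded by 1 along the resulting null sequence
  has N below 1, and homogeneity turns this into the estimate.\<close>

theorem bounded_seminorm_on_dual:
  assumes N_add: "\<And>\<phi> \<psi>. \<phi> \<in> dual \<Longrightarrow> \<psi> \<in> dual \<Longrightarrow> N (\<lambda>x. \<phi> x + \<psi> x) \<le> N \<phi> + N \<psi>"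
    and N_scale: "\<And>c \<phi>. \<phi> \<in> dual \<Longrightarrow> N (\<lambda>x. c * \<phi> x) = norm c * N \<phi>"
    and N_bound: "\<And>n. \<exists>M. \<forall>\<phi>\<in>polar n. N \<phi> \<le> M"
  obtains xs where "\<And>k. xs k \<in> X" "\<And>n. (\<lambda>k. Q n (xs k)) \<longlonglongrightarrow> 0"
    "\<And>\<phi>. \<phi> \<in> dual \<Longrightarrow> N \<phi> \<le> (SUP x\<in>null_hull xs. norm (\<phi> x))"
proof -
  define C where "C = {\<phi>\<in>dual. 1 \<le> N \<phi>}"
  have "dual_norm_closed C"
    unfolding dual_norm_closed_def
  proof (intro allI ballI impI)
    fix n \<phi>
    assume \<phi>: "\<phi> \<in> dual"
      and lim: "\<forall>\<epsilon>>0. \<exists>\<psi>\<in>C \<inter> polar n. \<forall>x\<in>X. norm (\<psi> x - \<phi> x) \<le> \<epsilon> * Q (Suc n) x"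
    obtain M where M: "\<And>\<phi>. \<phi> \<in> polar (Suc n) \<Longrightarrow> N \<phi> \<le> M" using N_bound by blast
    have "1 \<le> N \<phi>"
    proof (rule field_le_epsilon)
      fix e :: real assume "0 < e"
      \<comment> \<open>With this accuracy \<psi> - \<phi> is \<open>\<epsilon>\<close> times an
        element \<theta> of \<open>polar (Suc n)\<close>, so N grows by at most \<open>e\<close>.
        The summand 1 excludes a zero denominator.\<close>
      define \<epsilon> where "\<epsilon> = e / (\<bar>M\<bar> + 1)"
      have "0 < \<epsilon>" using \<open>0 < e\<close> by (simp add: \<epsilon>_def)
      with lim obtain \<psi> where \<psi>: "\<psi> \<in> C" "\<And>x. x \<in> X \<Longrightarrow> norm (\<psi> x - \<phi> x) \<le> \<epsilon> * Q (Suc n) x" by blast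
      then have "\<psi> \<in> dual" by (simp add: C_def)
      define \<theta> where "\<theta> = (\<lambda>x. of_real (1 / \<epsilon>) * (\<psi> x - \<phi> x))"
      have "\<theta> \<in> polar (Suc n)"
      proof (rule polarI)
        show "\<theta> \<in> dual" unfolding \<theta>_def by (intro dual_scale_fun dual_diff_fun \<open>\<psi> \<in> dual\<close> \<phi>)
        show "norm (\<theta> x) \<le> Q (Suc n) x" if "x \<in> X" for x
          using \<psi>(2)[OF that] \<open>0 < \<epsilon>\<close> by (simp add: \<theta>_def norm_mult norm_divide pos_divide_le_eq mult.commute)
      qed
      have "\<psi> = (\<lambda>x. \<phi> x + of_real \<epsilon> * \<theta> x)" using \<open>0 < \<epsilon>\<close> by (simp add: \<theta>_def)
      then have "N \<psi> \<le> N \<phi> + \<epsilon> * N \<theta>"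
        using N_add[OF \<phi> dual_scale_fun[of \<theta> "of_real \<epsilon>"]] N_scale[of \<theta> "of_real \<epsilon>"]
          polar_subset_dual[OF \<open>\<theta> \<in> polar (Suc n)\<close>] \<open>0 < \<epsilon>\<close> by simp
      also have "\<epsilon> * N \<theta> \<le> \<epsilon> * (\<bar>M\<bar> + 1)"
        using M[OF \<open>\<theta> \<in> polar (Suc n)\<close>] \<open>0 < \<epsilon>\<close> by (intro mult_left_mono) auto
      also have "\<epsilon> * (\<bar>M\<bar> + 1) = e" by (simp add: \<epsilon>_def)
      finally show "1 \<le> N \<phi> + e" using \<psi>(1) by (simp add: C_def)
    qed
    then show "\<phi> \<in> C" using \<phi> by (simp add: C_def)
  qed
  moreover have "(\<lambda>x. 0) \<notin> C"
    using N_scale[OF dual_zero_fun, of 0] by (simp add: C_def)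
  ultimately obtain xs where xs: "\<And>k. xs k \<in> X" "\<And>n. (\<lambda>k. Q n (xs k)) \<longlonglongrightarrow> 0"
    and far: "\<And>\<phi>. \<phi> \<in> C \<Longrightarrow> \<phi> \<in> dual \<Longrightarrow> \<exists>k. 1 < norm (\<phi> (xs k))"
    by (rule banach_dieudonne) blast
  show thesis
  proof (rule that[OF xs])
    fix \<phi> assume \<phi>: "\<phi> \<in> dual"
    let ?S = "SUP x\<in>null_hull xs. norm (\<phi> x)"
    have le: "norm (\<phi> (xs k)) \<le> ?S" for k
      by (rule cSUP_upper[OF mem_null_hull[OF xs(1)] dual_bounded_null_hull[OF \<phi> xs]])
    show "N \<phi> \<le> ?S"
    \<comment> \<open>The scaling uses numbers above the supremum, as the supremum itself may be
      0.\<close>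
    proof (rule dense_ge)
      fix t assume "?S < t"
      then have "0 < t" using le[of 0] norm_ge_zero[of "\<phi> (xs 0)"] by linarith
      let ?\<psi> = "\<lambda>x. of_real (1 / t) * \<phi> x"
      have \<psi>: "?\<psi> \<in> dual" by (rule dual_scale_fun[OF \<phi>])
      have "norm (?\<psi> (xs k)) \<le> 1" for k
        using le[of k] \<open>?S < t\<close> \<open>0 < t\<close> by (simp add: norm_mult norm_divide)
      then have "?\<psi> \<notin> C" using far[of ?\<psi>] \<psi> by (meson not_le)
      then have "N ?\<psi> < 1" using \<psi> by (simp add: C_def)
      then show "N \<phi> \<le> t" using N_scale[OF \<phi>, of "of_real (1 / t)"] \<open>0 < t\<close> by (simp add: norm_divide)
    qed
  qed
qed

end

section \<open>Extension of weakly defined maps\<close>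

context graded_schwartz_banach
begin

text \<open>The second conclusion, uniqueness of the representing vector, is what later gives
  linearity of u and its values at prescribed functionals. The third is the input for continuity
  with respect to compact sets.\<close>

theorem weak_extension:
  fixes sE :: "'k \<Rightarrow> 'e::ab_group_add \<Rightarrow> 'e" and f :: "('e \<Rightarrow> 'k) \<Rightarrow> 'v"
  assumes E: "lcHs sE A p" and complete_E: "locally_complete sE A p"
    and G: "G \<subseteq> lc_dual UNIV sE A p" and det: "determines_boundedness A p G"
    and f: "\<And>g. g \<in> G \<Longrightarrow> f g \<in> X"
    and separating: "\<And>x. x \<in> X \<Longrightarrow>
      (\<And>\<phi> e. \<phi> \<in> dual \<Longrightarrow> \<forall>g\<in>G. g e = \<phi> (f g) \<Longrightarrow> \<phi> x = 0) \<Longrightarrow> x = 0"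
  obtains u where "\<And>\<phi> g. \<phi> \<in> dual \<Longrightarrow> g \<in> G \<Longrightarrow> g (u \<phi>) = \<phi> (f g)"
    "\<And>\<phi> e. \<phi> \<in> dual \<Longrightarrow> \<forall>g\<in>G. g e = \<phi> (f g) \<Longrightarrow> u \<phi> = e"
    "\<And>\<alpha> n. \<alpha> \<in> A \<Longrightarrow> \<exists>M. \<forall>\<phi>\<in>polar n. p \<alpha> (u \<phi>) \<le> M"
proof -
  interpret E: vector_space sE using E by (simp add: lcHs_def)
  have p_add: "p \<alpha> (x + y) \<le> p \<alpha> x + p \<alpha> y" and p_scale: "p \<alpha> (sE c x) = norm c * p \<alpha> x"
    if "\<alpha> \<in> A" for \<alpha> x y c
    using E that by (auto simp: lcHs_def)
  have hausdorff: "x = 0" if "\<And>\<alpha>. \<alpha> \<in> A \<Longrightarrow> p \<alpha> x = 0" for x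
    using E that by (auto simp: lcHs_def)
  have p_nonneg: "0 \<le> p \<alpha> x" if "\<alpha> \<in> A" for \<alpha> x
    using p_add[OF that, of x "- x"] p_scale[OF that, of "-1" x] p_scale[OF that, of 0 x] by simp
  have g_add: "g (x + y) = g x + g y" and g_scale: "g (sE c x) = c * g x"
    if "g \<in> G" for g x y c
    using G that by (auto simp: lc_dual_def)
  have g_diff: "g (x - y) = g x - g y" if "g \<in> G" for g x y
    using g_add[OF that, of "x - y" y] by simp
  \<comment> \<open>Vectors that represent functionals of \<open>polar n\<close> lie in
    \<open>D n\<close>. These are the discs to which local completeness is applied: bounded because
    \<open>G\<close> determines boundedness, closed because its members are continuous.\<close>
  define D where "D n = {e. \<forall>g\<in>G. norm (g e) \<le> Q n (f g)}" for n
  have D_bounded: "lc_bounded UNIV A p (D n)" for n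
  proof -
    have "bdd_above ((\<lambda>x. norm (g x)) ` D n)" if "g \<in> G" for g
      by (rule bdd_aboveI2[of _ _ "Q n (f g)"]) (use that in \<open>simp add: D_def\<close>)
    then show ?thesis using det by (simp add: determines_boundedness_def)
  qed
  have D_p_bounded: "\<exists>M. \<forall>e\<in>D n. p \<alpha> e \<le> M" if "\<alpha> \<in> A" for \<alpha> n
    using D_bounded[of n] that by (auto simp: lc_bounded_def bdd_above_def)
  \<comment> \<open>All natural multiples of such a vector lie in the bounded set
    \<open>D 0\<close>, so every seminorm vanishes at it.\<close>
  have separated: "e = 0" if e: "\<And>g. g \<in> G \<Longrightarrow> g e = 0" for e
  proof (rule hausdorff)
    fix \<alpha> assume \<alpha>: "\<alpha> \<in> A"
    have "sE (of_nat k) e \<in> D 0" for k :: nat by (simp add: D_def g_scale e Q_nonneg f)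
    moreover obtain b where "\<And>x. x \<in> D 0 \<Longrightarrow> p \<alpha> x \<le> b" using D_p_bounded[OF \<alpha>, of 0] by blast
    ultimately have "real k * p \<alpha> e \<le> b" for k
      using p_scale[OF \<alpha>, of "of_nat k" e] by (metis norm_of_nat)
    then have "\<not> 0 < p \<alpha> e" using reals_Archimedean3 by (metis not_le)
    then show "p \<alpha> e = 0" using p_nonneg[OF \<alpha>, of e] by simp
  qed
  have D_absconvex: "absconvex sE (D n)" for n
    unfolding absconvex_def
  proof (intro ballI allI impI)
    fix x y and a b :: 'k assume xy: "x \<in> D n" "y \<in> D n" and ab: "norm a + norm b \<le> 1"
    have "norm (g (sE a x + sE b y)) \<le> Q n (f g)" if g: "g \<in> G" for g
    proof -
      have "norm (g (sE a x + sE b y)) \<le> norm a * norm (g x) + norm b * norm (g y)"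
        using norm_triangle_ineq[of "a * g x" "b * g y"] g by (simp add: g_add g_scale norm_mult)
      also have "\<dots> \<le> norm a * Q n (f g) + norm b * Q n (f g)"
        using xy g by (intro add_mono mult_left_mono) (auto simp: D_def)
      also have "\<dots> = (norm a + norm b) * Q n (f g)" by (simp add: distrib_right)
      also have "\<dots> \<le> 1 * Q n (f g)" by (intro mult_right_mono ab Q_nonneg f g)
      finally show ?thesis by simp
    qed
    then show "sE a x + sE b y \<in> D n" by (simp add: D_def)
  qed
  have D_closed: "lc_closed UNIV A p (D n)" for n
    unfolding lc_closed_def lc_open_def
  proof (intro conjI subset_UNIV ballI)
    fix e assume "e \<in> UNIV - D n"
    then obtain g where g: "g \<in> G" and "Q n (f g) < norm (g e)" by (auto simp: D_def not_le)
    define \<delta> where "\<delta> = norm (g e) - Q n (f g)"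
    have "0 < \<delta>" using \<open>Q n (f g) < norm (g e)\<close> by (simp add: \<delta>_def)
    have "g \<in> lc_dual UNIV sE A p" using G g by blast
    then obtain F C where F: "finite F" "F \<subseteq> A" "\<And>x. norm (g x) \<le> C * (\<Sum>\<alpha>\<in>F. p \<alpha> x)"
      unfolding lc_dual_def by blast
    \<comment> \<open>The summands 1 keep the denominator positive when \<open>C\<close> is 0 or
      \<open>F\<close> is empty, and make the estimate below strict.\<close>
    define \<epsilon> where "\<epsilon> = \<delta> / ((\<bar>C\<bar> + 1) * (real (card F) + 1))"
    have "0 < (\<bar>C\<bar> + 1) * (real (card F) + 1)" by (intro mult_pos_pos) auto
    then have "0 < \<epsilon>" and \<epsilon>: "\<epsilon> * ((\<bar>C\<bar> + 1) * (real (card F) + 1)) = \<delta>"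
      using \<open>0 < \<delta>\<close> by (simp_all add: \<epsilon>_def)
    have "y \<notin> D n" if y: "\<forall>\<alpha>\<in>F. p \<alpha> (y - e) < \<epsilon>" for y
    proof
      assume "y \<in> D n"
      have "norm (g (y - e)) \<le> C * (\<Sum>\<alpha>\<in>F. p \<alpha> (y - e))" by (rule F)
      also have "\<dots> \<le> \<bar>C\<bar> * (\<Sum>\<alpha>\<in>F. p \<alpha> (y - e))"
        using F(2) by (intro mult_right_mono sum_nonneg p_nonneg) auto
      also have "\<dots> \<le> \<bar>C\<bar> * (\<Sum>\<alpha>\<in>F. \<epsilon>)"
        using y by (intro mult_left_mono sum_mono) (auto intro: less_imp_le)
      also have "\<dots> = \<epsilon> * (\<bar>C\<bar> * real (card F))" by simp
      also have "\<dots> < \<epsilon> * ((\<bar>C\<bar> + 1) * (real (card F) + 1))"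
        using \<open>0 < \<epsilon>\<close> by (intro mult_strict_left_mono) (auto simp: algebra_simps intro: add_nonneg_pos)
      finally have "norm (g (y - e)) < \<delta>" by (simp only: \<epsilon>)
      moreover have "norm (g y) \<le> Q n (f g)" using \<open>y \<in> D n\<close> g by (simp add: D_def)
      ultimately show False
        using norm_triangle_ineq2[of "g e" "g y"] g by (simp add: g_diff \<delta>_def norm_minus_commute)
    qed
    then show "\<exists>F. finite F \<and> F \<subseteq> A \<and> (\<exists>\<epsilon>>0. {y \<in> UNIV. \<forall>i\<in>F. p i (y - e) < \<epsilon>} \<subseteq> UNIV - D n)"
      using F(1,2) \<open>0 < \<epsilon>\<close> by blast
  qed
  have D_scaled: "\<exists>d\<in>D n. e = sE (of_real t) d"
    if e: "\<And>g. g \<in> G \<Longrightarrow> norm (g e) \<le> t * Q n (f g)" and "0 < t" for e n t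
  proof
    show "e = sE (of_real t) (sE (of_real (1 / t)) e)" using \<open>0 < t\<close> by simp
    show "sE (of_real (1 / t)) e \<in> D n"
      using e \<open>0 < t\<close> by (simp add: D_def g_scale norm_mult norm_divide pos_divide_le_eq mult.commute)
  qed
  have gauge_le: "gauge_of sE (D n) e \<le> t"
    if "\<And>g. g \<in> G \<Longrightarrow> norm (g e) \<le> t * Q n (f g)" and "0 < t" for e n t
    unfolding gauge_of_def
    by (rule cInf_lower) (use D_scaled[OF that] \<open>0 < t\<close> in \<open>auto intro!: bdd_belowI[of _ 0]\<close>)
  \<comment> \<open>The bound with some \<open>t\<close> makes the gauge an infimum over a non-empty
    set and settles the case where \<open>Q n (f g)\<close> is 0.\<close>
  have le_gauge: "norm (g e) \<le> gauge_of sE (D n) e * Q n (f g)"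
    if g: "g \<in> G" and bound: "\<And>g. g \<in> G \<Longrightarrow> norm (g e) \<le> t * Q n (f g)" and "0 < t" for g e n t
  proof (cases "Q n (f g) = 0")
    case True
    then show ?thesis using bound[OF g] by simp
  next
    case False
    then have pos: "0 < Q n (f g)" using Q_nonneg[OF f[OF g], of n] by simp
    have "norm (g e) / Q n (f g) \<le> gauge_of sE (D n) e"
      unfolding gauge_of_def
    proof (rule cInf_greatest)
      show "{t. 0 < t \<and> (\<exists>d\<in>D n. e = sE (of_real t) d)} \<noteq> {}"
        using D_scaled[OF bound \<open>0 < t\<close>] \<open>0 < t\<close> by blast
      fix r assume "r \<in> {t. 0 < t \<and> (\<exists>d\<in>D n. e = sE (of_real t) d)}"
      then obtain d where "0 < r" "d \<in> D n" "e = sE (of_real r) d" by blast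
      then show "norm (g e) / Q n (f g) \<le> r"
        using g pos by (simp add: g_scale norm_mult D_def pos_divide_le_eq)
    qed
    then show ?thesis using pos by (simp add: pos_divide_le_eq)
  qed
  define H where "H = {\<phi>\<in>dual. \<exists>e. \<forall>g\<in>G. g e = \<phi> (f g)}"
  have "H = dual"
  proof (rule separating_norm_closed_subspace_eq_dual)
    show "H \<subseteq> dual" by (auto simp: H_def)
    have "\<forall>g\<in>G. g 0 = 0" using g_scale[of _ 0 0] by simp
    then show "(\<lambda>x. 0) \<in> H" using dual_zero_fun by (auto simp: H_def)
    show "(\<lambda>x. \<phi> x + \<psi> x) \<in> H" if \<phi>\<psi>: "\<phi> \<in> H" "\<psi> \<in> H" for \<phi> \<psi>
    proof -
      obtain d e where "\<forall>g\<in>G. g d = \<phi> (f g)" "\<forall>g\<in>G. g e = \<psi> (f g)" using \<phi>\<psi> by (auto simp: H_def)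
      then have "\<forall>g\<in>G. g (d + e) = \<phi> (f g) + \<psi> (f g)" by (simp add: g_add)
      then show ?thesis using \<phi>\<psi> dual_add_fun by (auto simp: H_def)
    qed
    show "(\<lambda>x. c * \<phi> x) \<in> H" if \<phi>: "\<phi> \<in> H" for c \<phi>
    proof -
      obtain e where "\<forall>g\<in>G. g e = \<phi> (f g)" using \<phi> by (auto simp: H_def)
      then have "\<forall>g\<in>G. g (sE c e) = c * \<phi> (f g)" by (simp add: g_scale)
      then show ?thesis using \<phi> dual_scale_fun by (auto simp: H_def)
    qed
    show "x = 0" if "x \<in> X" "\<And>h. h \<in> H \<Longrightarrow> h x = 0" for x
      by (rule separating[OF that(1)]) (use that(2) in \<open>auto simp: H_def\<close>)
    fix \<phi> n
    assume \<phi>: "\<phi> \<in> dual"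
      and lim: "\<And>\<epsilon>. 0 < \<epsilon> \<Longrightarrow> \<exists>h\<in>H. \<forall>x\<in>X. norm (h x - \<phi> x) \<le> \<epsilon> * Q n x"
    obtain m0 where m0: "\<phi> \<in> polar m0" using \<phi> by (rule dual_polarE)
    \<comment> \<open>One disc has to hold everything: \<open>m0\<close> controls
      \<open>\<phi>\<close>, and \<open>n\<close> measures the approximation.\<close>
    define m where "m = max m0 n"
    let ?\<epsilon> = "\<lambda>k. inverse (real (Suc k))"
    have "\<forall>k. \<exists>e h. (\<forall>g\<in>G. g e = h (f g)) \<and> (\<forall>x\<in>X. norm (h x - \<phi> x) \<le> ?\<epsilon> k * Q m x)"
    proof
      fix k
      obtain h where h: "h \<in> H" "\<forall>x\<in>X. norm (h x - \<phi> x) \<le> ?\<epsilon> k * Q n x"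
        using lim[of "?\<epsilon> k"] by auto
      have "norm (h x - \<phi> x) \<le> ?\<epsilon> k * Q m x" if "x \<in> X" for x
      proof -
        have "?\<epsilon> k * Q n x \<le> ?\<epsilon> k * Q m x"
          by (intro mult_left_mono Q_mono that) (simp_all add: m_def)
        with h(2) that show ?thesis by (blast intro: order_trans)
      qed
      then show "\<exists>e h. (\<forall>g\<in>G. g e = h (f g)) \<and> (\<forall>x\<in>X. norm (h x - \<phi> x) \<le> ?\<epsilon> k * Q m x)"
        using h(1) by (auto simp: H_def)
    qed
    then obtain e h where e: "\<And>k g. g \<in> G \<Longrightarrow> g (e k) = h k (f g)"
      and h: "\<And>k x. x \<in> X \<Longrightarrow> norm (h k x - \<phi> x) \<le> ?\<epsilon> k * Q m x"
      by metis
    have near: "norm (g (e k) - \<phi> (f g)) \<le> ?\<epsilon> k * Q m (f g)" if "g \<in> G" for g k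
      using h[OF f[OF that], of k] by (simp add: e that)
    have e_bound: "norm (g (e k)) \<le> 2 * Q m (f g)" if g: "g \<in> G" for g k
    proof -
      have "?\<epsilon> k * Q m (f g) \<le> 1 * Q m (f g)"
        by (intro mult_right_mono Q_nonneg f g) (simp add: field_simps)
      moreover have "norm (\<phi> (f g)) \<le> Q m (f g)"
        using polar_bound[OF m0 f[OF g]] Q_mono[OF f[OF g], of m0 m] by (simp add: m_def)
      ultimately show ?thesis using near[OF g, of k] norm_triangle_ineq2[of "g (e k)" "\<phi> (f g)"] by linarith
    qed
    \<comment> \<open>The multiple 2 allows one unit for \<open>\<phi>\<close> and one for the
      error, whose accuracy is at most 1.\<close>
    have "e k \<in> span_abs sE (D m)" for k
      using D_scaled[OF e_bound, of k] by (force simp: span_abs_def intro!: exI[of _ 2])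
    moreover have "\<forall>\<epsilon>>0. \<exists>N. \<forall>k\<ge>N. \<forall>l\<ge>N. gauge_of sE (D m) (e k - e l) < \<epsilon>"
    proof (intro allI impI)
      fix \<epsilon> :: real assume "0 < \<epsilon>"
      obtain N where N: "?\<epsilon> N < \<epsilon> / 2" using reals_Archimedean[of "\<epsilon> / 2"] \<open>0 < \<epsilon>\<close> by auto
      have "gauge_of sE (D m) (e k - e l) \<le> 2 * ?\<epsilon> N" if "N \<le> k" "N \<le> l" for k l
      proof (rule gauge_le)
        fix g assume g: "g \<in> G"
        have "?\<epsilon> k * Q m (f g) \<le> ?\<epsilon> N * Q m (f g)" "?\<epsilon> l * Q m (f g) \<le> ?\<epsilon> N * Q m (f g)"
          using that by (intro mult_right_mono Q_nonneg f g; simp add: field_simps)+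
        then show "norm (g (e k - e l)) \<le> 2 * ?\<epsilon> N * Q m (f g)"
          using near[OF g, of k] near[OF g, of l] norm_triangle_ineq4[of "g (e k) - \<phi> (f g)" "g (e l) - \<phi> (f g)"]
          by (simp add: g_diff g)
      qed simp
      moreover have "2 * ?\<epsilon> N < \<epsilon>" using N by linarith
      ultimately show "\<exists>N. \<forall>k\<ge>N. \<forall>l\<ge>N. gauge_of sE (D m) (e k - e l) < \<epsilon>"
        by (meson le_less_trans)
    qed
    moreover have "\<forall>xs. (\<forall>k. xs k \<in> span_abs sE (D m))
        \<and> (\<forall>\<epsilon>>0. \<exists>N. \<forall>k\<ge>N. \<forall>l\<ge>N. gauge_of sE (D m) (xs k - xs l) < \<epsilon>)
      \<longrightarrow> (\<exists>x\<in>span_abs sE (D m). (\<lambda>k. gauge_of sE (D m) (xs k - x)) \<longlonglongrightarrow> 0)"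
      using complete_E D_closed[of m] D_bounded[of m] D_absconvex[of m]
      unfolding locally_complete_def by blast
    ultimately have "\<exists>x\<in>span_abs sE (D m). (\<lambda>k. gauge_of sE (D m) (e k - x)) \<longlonglongrightarrow> 0" by simp
    then obtain e0 where e0: "e0 \<in> span_abs sE (D m)" "(\<lambda>k. gauge_of sE (D m) (e k - e0)) \<longlonglongrightarrow> 0" ..
    obtain j d where d: "d \<in> D m" "e0 = sE (of_nat j) d" using e0(1) by (auto simp: span_abs_def)
    \<comment> \<open>As \<open>e0\<close> is \<open>j\<close> times a point of the disc,
      \<open>e k - e0\<close> lies in a multiple of it; \<open>le_gauge\<close> needs this to turn
      gauge convergence into convergence under each g.\<close>
    have diff_bound: "norm (g (e k - e0)) \<le> (2 + real j) * Q m (f g)" if g: "g \<in> G" for g k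
    proof -
      have "norm (g e0) \<le> real j * Q m (f g)"
        using d g by (simp add: g_scale norm_mult D_def mult_left_mono)
      then show ?thesis
        using e_bound[OF g, of k] norm_triangle_ineq4[of "g (e k)" "g e0"]
        by (simp add: g_diff g distrib_right)
    qed
    have "g e0 = \<phi> (f g)" if g: "g \<in> G" for g
    proof (rule LIMSEQ_unique)
      have lim_gauge: "(\<lambda>k. gauge_of sE (D m) (e k - e0) * Q m (f g)) \<longlonglongrightarrow> 0"
        using tendsto_mult_right[OF e0(2), of "Q m (f g)"] by simp
      have "norm (g (e k) - g e0) \<le> gauge_of sE (D m) (e k - e0) * Q m (f g)" for k
        using le_gauge[OF g diff_bound, of k] by (simp add: g_diff g)
      then have "(\<lambda>k. g (e k) - g e0) \<longlonglongrightarrow> 0"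
        by (intro Lim_null_comparison[OF always_eventually lim_gauge] allI)
      then show "(\<lambda>k. g (e k)) \<longlonglongrightarrow> g e0" by (simp add: LIM_zero_iff)
      have lim_inv: "(\<lambda>k. ?\<epsilon> k * Q m (f g)) \<longlonglongrightarrow> 0"
        using tendsto_mult_right[OF LIMSEQ_inverse_real_of_nat, of "Q m (f g)"] by simp
      have "(\<lambda>k. g (e k) - \<phi> (f g)) \<longlonglongrightarrow> 0"
        using near[OF g] by (intro Lim_null_comparison[OF always_eventually lim_inv] allI)
      then show "(\<lambda>k. g (e k)) \<longlonglongrightarrow> \<phi> (f g)" by (simp add: LIM_zero_iff)
    qed
    then show "\<phi> \<in> H" using \<phi> by (auto simp: H_def)
  qed
  define u where "u \<phi> = (SOME e. \<forall>g\<in>G. g e = \<phi> (f g))" for \<phi> :: "'v \<Rightarrow> 'k"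
  have u: "g (u \<phi>) = \<phi> (f g)" if "\<phi> \<in> dual" "g \<in> G" for \<phi> g
  proof -
    have "\<exists>e. \<forall>g\<in>G. g e = \<phi> (f g)" using that \<open>H = dual\<close> by (auto simp: H_def)
    from someI_ex[OF this] show ?thesis using that(2) by (simp add: u_def)
  qed
  show thesis
  proof
    show "g (u \<phi>) = \<phi> (f g)" if "\<phi> \<in> dual" "g \<in> G" for \<phi> g by (rule u[OF that])
    show "u \<phi> = e" if e: "\<phi> \<in> dual" "\<forall>g\<in>G. g e = \<phi> (f g)" for \<phi> e
    proof -
      have "g (u \<phi> - e) = 0" if g: "g \<in> G" for g
        using e(2) g by (simp add: g_diff[OF g] u[OF e(1) g])
      then have "u \<phi> - e = 0" by (rule separated)
      then show ?thesis by simp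
    qed
    fix \<alpha> n assume "\<alpha> \<in> A"
    then obtain M where "\<And>e. e \<in> D n \<Longrightarrow> p \<alpha> e \<le> M"
      using D_p_bounded[of \<alpha> n] by blast
    moreover have "u \<phi> \<in> D n" if "\<phi> \<in> polar n" for \<phi>
      using that by (simp add: D_def u polar_subset_dual polar_bound f)
    ultimately show "\<exists>M. \<forall>\<phi>\<in>polar n. p \<alpha> (u \<phi>) \<le> M" by blast
  qed
qed

end

section \<open>Graded seminorms on a Frechet--Schwartz space\<close>

text \<open>From an index i the recursion passes to one that dominates i, the n-th member of the
  countable cofinal family, and the index that the Schwartz property attaches to i. Dominating the
  cofinal family preserves the topology; scaling by constants achieves the doubling.\<close>

lemma frechet_schwartz_graded:
  fixes s :: "'k::real_normed_field \<Rightarrow> 'v::ab_group_add \<Rightarrow> 'v" and q :: "'i \<Rightarrow> 'v \<Rightarrow> real"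
  assumes s: "Vector_Spaces.vector_space s" and sub: "module.subspace s X"
    and q_add: "\<And>i x y. i \<in> I \<Longrightarrow> x \<in> X \<Longrightarrow> y \<in> X \<Longrightarrow> q i (x + y) \<le> q i x + q i y"
    and q_scale: "\<And>i c x. i \<in> I \<Longrightarrow> x \<in> X \<Longrightarrow> q i (s c x) = norm c * q i x"
    and nonempty: "I \<noteq> {}" and directed: "directed_seminorms X I q" and FS: "frechet_schwartz X I q"
  obtains Q where "graded_schwartz s X Q"
    "\<And>i. i \<in> I \<Longrightarrow> \<exists>n C. \<forall>x\<in>X. q i x \<le> C * Q n x"
    "\<And>n. \<exists>i\<in>I. \<exists>C. \<forall>x\<in>X. Q n x \<le> C * q i x"
proof -
  interpret vector_space s by (rule s)
  have diff: "x - y \<in> X" if "x \<in> X" "y \<in> X" for x y using subspace_diff[OF sub that] .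
  have q_nonneg: "0 \<le> q i x" if "i \<in> I" "x \<in> X" for i x
    using q_add[OF that, of "s (-1) x"] q_scale[OF that, of "-1"] q_scale[OF that, of 0]
      subspace_scale[OF sub that(2), of "-1"] by simp
  obtain idx :: "nat \<Rightarrow> 'i" where idx: "\<And>n. idx n \<in> I"
    and metrizable: "\<And>i. i \<in> I \<Longrightarrow> \<exists>n C. \<forall>x\<in>X. q i x \<le> C * q (idx n) x"
    using FS unfolding frechet_schwartz_def lc_metrizable_def by blast
  obtain sch where sch: "\<And>i. i \<in> I \<Longrightarrow> sch i \<in> I"
    and precompact: "\<And>i \<epsilon>. i \<in> I \<Longrightarrow> 0 < \<epsilon> \<Longrightarrow> \<exists>F. finite F \<and> F \<subseteq> X \<and>
      (\<forall>x\<in>X. q (sch i) x \<le> 1 \<longrightarrow> (\<exists>y\<in>F. q i (x - y) < \<epsilon>))"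
    using FS unfolding frechet_schwartz_def lc_schwartz_def by metis
  have dominate: "\<exists>k\<in>I. \<exists>D\<ge>1. \<forall>x\<in>X. q i x \<le> D * q k x \<and> q j x \<le> D * q k x" if ij: "i \<in> I" "j \<in> I" for i j
  proof -
    obtain k C where k: "k \<in> I" "\<forall>x\<in>X. q i x \<le> C * q k x \<and> q j x \<le> C * q k x"
      using directed ij unfolding directed_seminorms_def by meson
    have "C * q k x \<le> max 1 C * q k x" if "x \<in> X" for x
      by (intro mult_right_mono q_nonneg k that) simp
    then show ?thesis using k by (intro bexI[of _ k] exI[of _ "max 1 C"]) (auto intro: order_trans)
  qed
  define good where "good n = (\<lambda>(i, c :: real). i \<in> I \<and> 1 \<le> c)" for n :: nat
  define next_to where "next_to n = (\<lambda>(i, c :: real) (i', c'). (\<forall>x\<in>X. 2 * (c * q i x) \<le> c' * q i' x)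
      \<and> (\<forall>x\<in>X. q (idx n) x \<le> c' * q i' x)
      \<and> (\<forall>\<epsilon>>0. \<exists>F. finite F \<and> F \<subseteq> X \<and> (\<forall>x\<in>X. c' * q i' x \<le> 1 \<longrightarrow> (\<exists>y\<in>F. c * q i (x - y) < \<epsilon>))))" for n
  have "\<exists>S. \<forall>n. good n (S n) \<and> next_to n (S n) (S (Suc n))"
  proof (rule dependent_nat_choice)
    obtain i where "i \<in> I" using nonempty by blast
    then show "\<exists>S. good 0 S" by (auto simp: good_def intro!: exI[of _ "(i, 1)"])
    fix S n assume "good n S"
    then obtain i c where S: "S = (i, c)" and i: "i \<in> I" and c: "1 \<le> c" by (auto simp: good_def)
    obtain j D where j: "j \<in> I" "1 \<le> D" "\<And>x. x \<in> X \<Longrightarrow> q i x \<le> D * q j x"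
      "\<And>x. x \<in> X \<Longrightarrow> q (idx n) x \<le> D * q j x"
      using dominate[OF i idx] by blast
    obtain k D' where k: "k \<in> I" "1 \<le> D'" "\<And>x. x \<in> X \<Longrightarrow> q j x \<le> D' * q k x"
      "\<And>x. x \<in> X \<Longrightarrow> q (sch i) x \<le> D' * q k x"
      using dominate[OF j(1) sch[OF i]] by blast
    \<comment> \<open>\<open>D\<close> and \<open>D'\<close> come from two uses of directedness, for
      \<open>i\<close> with \<open>idx n\<close> and for \<open>j\<close> with \<open>sch i\<close>;
      the factor \<open>2 * c\<close> doubles the multiple \<open>c\<close> of
      \<open>q i\<close>.\<close>
    define c' where "c' = 2 * c * D * D'"
    have "1 * 1 \<le> 2 * c * D" by (rule mult_mono) (use j c in auto)
    then have "1 * 1 \<le> (2 * c * D) * D'" by (intro mult_mono[of 1 "2 * c * D"]) (use k in linarith)+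
    then have "1 \<le> c'" by (simp add: c'_def)
    have q_k: "q j x \<le> D' * q k x" "0 \<le> q k x" if "x \<in> X" for x
      using that k j q_nonneg by auto
    have 1: "2 * (c * q i x) \<le> c' * q k x" if "x \<in> X" for x
    proof -
      have "q i x \<le> D * (D' * q k x)"
        using j(3)[OF that] mult_left_mono[OF k(3)[OF that], of D] j(2) by linarith
      then have "(2 * c) * q i x \<le> (2 * c) * (D * (D' * q k x))" by (rule mult_left_mono) (use c in simp)
      then show ?thesis by (simp add: c'_def mult.assoc)
    qed
    have 2: "q (idx n) x \<le> c' * q k x" if "x \<in> X" for x
    proof -
      have "q (idx n) x \<le> D * (D' * q k x)"
        using j(4)[OF that] mult_left_mono[OF k(3)[OF that], of D] j(2) by linarith
      moreover have "1 * (D * (D' * q k x)) \<le> (2 * c) * (D * (D' * q k x))"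
        using c j(2) k(2) q_k(2)[OF that] by (intro mult_right_mono) auto
      ultimately show ?thesis by (simp add: c'_def mult.assoc)
    qed
    have 3: "\<exists>F. finite F \<and> F \<subseteq> X \<and> (\<forall>x\<in>X. c' * q k x \<le> 1 \<longrightarrow> (\<exists>y\<in>F. c * q i (x - y) < \<epsilon>))"
      if "0 < \<epsilon>" for \<epsilon>
    proof -
      obtain F where F: "finite F" "F \<subseteq> X" "\<And>x. x \<in> X \<Longrightarrow> q (sch i) x \<le> 1 \<Longrightarrow> \<exists>y\<in>F. q i (x - y) < \<epsilon> / c"
        using precompact[OF i, of "\<epsilon> / c"] \<open>0 < \<epsilon>\<close> c by auto
      have "\<exists>y\<in>F. c * q i (x - y) < \<epsilon>" if x: "x \<in> X" "c' * q k x \<le> 1" for x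
      proof -
        have "1 * (D' * q k x) \<le> (2 * c * D) * (D' * q k x)"
          using \<open>1 * 1 \<le> 2 * c * D\<close> k(2) q_k(2)[OF x(1)] by (intro mult_right_mono) auto
        then have "q (sch i) x \<le> 1" using k(4)[OF x(1)] x(2) by (simp add: c'_def mult.assoc)
        then obtain y where "y \<in> F" "q i (x - y) < \<epsilon> / c" using F(3)[OF x(1)] by blast
        then show ?thesis using c by (intro bexI[of _ y]) (simp_all add: pos_less_divide_eq mult.commute)
      qed
      then show ?thesis using F(1,2) by blast
    qed
    show "\<exists>S'. good (Suc n) S' \<and> next_to n S S'"
      using \<open>k \<in> I\<close> \<open>1 \<le> c'\<close> 1 2 3
      by (intro exI[of _ "(k, c')"]) (simp add: good_def next_to_def S)
  qed
  then obtain S where S: "\<And>n. good n (S n)" "\<And>n. next_to n (S n) (S (Suc n))" by blast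
  define ix where "ix n = fst (S n)" for n
  define co where "co n = snd (S n)" for n
  have ix: "ix n \<in> I" and co: "1 \<le> co n" for n
    using S(1)[of n] by (auto simp: good_def ix_def co_def split: prod.splits)
  have grow: "2 * (co n * q (ix n) x) \<le> co (Suc n) * q (ix (Suc n)) x"
    and idx_le: "q (idx n) x \<le> co (Suc n) * q (ix (Suc n)) x" if "x \<in> X" for n x
    using S(2)[of n] that by (auto simp: next_to_def ix_def co_def split: prod.splits)
  have totally_bounded: "\<exists>F. finite F \<and> F \<subseteq> X \<and>
      (\<forall>x\<in>X. co (Suc n) * q (ix (Suc n)) x \<le> 1 \<longrightarrow> (\<exists>y\<in>F. co n * q (ix n) (x - y) < \<epsilon>))" if "0 < \<epsilon>" for n \<epsilon>
    using S(2)[of n] that unfolding next_to_def ix_def co_def case_prod_beta by blast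
  \<comment> \<open>Putting the zero seminorm in front shifts all indices by one.\<close>
  define Q where "Q n x = (case n of 0 \<Rightarrow> 0 | Suc m \<Rightarrow> co m * q (ix m) x)" for n x
  have Q_simps: "Q 0 x = 0" "Q (Suc n) x = co n * q (ix n) x" for n x by (simp_all add: Q_def)
  have compare: "\<exists>n C. 0 \<le> C \<and> (\<forall>x\<in>X. q i x \<le> C * Q n x)" if i: "i \<in> I" for i
  proof -
    obtain n C where C: "\<forall>x\<in>X. q i x \<le> C * q (idx n) x" using metrizable[OF i] by blast
    \<comment> \<open>\<open>idx n\<close> is dominated by the pair with index n + 1, which is
      \<open>Q\<close> with index n + 2.\<close>
    have "q i x \<le> \<bar>C\<bar> * Q (Suc (Suc n)) x" if "x \<in> X" for x
    proof -
      have "q i x \<le> \<bar>C\<bar> * q (idx n) x"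
        using C that mult_right_mono[OF abs_ge_self q_nonneg[OF idx that], of C n] by force
      also have "\<dots> \<le> \<bar>C\<bar> * (co (Suc n) * q (ix (Suc n)) x)"
        by (intro mult_left_mono idx_le that) simp
      finally show ?thesis by (simp add: Q_simps)
    qed
    then show ?thesis by (metis abs_ge_zero)
  qed
  have "graded_schwartz s X Q"
  proof
    show "subspace X" by (rule sub)
    show "Q n (x + y) \<le> Q n x + Q n y" if "x \<in> X" "y \<in> X" for n x y
    proof (cases n)
      case (Suc m)
      have "co m * q (ix m) (x + y) \<le> co m * (q (ix m) x + q (ix m) y)"
        using co[of m] by (intro mult_left_mono q_add ix that) simp
      then show ?thesis by (simp add: Suc Q_simps distrib_left)
    qed (simp add: Q_simps)
    show "Q n (s c x) = norm c * Q n x" if "x \<in> X" for n c x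
      by (cases n) (simp_all add: Q_simps q_scale ix that)
    show "Q 0 x = 0" for x by (simp add: Q_simps)
    show "2 * Q n x \<le> Q (Suc n) x" if "x \<in> X" for n x
    proof (cases n)
      case 0
      have "0 \<le> co 0 * q (ix 0) x" using co[of 0] q_nonneg[OF ix that, of 0] by simp
      then show ?thesis by (simp add: 0 Q_simps)
    qed (use grow[OF that] in \<open>simp add: Q_simps\<close>)
    show "\<exists>F. finite F \<and> F \<subseteq> X \<and> (\<forall>x\<in>X. Q (Suc n) x \<le> 1 \<longrightarrow> (\<exists>y\<in>F. Q n (x - y) < \<epsilon>))" if "0 < \<epsilon>" for n \<epsilon>
    proof (cases n)
      case 0
      show ?thesis
        by (rule exI[of _ "{0}"]) (simp add: 0 Q_simps that subspace_0[OF sub])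
    next
      case (Suc m)
      then show ?thesis using totally_bounded[OF that, of m] by (simp add: Q_simps)
    qed
    fix xs :: "nat \<Rightarrow> 'v"
    assume xs: "\<And>k. xs k \<in> X" and cauchy: "\<And>n \<epsilon>. 0 < \<epsilon> \<Longrightarrow> \<exists>N. \<forall>k\<ge>N. \<forall>l\<ge>N. Q n (xs k - xs l) < \<epsilon>"
    \<comment> \<open>Completeness is given for Cauchy filters; the sequence is tested through the
      filter of its tails.\<close>
    let ?F = "filtermap xs sequentially"
    have F_cauchy: "eventually (\<lambda>(x, y). q i (x - y) < \<epsilon>) (?F \<times>\<^sub>F ?F)" if "i \<in> I" "0 < \<epsilon>" for i \<epsilon>
    proof -
      obtain n C where C: "0 \<le> C" "\<And>x. x \<in> X \<Longrightarrow> q i x \<le> C * Q n x" using compare[OF \<open>i \<in> I\<close>] by blast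
      obtain N where N: "\<And>k l. N \<le> k \<Longrightarrow> N \<le> l \<Longrightarrow> Q n (xs k - xs l) < \<epsilon> / (C + 1)"
        using cauchy[of "\<epsilon> / (C + 1)" n] C(1) \<open>0 < \<epsilon>\<close> by auto
      have "q i (xs k - xs l) < \<epsilon>" if "N \<le> k" "N \<le> l" for k l
      proof -
        have "q i (xs k - xs l) \<le> C * Q n (xs k - xs l)" by (intro C diff xs)
        also have "\<dots> \<le> C * (\<epsilon> / (C + 1))" using N[OF that] C(1) by (intro mult_left_mono) auto
        also have "\<dots> < \<epsilon>" using C(1) \<open>0 < \<epsilon>\<close> by (simp add: pos_divide_less_eq algebra_simps)
        finally show ?thesis .
      qed
      moreover have "eventually (\<lambda>x. x \<in> xs ` {N..}) ?F"
        by (auto simp: eventually_filtermap eventually_sequentially)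
      ultimately show ?thesis
        unfolding eventually_prod_filter by (intro exI[of _ "\<lambda>x. x \<in> xs ` {N..}"]) auto
    qed
    have "?F \<noteq> bot" "eventually (\<lambda>x. x \<in> X) ?F"
      by (simp_all add: filtermap_bot_iff eventually_filtermap xs)
    with F_cauchy obtain x where x: "x \<in> X" "\<And>i \<epsilon>. i \<in> I \<Longrightarrow> 0 < \<epsilon> \<Longrightarrow> eventually (\<lambda>y. q i (y - x) < \<epsilon>) ?F"
      using FS unfolding frechet_schwartz_def lc_complete_def by metis
    have lim: "(\<lambda>k. q i (xs k - x)) \<longlonglongrightarrow> 0" if i: "i \<in> I" for i
    proof (rule LIMSEQ_I)
      fix r :: real assume "0 < r"
      then obtain N where "\<And>k. N \<le> k \<Longrightarrow> q i (xs k - x) < r"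
        using x(2)[OF i] by (auto simp: eventually_filtermap eventually_sequentially)
      then show "\<exists>N. \<forall>k\<ge>N. norm (q i (xs k - x) - 0) < r"
        using q_nonneg[OF i diff[OF xs x(1)]] by (intro exI[of _ N]) simp
    qed
    have "(\<lambda>k. Q n (xs k - x)) \<longlonglongrightarrow> 0" for n
      using tendsto_mult_right_zero[OF lim[OF ix]] by (cases n) (simp_all add: Q_simps)
    then show "\<exists>x\<in>X. \<forall>n. (\<lambda>k. Q n (xs k - x)) \<longlonglongrightarrow> 0" using x(1) by blast
  qed
  moreover have "\<exists>i\<in>I. \<exists>C. \<forall>x\<in>X. Q n x \<le> C * q i x" for n
  proof (cases n)
    case 0
    then show ?thesis using idx[of 0] by (auto simp: Q_simps intro!: bexI[of _ "idx 0"] exI[of _ 0])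
  next
    case (Suc m)
    then show ?thesis using ix[of m] by (auto simp: Q_simps)
  qed
  ultimately show thesis using compare by (intro that[of Q]) blast+
qed

section \<open>Comparison of the grading with the given seminorms\<close>

context graded_schwartz
begin

context
  fixes I :: "'i set" and q :: "'i \<Rightarrow> 'v \<Rightarrow> real"
  assumes q_nonneg: "\<And>i x. i \<in> I \<Longrightarrow> x \<in> X \<Longrightarrow> 0 \<le> q i x"
    and q_le_Q: "\<And>i. i \<in> I \<Longrightarrow> \<exists>n C. \<forall>x\<in>X. q i x \<le> C * Q n x"
    and Q_le_q: "\<And>n. \<exists>i\<in>I. \<exists>C. \<forall>x\<in>X. Q n x \<le> C * q i x"
begin

text \<open>The dual and the open sets of the given seminorms refer to finite subfamilies; by
  monotonicity of the grading a single member of large index controls each of these.\<close>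

lemma finite_sum_le_Q:
  assumes "finite F" "F \<subseteq> I"
  shows "\<exists>n C. 0 \<le> C \<and> (\<forall>x\<in>X. (\<Sum>i\<in>F. q i x) \<le> C * Q n x)"
  using assms
proof (induction F rule: finite_induct)
  case empty
  then show ?case by (intro exI[of _ 0]) simp
next
  case (insert i F)
  then obtain n C where C: "0 \<le> C" "\<forall>x\<in>X. (\<Sum>i\<in>F. q i x) \<le> C * Q n x" by auto
  obtain m B where B: "\<forall>x\<in>X. q i x \<le> B * Q m x" using q_le_Q insert by blast
  have "(\<Sum>j\<in>insert i F. q j x) \<le> (\<bar>B\<bar> + C) * Q (max m n) x" if x: "x \<in> X" for x
  proof -
    have "B * Q m x \<le> \<bar>B\<bar> * Q m x" by (intro mult_right_mono Q_nonneg x) simp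
    moreover have "\<bar>B\<bar> * Q m x \<le> \<bar>B\<bar> * Q (max m n) x" by (intro mult_left_mono Q_mono x) simp_all
    moreover have "C * Q n x \<le> C * Q (max m n) x" by (intro mult_left_mono Q_mono x C) simp
    moreover have "q i x \<le> B * Q m x" "(\<Sum>i\<in>F. q i x) \<le> C * Q n x" using B C x by auto
    ultimately have "q i x + (\<Sum>i\<in>F. q i x) \<le> (\<bar>B\<bar> + C) * Q (max m n) x"
      unfolding distrib_right by linarith
    then show ?thesis using insert.hyps by simp
  qed
  then show ?case using C(1) by (intro exI[of _ "max m n"] exI[of _ "\<bar>B\<bar> + C"]) simp
qed

lemma lc_dual_eq_dual: "lc_dual X s I q = dual"
proof (intro subset_antisym subsetI)
  fix \<phi> assume \<phi>: "\<phi> \<in> lc_dual X s I q"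
  then obtain F B where F: "finite F" "F \<subseteq> I" "\<And>x. x \<in> X \<Longrightarrow> norm (\<phi> x) \<le> B * (\<Sum>i\<in>F. q i x)"
    unfolding lc_dual_def by blast
  obtain n C where C: "0 \<le> C" "\<And>x. x \<in> X \<Longrightarrow> (\<Sum>i\<in>F. q i x) \<le> C * Q n x"
    using finite_sum_le_Q[OF F(1,2)] by blast
  show "\<phi> \<in> dual"
  proof (rule dualI)
    fix x assume x: "x \<in> X"
    have "norm (\<phi> x) \<le> B * (\<Sum>i\<in>F. q i x)" by (rule F(3)[OF x])
    also have "\<dots> \<le> \<bar>B\<bar> * (\<Sum>i\<in>F. q i x)"
      using F(2) x by (intro mult_right_mono sum_nonneg q_nonneg) auto
    also have "\<dots> \<le> \<bar>B\<bar> * (C * Q n x)" by (intro mult_left_mono C x) simp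
    finally show "norm (\<phi> x) \<le> (\<bar>B\<bar> * C) * Q n x" by (simp add: mult.assoc)
  qed (use \<phi> in \<open>auto simp: lc_dual_def\<close>)
next
  fix \<phi> assume \<phi>: "\<phi> \<in> dual"
  then obtain n where n: "\<phi> \<in> polar n" by (rule dual_polarE)
  obtain i C where "i \<in> I" "\<And>x. x \<in> X \<Longrightarrow> Q n x \<le> C * q i x" using Q_le_q by blast
  then have "finite {i} \<and> {i} \<subseteq> I \<and> (\<forall>x\<in>X. norm (\<phi> x) \<le> C * (\<Sum>i\<in>{i}. q i x))"
    using polar_bound[OF n] by (force intro: order_trans)
  then have "\<exists>F C. finite F \<and> F \<subseteq> I \<and> (\<forall>x\<in>X. norm (\<phi> x) \<le> C * (\<Sum>i\<in>F. q i x))" by blast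
  then show "\<phi> \<in> lc_dual X s I q"
    unfolding lc_dual_def using dual_add[OF \<phi>] dual_scale[OF \<phi>] dual_outside[OF \<phi>] by blast
qed

lemma lc_compact_null_hull:
  assumes xs: "\<And>k. xs k \<in> X" and null: "\<And>n. (\<lambda>k. Q n (xs k)) \<longlonglongrightarrow> 0"
  shows "lc_compact X I q (null_hull xs)"
  unfolding lc_compact_def
proof (intro conjI allI impI)
  show "null_hull xs \<subseteq> X" by (auto simp: null_hull_def series_limit_def)
  fix \<U> assume \<U>: "(\<forall>U\<in>\<U>. lc_open X I q U) \<and> null_hull xs \<subseteq> \<Union>\<U>"
  show "\<exists>\<V>\<subseteq>\<U>. finite \<V> \<and> null_hull xs \<subseteq> \<Union>\<V>"
  proof (rule null_hull_finite_subcover[OF xs null])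
    fix U x assume "U \<in> \<U>" "x \<in> U"
    then have "lc_open X I q U" using \<U> by blast
    then obtain F \<epsilon> where F: "finite F" "F \<subseteq> I" "0 < \<epsilon>" "{y\<in>X. \<forall>i\<in>F. q i (y - x) < \<epsilon>} \<subseteq> U"
      and x: "x \<in> X"
      using \<open>x \<in> U\<close> unfolding lc_open_def by blast
    obtain n C where C: "0 \<le> C" and sum_le: "\<And>x. x \<in> X \<Longrightarrow> (\<Sum>i\<in>F. q i x) \<le> C * Q n x"
      using finite_sum_le_Q[OF F(1,2)] by blast
    have "q i (y - x) < \<epsilon>" if y: "y \<in> X" "Q n (y - x) < \<epsilon> / (C + 1)" and i: "i \<in> F" for y i
    proof -
      have "q i (y - x) \<le> (\<Sum>i\<in>F. q i (y - x))"
        using i F(1,2) X_diff[OF y(1) x] by (intro member_le_sum q_nonneg) auto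
      also have "\<dots> \<le> C * Q n (y - x)" by (intro sum_le X_diff y x)
      also have "\<dots> \<le> C * (\<epsilon> / (C + 1))" using y(2) C(1) by (intro mult_left_mono) auto
      also have "\<dots> < \<epsilon>" using C(1) F(3) by (simp add: pos_divide_less_eq algebra_simps)
      finally show ?thesis .
    qed
    then have "{y\<in>X. Q n (y - x) < \<epsilon> / (C + 1)} \<subseteq> U" using F(4) by blast
    then show "\<exists>n. \<exists>\<epsilon>>0. {y\<in>X. Q n (y - x) < \<epsilon>} \<subseteq> U"
      using C(1) F(3) by (intro exI[of _ n] exI[of _ "\<epsilon> / (C + 1)"]) simp
  qed (use \<U> in blast)
qed

end

end

section \<open>The scalar weighted space\<close>

lemma vector_space_fscale: "Vector_Spaces.vector_space (fscale ((*) :: 'k::real_normed_field \<Rightarrow> 'k \<Rightarrow> 'k))"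
  by unfold_locales (auto simp: fscale_def algebra_simps)

context
  fixes \<Omega> :: "'x set" and J :: "'j set" and L :: "'l set" and M :: "'l \<Rightarrow> 'm set"
    and \<nu> :: "'j \<Rightarrow> 'l \<Rightarrow> 'm \<Rightarrow> 'x \<Rightarrow> real" and M0 Mr :: "'m set" and \<omega> :: "'m \<Rightarrow> 'x set"
    and D :: "'m \<Rightarrow> ('x \<Rightarrow> 'k::real_normed_field) set" and T :: "'m \<Rightarrow> ('x \<Rightarrow> 'k) \<Rightarrow> 'x \<Rightarrow> 'k"
    and X and q :: "'j \<times> 'l \<times> unit \<Rightarrow> ('x \<Rightarrow> 'k) \<Rightarrow> real"
  assumes weights: "weight_data \<Omega> J L M \<nu> M0 Mr \<omega>"
    and lin: "linear_ops \<Omega> (Mall L M M0 Mr) (*) \<omega> D T"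
  defines "X \<equiv> FVsp \<Omega> J L M \<nu> M0 Mr \<omega> {()} (\<lambda>_ z. norm z) D T"
    and "q \<equiv> FVsemi \<Omega> M \<nu> (\<lambda>_ z. norm z) T"
begin

lemma FVsp_iff: "f \<in> X \<longleftrightarrow> (\<forall>m\<in>Mall L M M0 Mr. f \<in> D m) \<and> (\<forall>m\<in>M0. \<forall>x\<in>\<omega> m. T m f x = 0)
    \<and> (\<forall>j\<in>J. \<forall>l\<in>L. \<exists>B. \<forall>x\<in>\<Omega>. \<forall>m\<in>M l. norm (T m f x) * \<nu> j l m x \<le> B)"
proof -
  have "bdd_above {norm (T m f x) * \<nu> j l m x | x m. x \<in> \<Omega> \<and> m \<in> M l}
      \<longleftrightarrow> (\<exists>B. \<forall>x\<in>\<Omega>. \<forall>m\<in>M l. norm (T m f x) * \<nu> j l m x \<le> B)" for j l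
    unfolding bdd_above_def by blast
  then show ?thesis by (simp add: X_def FVsp_def)
qed

lemma weight_nonneg: "0 \<le> \<nu> j l m x"
  using weights by (simp add: weight_data_def)

text \<open>Membership in X is what bounds the weighted values, so that the supremum in the seminorm
  is attached to a bounded set.\<close>

lemma FVsemi_upper:
  assumes "f \<in> X" "j \<in> J" "l \<in> L" "x \<in> \<Omega>" "m \<in> M l"
  shows "norm (T m f x) * \<nu> j l m x \<le> q (j, l, ()) f"
proof -
  obtain B where "\<forall>x\<in>\<Omega>. \<forall>m\<in>M l. norm (T m f x) * \<nu> j l m x \<le> B"
    using assms(1-3) unfolding FVsp_iff by blast
  then have "bdd_above ((\<lambda>(x, m). norm (T m f x) * \<nu> j l m x) ` (\<Omega> \<times> M l))"
    by (intro bdd_aboveI[of _ B]) auto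
  from cSUP_upper[OF _ this, of "(x, m)"] assms(4,5) show ?thesis by (simp add: q_def FVsemi_def)
qed

lemma FVsemi_least:
  assumes "l \<in> L" "\<And>x m. x \<in> \<Omega> \<Longrightarrow> m \<in> M l \<Longrightarrow> norm (T m f x) * \<nu> j l m x \<le> B"
  shows "q (j, l, ()) f \<le> B"
  unfolding q_def FVsemi_def split
  by (rule cSUP_least) (use assms weights in \<open>auto simp: weight_data_def\<close>)

lemma FV_op_add: "f \<in> X \<Longrightarrow> g \<in> X \<Longrightarrow> m \<in> Mall L M M0 Mr \<Longrightarrow> x \<in> \<omega> m \<Longrightarrow> T m (f + g) x = T m f x + T m g x"
  and FV_dom_add: "f \<in> X \<Longrightarrow> g \<in> X \<Longrightarrow> m \<in> Mall L M M0 Mr \<Longrightarrow> f + g \<in> D m"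
  and FV_op_scale: "f \<in> X \<Longrightarrow> m \<in> Mall L M M0 Mr \<Longrightarrow> x \<in> \<omega> m \<Longrightarrow> T m (fscale (*) c f) x = c * T m f x"
  and FV_dom_scale: "f \<in> X \<Longrightarrow> m \<in> Mall L M M0 Mr \<Longrightarrow> fscale (*) c f \<in> D m"
  using lin unfolding linear_ops_def FVsp_iff fscale_def plus_fun_def by blast+

lemma FV_op_zero: "m \<in> Mall L M M0 Mr \<Longrightarrow> x \<in> \<omega> m \<Longrightarrow> T m 0 x = 0"
  and FV_dom_zero: "m \<in> Mall L M M0 Mr \<Longrightarrow> 0 \<in> D m"
proof -
  assume m: "m \<in> Mall L M M0 Mr"
  then have dom: "(\<lambda>x. 0) \<in> D m" using lin unfolding linear_ops_def by blast
  then show "0 \<in> D m" by (simp add: zero_fun_def)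
  assume x: "x \<in> \<omega> m"
  have "\<forall>c. \<forall>f\<in>D m. (\<lambda>x. c * f x) \<in> D m \<and> (\<forall>x\<in>\<omega> m. T m (\<lambda>x. c * f x) x = c * T m f x)"
    using lin m unfolding linear_ops_def by blast
  from this[THEN spec, of 0, THEN bspec, OF dom] x show "T m 0 x = 0" by (simp add: zero_fun_def)
qed

lemma domain_subset: "l \<in> L \<Longrightarrow> m \<in> M l \<Longrightarrow> x \<in> \<Omega> \<Longrightarrow> x \<in> \<omega> m"
  and mem_Mall: "l \<in> L \<Longrightarrow> m \<in> M l \<Longrightarrow> m \<in> Mall L M M0 Mr"
proof -
  have "\<forall>m\<in>(\<Union>l\<in>L. M l). \<Omega> \<subseteq> \<omega> m" using weights by (simp add: weight_data_def)
  then show "l \<in> L \<Longrightarrow> m \<in> M l \<Longrightarrow> x \<in> \<Omega> \<Longrightarrow> x \<in> \<omega> m" by blast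
qed auto

lemma FVsp_add_bound:
  assumes "f \<in> X" "g \<in> X" "j \<in> J" "l \<in> L" "x \<in> \<Omega>" "m \<in> M l"
  shows "norm (T m (f + g) x) * \<nu> j l m x \<le> q (j, l, ()) f + q (j, l, ()) g"
proof -
  have "T m (f + g) x = T m f x + T m g x"
    by (rule FV_op_add[OF assms(1,2) mem_Mall domain_subset]) (rule assms)+
  then have "norm (T m (f + g) x) * \<nu> j l m x \<le> (norm (T m f x) + norm (T m g x)) * \<nu> j l m x"
    by (simp add: mult_right_mono norm_triangle_ineq weight_nonneg)
  also have "\<dots> \<le> q (j, l, ()) f + q (j, l, ()) g"
    unfolding distrib_right by (intro add_mono FVsemi_upper assms)
  finally show ?thesis .
qed

lemma FVsp_scale_bound:
  assumes "f \<in> X" "j \<in> J" "l \<in> L" "x \<in> \<Omega>" "m \<in> M l"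
  shows "norm (T m (fscale (*) c f) x) * \<nu> j l m x \<le> norm c * q (j, l, ()) f"
proof -
  have "T m (fscale (*) c f) x = c * T m f x"
    by (rule FV_op_scale[OF assms(1) mem_Mall domain_subset]) (rule assms)+
  then show ?thesis
    using mult_left_mono[OF FVsemi_upper[OF assms], of "norm c"] by (simp add: norm_mult mult.assoc)
qed

lemma subspace_FVsp: "module.subspace (fscale (*)) X"
proof -
  interpret vector_space "fscale ((*) :: 'k \<Rightarrow> _)" by (rule vector_space_fscale)
  show ?thesis
    unfolding subspace_def
  proof (intro conjI ballI allI)
    have "T m 0 x = 0" if "l \<in> L" "m \<in> M l" "x \<in> \<Omega>" for l m x
      by (rule FV_op_zero[OF mem_Mall domain_subset]) (rule that)+
    then show "0 \<in> X"
      unfolding FVsp_iff using FV_op_zero FV_dom_zero by (auto intro!: exI[of _ 0])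
    fix f assume f: "f \<in> X"
    show "fscale (*) c f \<in> X" for c
      unfolding FVsp_iff
    proof (intro conjI ballI)
      show "T m (fscale (*) c f) x = 0" if "m \<in> M0" "x \<in> \<omega> m" for m x
        using that f FV_op_scale[OF f, of m x c] by (simp add: FVsp_iff)
      show "\<exists>B. \<forall>x\<in>\<Omega>. \<forall>m\<in>M l. norm (T m (fscale (*) c f) x) * \<nu> j l m x \<le> B" if "j \<in> J" "l \<in> L" for j l
        using FVsp_scale_bound[OF f that] by blast
    qed (rule FV_dom_scale[OF f])
    fix g assume g: "g \<in> X"
    show "f + g \<in> X"
      unfolding FVsp_iff
    proof (intro conjI ballI)
      show "T m (f + g) x = 0" if "m \<in> M0" "x \<in> \<omega> m" for m x
        using that f g FV_op_add[OF f g, of m x] by (simp add: FVsp_iff)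
      show "\<exists>B. \<forall>x\<in>\<Omega>. \<forall>m\<in>M l. norm (T m (f + g) x) * \<nu> j l m x \<le> B" if "j \<in> J" "l \<in> L" for j l
        using FVsp_add_bound[OF f g that] by blast
    qed (rule FV_dom_add[OF f g])
  qed
qed

lemma FVsemi_add:
  assumes "i \<in> J \<times> L \<times> {()}" "f \<in> X" "g \<in> X"
  shows "q i (f + g) \<le> q i f + q i g"
  using assms by (auto intro!: FVsemi_least FVsp_add_bound)

text \<open>The termwise estimate gives one inequality for every scalar, and for the inverse of c
  applied to c f it gives the other. For c = 0 the seminorm must be non-negative, which holds
  because its supremum runs over a non-empty set.\<close>

lemma FVsemi_scale:
  assumes i: "i \<in> J \<times> L \<times> {()}" and f: "f \<in> X"
  shows "q i (fscale (*) c f) = norm c * q i f"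
proof -
  interpret vector_space "fscale ((*) :: 'k \<Rightarrow> _)" by (rule vector_space_fscale)
  have le: "q i (fscale (*) c f) \<le> norm c * q i f" if "f \<in> X" for c f
    using i that by (auto intro!: FVsemi_least FVsp_scale_bound)
  have ge: "norm c * q i f \<le> q i (fscale (*) c f)" if "c \<noteq> 0"
  proof -
    have "q i (fscale (*) (inverse c) (fscale (*) c f)) \<le> norm (inverse c) * q i (fscale (*) c f)"
      by (rule le[OF subspace_scale[OF subspace_FVsp f]])
    then show ?thesis using that by (simp add: norm_divide field_simps)
  qed
  have nonneg: "0 \<le> q i f" if "f \<in> X" for f
  proof -
    obtain j l where jl: "j \<in> J" "l \<in> L" "i = (j, l, ())" using i by auto
    have "\<Omega> \<noteq> {}" "M l \<noteq> {}" using weights jl(2) by (simp_all add: weight_data_def)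
    then obtain x m where "x \<in> \<Omega>" "m \<in> M l" by blast
    then show ?thesis
      using FVsemi_upper[OF that jl(1,2), of x m] weight_nonneg[of j l m x] jl(3)
      by (meson mult_nonneg_nonneg norm_ge_zero order_trans)
  qed
  show ?thesis
    using le[OF f, of c] ge nonneg[OF subspace_scale[OF subspace_FVsp f], of c] by (cases "c = 0") force+
qed

end

section \<open>Surjectivity of the restriction map\<close>

theorem theorem3p16:
  fixes sE :: "'k::{real_normed_field,banach} \<Rightarrow> 'e::ab_group_add \<Rightarrow> 'e"
    and A :: "'a set" and p :: "'a \<Rightarrow> 'e \<Rightarrow> real"
    and G :: "('e \<Rightarrow> 'k) set"
    and \<Omega> :: "'x set" and J :: "'j set" and L :: "'l set" and M :: "'l \<Rightarrow> 'm set"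
    and \<nu> :: "'j \<Rightarrow> 'l \<Rightarrow> 'm \<Rightarrow> 'x \<Rightarrow> real"
    and M0 Mr :: "'m set" and \<omega> :: "'m \<Rightarrow> 'x set"
    and domK :: "'m \<Rightarrow> ('x \<Rightarrow> 'k) set" and TK :: "'m \<Rightarrow> ('x \<Rightarrow> 'k) \<Rightarrow> 'x \<Rightarrow> 'k"
    and domE :: "'m \<Rightarrow> ('x \<Rightarrow> 'e) set" and TE :: "'m \<Rightarrow> ('x \<Rightarrow> 'e) \<Rightarrow> 'x \<Rightarrow> 'e"
    and U :: "('m \<times> 'x) set"
  defines "MM \<equiv> Mall L M M0 Mr"
    and "FVK \<equiv> FVsp \<Omega> J L M \<nu> M0 Mr \<omega> {()} (\<lambda>_ z. norm z) domK TK"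
    and "IK \<equiv> J \<times> L \<times> {()}"
    and "qK \<equiv> FVsemi \<Omega> M \<nu> (\<lambda>_ z. norm z) TK"
    and "FVE \<equiv> FVsp \<Omega> J L M \<nu> M0 Mr \<omega> A p domE TE"
    and "IE \<equiv> J \<times> L \<times> A"
    and "qE \<equiv> FVsemi \<Omega> M \<nu> p TE"
    and "Edual \<equiv> lc_dual UNIV sE A p"
    and "FVdual \<equiv> lc_dual (FVsp \<Omega> J L M \<nu> M0 Mr \<omega> {()} (\<lambda>_ z. norm z) domK TK) (fscale (*))
           (J \<times> L \<times> {()}) (FVsemi \<Omega> M \<nu> (\<lambda>_ z. norm z) TK)"
    and "EPS \<equiv> eps_prod (FVsp \<Omega> J L M \<nu> M0 Mr \<omega> {()} (\<lambda>_ z. norm z) domK TK)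
           (J \<times> L \<times> {()}) (FVsemi \<Omega> M \<nu> (\<lambda>_ z. norm z) TK) sE A p"
    and "S \<equiv> Smap (FVsp \<Omega> J L M \<nu> M0 Mr \<omega> {()} (\<lambda>_ z. norm z) domK TK) \<Omega>"
  assumes E_lcHs: "lcHs sE A p" and E_directed: "directed_seminorms UNIV A p"
    and E_nontrivial: "\<exists>x::'e. x \<noteq> 0"
    and E_loc_complete: "locally_complete sE A p"
    and G_sub: "G \<subseteq> Edual" and G_lin: "linear_subspace_fun G"
    and G_det: "determines_boundedness A p G"
    and weights: "weight_data \<Omega> J L M \<nu> M0 Mr \<omega>"
    and TK_lin: "linear_ops \<Omega> MM (*) \<omega> domK TK"
    and TE_lin: "linear_ops \<Omega> MM sE \<omega> domE TE"
    and FVK_dom: "directed_seminorms FVK IK qK \<and> (\<forall>x\<in>\<Omega>. restr FVK (\<lambda>f. f x) \<in> FVdual)"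
    and FVE_dom: "directed_seminorms FVE IE qE"
    and consistent: "\<forall>u\<in>EPS. \<forall>m\<in>MM. S u \<in> domE m \<and>
         (\<forall>x\<in>\<omega> m. restr FVK (\<lambda>f. TK m f x) \<in> FVdual \<and> TE m (S u) x = u (restr FVK (\<lambda>f. TK m f x)))"
    and strong: "\<forall>e'\<in>Edual. \<forall>f\<in>FVE. \<forall>m\<in>MM. (\<lambda>x. e' (f x)) \<in> domK m \<and>
         (\<forall>x\<in>\<omega> m. TK m (\<lambda>x. e' (f x)) x = e' (TE m f x))"
    and FS: "frechet_schwartz FVK IK qK"
    and U_sub: "U \<subseteq> Sigma MM \<omega>"
    and U_cont: "\<forall>(m, x)\<in>U. restr FVK (\<lambda>f. TK m f x) \<in> FVdual"
    and U_uniq: "\<forall>f\<in>FVK. (\<forall>(m, x)\<in>U. TK m f x = 0) \<longrightarrow> f = (\<lambda>x. 0)"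
  shows "\<forall>F\<in>{F :: 'm \<times> 'x \<Rightarrow> 'e. \<forall>g\<in>G. \<exists>h\<in>FVK. \<forall>(m, x)\<in>U. TK m h x = g (F (m, x))}.
           \<exists>u\<in>EPS. \<forall>(m, x)\<in>U. TE m (S u) x = F (m, x)"
proof -
  note lin = TK_lin[unfolded MM_def]
  note sub = subspace_FVsp[OF weights lin, folded FVK_def]
  note q_add = FVsemi_add[OF weights lin, folded FVK_def qK_def IK_def]
  note q_scale = FVsemi_scale[OF weights lin, folded FVK_def qK_def IK_def]
  have "IK \<noteq> {}" using weights by (auto simp: IK_def weight_data_def)
  obtain Q where graded: "graded_schwartz (fscale ((*) :: 'k \<Rightarrow> 'k \<Rightarrow> 'k)) FVK Q"
    and q_le_Q: "\<And>i. i \<in> IK \<Longrightarrow> \<exists>n C. \<forall>x\<in>FVK. qK i x \<le> C * Q n x"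
    and Q_le_q: "\<And>n. \<exists>i\<in>IK. \<exists>C. \<forall>x\<in>FVK. Q n x \<le> C * qK i x"
    using frechet_schwartz_graded[OF vector_space_fscale sub q_add q_scale \<open>IK \<noteq> {}\<close> conjunct1[OF FVK_dom] FS]
    by blast
  interpret graded_schwartz_banach "fscale ((*) :: 'k \<Rightarrow> 'k \<Rightarrow> 'k)" FVK Q
    using graded by (simp add: graded_schwartz_banach_def)
  have q_nonneg: "0 \<le> qK i x" if "i \<in> IK" "x \<in> FVK" for i x
    using q_add[OF that, of "fscale (*) (-1) x"] q_scale[OF that, of "-1"] q_scale[OF that, of 0]
      X_scale[OF that(2), of "-1"] by simp
  have lc_dual: "lc_dual FVK (fscale (*)) IK qK = dual"
  proof (rule lc_dual_eq_dual)
    show "0 \<le> qK i x" if "i \<in> IK" "x \<in> FVK" for i x using that by (rule q_nonneg)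
    show "\<exists>n C. \<forall>x\<in>FVK. qK i x \<le> C * Q n x" if "i \<in> IK" for i using that by (rule q_le_Q)
    show "\<exists>i\<in>IK. \<exists>C. \<forall>x\<in>FVK. Q n x \<le> C * qK i x" for n by (rule Q_le_q)
  qed
  have compact_hull: "lc_compact FVK IK qK (null_hull xs)"
    if xs: "\<And>k. xs k \<in> FVK" "\<And>n. (\<lambda>k. Q n (xs k)) \<longlonglongrightarrow> 0" for xs
  proof (rule lc_compact_null_hull)
    show "0 \<le> qK i x" if "i \<in> IK" "x \<in> FVK" for i x using that by (rule q_nonneg)
    show "\<exists>n C. \<forall>x\<in>FVK. qK i x \<le> C * Q n x" if "i \<in> IK" for i using that by (rule q_le_Q)
    show "\<exists>i\<in>IK. \<exists>C. \<forall>x\<in>FVK. Q n x \<le> C * qK i x" for n by (rule Q_le_q)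
  qed (rule xs)+
  have "FVdual = lc_dual FVK (fscale (*)) IK qK"
    by (simp only: FVdual_def FVK_def IK_def qK_def)
  then have FVdual: "FVdual = dual" using lc_dual by simp
  have EPS: "EPS = eps_prod FVK IK qK sE A p"
    by (simp only: EPS_def FVK_def IK_def qK_def)
  show ?thesis
  proof
    fix F assume "F \<in> {F :: 'm \<times> 'x \<Rightarrow> 'e. \<forall>g\<in>G. \<exists>h\<in>FVK. \<forall>(m, x)\<in>U. TK m h x = g (F (m, x))}"
    then have "\<forall>g\<in>G. \<exists>h. h \<in> FVK \<and> (\<forall>(m, x)\<in>U. TK m h x = g (F (m, x)))" by (simp add: Bex_def)
    from bchoice[OF this] obtain f
      where f_choice: "\<forall>g\<in>G. f g \<in> FVK \<and> (\<forall>(m, x)\<in>U. TK m (f g) x = g (F (m, x)))" ..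
    have f: "f g \<in> FVK" if "g \<in> G" for g using f_choice that by simp
    have fF: "TK m (f g) x = g (F (m, x))" if g: "g \<in> G" and mx: "(m, x) \<in> U" for g m x
      using bspec[OF conjunct2[OF bspec[OF f_choice g]] mx] by simp
    have delta: "restr FVK (\<lambda>f. TK m f x) \<in> dual" if "(m, x) \<in> U" for m x
      using bspec[OF U_cont that] unfolding FVdual by simp
    \<comment> \<open>\<open>F (m, x)\<close> represents the functional of (m, x). This serves
      twice: the represented functionals separate points, as \<open>U\<close> is a set of
      uniqueness, and uniqueness of representing vectors identifies \<open>u\<close> on
      them.\<close>
    have delta_F: "\<forall>g\<in>G. g (F (m, x)) = restr FVK (\<lambda>f. TK m f x) (f g)" if "(m, x) \<in> U" for m x
      using fF[OF _ that] f by (simp add: restr_def)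
    have separating: "h = 0"
      if h: "h \<in> FVK" and zero: "\<And>\<phi> e. \<phi> \<in> dual \<Longrightarrow> \<forall>g\<in>G. g e = \<phi> (f g) \<Longrightarrow> \<phi> h = 0" for h
    proof -
      have "TK m h x = 0" if "(m, x) \<in> U" for m x
        using zero[OF delta[OF that] delta_F[OF that]] h by (simp add: restr_def)
      then have "\<forall>(m, x)\<in>U. TK m h x = 0" by auto
      then have "h = (\<lambda>x. 0)" using bspec[OF U_uniq h] by simp
      then show ?thesis by (simp add: zero_fun_def)
    qed
    obtain u where u: "\<And>\<phi> g. \<phi> \<in> dual \<Longrightarrow> g \<in> G \<Longrightarrow> g (u \<phi>) = \<phi> (f g)"
      and u_eq: "\<And>\<phi> e. \<phi> \<in> dual \<Longrightarrow> \<forall>g\<in>G. g e = \<phi> (f g) \<Longrightarrow> u \<phi> = e"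
      and u_bound: "\<And>\<alpha> n. \<alpha> \<in> A \<Longrightarrow> \<exists>M. \<forall>\<phi>\<in>polar n. p \<alpha> (u \<phi>) \<le> M"
    proof (rule weak_extension[OF E_lcHs E_loc_complete G_sub[unfolded Edual_def] G_det])
      show "f g \<in> FVK" if "g \<in> G" for g by (rule f[OF that])
      show "h = 0" if "h \<in> FVK" "\<And>\<phi> e. \<phi> \<in> dual \<Longrightarrow> \<forall>g\<in>G. g e = \<phi> (f g) \<Longrightarrow> \<phi> h = 0" for h
        using that(1) by (rule separating) (rule that(2))
    qed (rule that)
    have g_linear: "g (x + y) = g x + g y" "g (sE c x) = c * g x" if "g \<in> G" for g x y c
      using G_sub that by (auto simp: Edual_def lc_dual_def)
    \<comment> \<open>The values of \<open>u\<close> come from separate choices; uniqueness of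
      representing vectors makes \<open>u\<close> linear.\<close>
    have u_add: "u (\<lambda>x. \<phi> x + \<psi> x) = u \<phi> + u \<psi>" if "\<phi> \<in> dual" "\<psi> \<in> dual" for \<phi> \<psi>
      by (rule u_eq) (use that in \<open>simp_all add: dual_add_fun g_linear u\<close>)
    have u_scale: "u (\<lambda>x. c * \<phi> x) = sE c (u \<phi>)" if "\<phi> \<in> dual" for c \<phi>
      by (rule u_eq) (use that in \<open>simp_all add: dual_scale_fun g_linear u\<close>)
    \<comment> \<open>Continuity for kappa, witnessed by the hull of a null sequence that depends on
      \<alpha>, with the constant 1.\<close>
    have "\<exists>K C. K \<noteq> {} \<and> lc_compact FVK IK qK K \<and> absconvex (fscale (*)) K \<and>
        (\<forall>\<phi>\<in>dual. p \<alpha> (u \<phi>) \<le> C * (SUP f\<in>K. norm (\<phi> f)))" if \<alpha>: "\<alpha> \<in> A" for \<alpha>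
    proof -
      have p: "p \<alpha> (x + y) \<le> p \<alpha> x + p \<alpha> y" "p \<alpha> (sE c x) = norm c * p \<alpha> x" for x y c
        using E_lcHs \<alpha> by (auto simp: lcHs_def)
      obtain xs where xs: "\<And>k. xs k \<in> FVK" "\<And>n. (\<lambda>k. Q n (xs k)) \<longlonglongrightarrow> 0"
        and le: "\<And>\<phi>. \<phi> \<in> dual \<Longrightarrow> p \<alpha> (u \<phi>) \<le> (SUP x\<in>null_hull xs. norm (\<phi> x))"
        using bounded_seminorm_on_dual[of "\<lambda>\<phi>. p \<alpha> (u \<phi>)"] u_add u_scale p u_bound[OF \<alpha>] by auto
      show ?thesis
        using compact_hull[OF xs] mem_null_hull[of xs 0, OF xs(1)] absconvex_null_hull[of xs, OF xs(1)] le
        by (intro exI[of _ "null_hull xs"] exI[of _ 1]) auto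
    qed
    then have "u \<in> EPS"
      unfolding EPS eps_prod_def lc_dual
      using u_add u_scale by simp
    \<comment> \<open>Consistency converts the operator applied to \<open>S u\<close> into the value
      of \<open>u\<close> at the functional of (m, x), which is already known.\<close>
    moreover have "TE m (S u) x = F (m, x)" if mx: "(m, x) \<in> U" for m x
    proof -
      have "m \<in> MM" "x \<in> \<omega> m" using U_sub mx by auto
      then have "TE m (S u) x = u (restr FVK (\<lambda>f. TK m f x))"
        using bspec[OF bspec[OF consistent \<open>u \<in> EPS\<close>] \<open>m \<in> MM\<close>] by simp
      also have "\<dots> = F (m, x)" by (rule u_eq[OF delta[OF mx] delta_F[OF mx]])
      finally show ?thesis .
    qed
    ultimately show "\<exists>u\<in>EPS. \<forall>(m, x)\<in>U. TE m (S u) x = F (m, x)" by blast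
  qed
qed

end
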